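(* Over $\mathsf{RCA}_0$, $\mathsf{AHT}_2$ implies $\mathsf{SRT}^2_2$, the Stable Ramsey's Theorem for pairs and $2$ colors; that is, $\mathsf{RCA}_0 \vdash \mathsf{AHT}_2 \rightarrow \mathsf{SRT}^2_2$.
   Context: $\mathsf{RCA}_0$ is the usual base system of reverse mathematics in second-order arithmetic; $\mathbf{N}$ denotes its first-order universe, and all principles below are statements in the language of second-order arithmetic. A map into $k$ means a map into $\{0,\dots,k-1\}$. $[\mathbf{N}]^2$ is the set of pairs $(x,y)$ of elements of $\mathbf{N}$ with $x<y$. For a positive integer $n=2^{t_1}+\dots+2^{t_p}$ with $t_1<\dots<t_p$, put $\lambda(n)=t_1$ and $\mu(n)=t_p$. A set $X$ of positive integers satisfies the Apartness Condition if for all $x,x'\in X$ with $x<x'$ we have $\mu(x)<\lambda(x')$. For an infinite set $H=\{h_1<h_2<h_3<\dots\}$, $AS(H)$ denotes the set of all finite sums of distinct adjacent elements of $H$, i.e. all sums $h_i+h_{i+1}+\dots+h_j$ with $i\le j$ (including single elements, $i=j$). $\mathsf{AHT}_k$ (Adjacent Hindman's Theorem for $k$ colors): for every $c:\mathbf{N}\to k$ there exists an infinite set $H$ of positive integers satisfying the Apartness Condition such that all elements of $AS(H)$ have the same $c$-color. A coloring $f:[\mathbf{N}]^2\to k$ is stable if for every $x$ the limit $\lim_{s\to\infty} f(x,s)$ exists, i.e. there are $d<k$ and $t>x$ with $f(x,s)=d$ for all $s\ge t$. $\mathsf{SRT}^2_k$: for every stable $f:[\mathbf{N}]^2\to k$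 there is an infinite set $J\subseteq\mathbf{N}$ and a color $d<k$ such that $f(x,y)=d$ for all $x<y$ in $J$. *)

theory Defs
  imports Main
begin

section \<open>The language of second-order arithmetic\<close>

text \<open>
  Following Gentzen, free variables (``parameters'' \<open>Par\<close>, \<open>SPar\<close>) are kept apart from the
  named variables (\<open>V\<close>, \<open>SV\<close>) that quantifiers bind.  The calculus below only ever substitutes
  terms without named variables, so substitution cannot capture.  Equality is primitive only for
  numbers.
\<close>

type_synonym name = string

datatype tm =
    V name
  | Par nat
  | ZeroT ("\<^bold>0")
  | OneT ("\<^bold>1")
  | Add tm tm (infixl "\<^bold>+" 65)
  | Mul tm tm (infixl "\<^bold>*" 70)

datatype st = SV name | SPar nat

datatype fm =
    Falsum ("\<^bold>\<bottom>")
  | Eq tm tm (infix "\<^bold>=" 50)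
  | Less tm tm (infix "\<^bold><" 50)
  | Mem tm st (infix "\<^bold>\<in>" 50)
  | Imp fm fm (infixr "\<^bold>\<longrightarrow>" 25)
  | Forall name fm ("(3\<^bold>\<forall>_./ _)" [0, 10] 10)
  | SForall name fm ("(3\<^bold>\<forall>\<^sub>S_./ _)" [0, 10] 10)

abbreviation Neg :: "fm \<Rightarrow> fm" ("\<^bold>\<not> _" [40] 40)
  where "\<^bold>\<not> p \<equiv> p \<^bold>\<longrightarrow> \<^bold>\<bottom>"

abbreviation Conj :: "fm \<Rightarrow> fm \<Rightarrow> fm" (infixr "\<^bold>\<and>" 35)
  where "p \<^bold>\<and> q \<equiv> \<^bold>\<not> (p \<^bold>\<longrightarrow> \<^bold>\<not> q)"

abbreviation Disj :: "fm \<Rightarrow> fm \<Rightarrow> fm" (infixr "\<^bold>\<or>" 30)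
  where "p \<^bold>\<or> q \<equiv> \<^bold>\<not> p \<^bold>\<longrightarrow> q"

abbreviation Iff :: "fm \<Rightarrow> fm \<Rightarrow> fm" (infix "\<^bold>\<longleftrightarrow>" 25)
  where "p \<^bold>\<longleftrightarrow> q \<equiv> (p \<^bold>\<longrightarrow> q) \<^bold>\<and> (q \<^bold>\<longrightarrow> p)"

abbreviation Exists :: "name \<Rightarrow> fm \<Rightarrow> fm" ("(3\<^bold>\<exists>_./ _)" [0, 10] 10)
  where "\<^bold>\<exists>x. p \<equiv> \<^bold>\<not> (\<^bold>\<forall>x. \<^bold>\<not> p)"

abbreviation SExists :: "name \<Rightarrow> fm \<Rightarrow> fm" ("(3\<^bold>\<exists>\<^sub>S_./ _)" [0, 10] 10)
  where "\<^bold>\<exists>\<^sub>SX. p \<equiv> \<^bold>\<not> (\<^bold>\<forall>\<^sub>SX. \<^bold>\<not> p)"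

abbreviation Le :: "tm \<Rightarrow> tm \<Rightarrow> fm" (infix "\<^bold>\<le>" 50)
  where "s \<^bold>\<le> t \<equiv> s \<^bold>< t \<^bold>\<or> s \<^bold>= t"

fun vars_tm :: "tm \<Rightarrow> name set" where
  "vars_tm (V x) = {x}"
| "vars_tm (Par a) = {}"
| "vars_tm \<^bold>0 = {}"
| "vars_tm \<^bold>1 = {}"
| "vars_tm (s \<^bold>+ t) = vars_tm s \<union> vars_tm t"
| "vars_tm (s \<^bold>* t) = vars_tm s \<union> vars_tm t"

fun pars_tm :: "tm \<Rightarrow> nat set" where
  "pars_tm (V x) = {}"
| "pars_tm (Par a) = {a}"
| "pars_tm \<^bold>0 = {}"
| "pars_tm \<^bold>1 = {}"
| "pars_tm (s \<^bold>+ t) = pars_tm s \<union> pars_tm t"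
| "pars_tm (s \<^bold>* t) = pars_tm s \<union> pars_tm t"

fun pars :: "fm \<Rightarrow> nat set" where
  "pars \<^bold>\<bottom> = {}"
| "pars (s \<^bold>= t) = pars_tm s \<union> pars_tm t"
| "pars (s \<^bold>< t) = pars_tm s \<union> pars_tm t"
| "pars (t \<^bold>\<in> A) = pars_tm t"
| "pars (p \<^bold>\<longrightarrow> q) = pars p \<union> pars q"
| "pars (\<^bold>\<forall>x. p) = pars p"
| "pars (\<^bold>\<forall>\<^sub>SX. p) = pars p"

fun spars_st :: "st \<Rightarrow> nat set" where
  "spars_st (SV X) = {}"
| "spars_st (SPar a) = {a}"

fun spars :: "fm \<Rightarrow> nat set" where
  "spars \<^bold>\<bottom> = {}"
| "spars (s \<^bold>= t) = {}"
| "spars (s \<^bold>< t) = {}"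
| "spars (t \<^bold>\<in> A) = spars_st A"
| "spars (p \<^bold>\<longrightarrow> q) = spars p \<union> spars q"
| "spars (\<^bold>\<forall>x. p) = spars p"
| "spars (\<^bold>\<forall>\<^sub>SX. p) = spars p"

fun free_svars_st :: "st \<Rightarrow> name set" where
  "free_svars_st (SV X) = {X}"
| "free_svars_st (SPar a) = {}"

fun free_svars :: "fm \<Rightarrow> name set" where
  "free_svars \<^bold>\<bottom> = {}"
| "free_svars (s \<^bold>= t) = {}"
| "free_svars (s \<^bold>< t) = {}"
| "free_svars (t \<^bold>\<in> A) = free_svars_st A"
| "free_svars (p \<^bold>\<longrightarrow> q) = free_svars p \<union> free_svars q"
| "free_svars (\<^bold>\<forall>x. p) = free_svars p"
| "free_svars (\<^bold>\<forall>\<^sub>SX. p) = free_svars p - {X}"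

fun subst_tm :: "name \<Rightarrow> tm \<Rightarrow> tm \<Rightarrow> tm" where
  "subst_tm x u (V y) = (if y = x then u else V y)"
| "subst_tm x u (Par a) = Par a"
| "subst_tm x u \<^bold>0 = \<^bold>0"
| "subst_tm x u \<^bold>1 = \<^bold>1"
| "subst_tm x u (s \<^bold>+ t) = subst_tm x u s \<^bold>+ subst_tm x u t"
| "subst_tm x u (s \<^bold>* t) = subst_tm x u s \<^bold>* subst_tm x u t"

fun subst :: "name \<Rightarrow> tm \<Rightarrow> fm \<Rightarrow> fm" where
  "subst x u \<^bold>\<bottom> = \<^bold>\<bottom>"
| "subst x u (s \<^bold>= t) = (subst_tm x u s \<^bold>= subst_tm x u t)"
| "subst x u (s \<^bold>< t) = (subst_tm x u s \<^bold>< subst_tm x u t)"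
| "subst x u (t \<^bold>\<in> A) = (subst_tm x u t \<^bold>\<in> A)"
| "subst x u (p \<^bold>\<longrightarrow> q) = (subst x u p \<^bold>\<longrightarrow> subst x u q)"
| "subst x u (\<^bold>\<forall>y. p) = (\<^bold>\<forall>y. if y = x then p else subst x u p)"
| "subst x u (\<^bold>\<forall>\<^sub>SX. p) = (\<^bold>\<forall>\<^sub>SX. subst x u p)"

fun ssubst_st :: "name \<Rightarrow> st \<Rightarrow> st \<Rightarrow> st" where
  "ssubst_st X U (SV Y) = (if Y = X then U else SV Y)"
| "ssubst_st X U (SPar a) = SPar a"

fun ssubst :: "name \<Rightarrow> st \<Rightarrow> fm \<Rightarrow> fm" where
  "ssubst X U \<^bold>\<bottom> = \<^bold>\<bottom>"
| "ssubst X U (s \<^bold>= t) = (s \<^bold>= t)"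
| "ssubst X U (s \<^bold>< t) = (s \<^bold>< t)"
| "ssubst X U (t \<^bold>\<in> A) = (t \<^bold>\<in> ssubst_st X U A)"
| "ssubst X U (p \<^bold>\<longrightarrow> q) = (ssubst X U p \<^bold>\<longrightarrow> ssubst X U q)"
| "ssubst X U (\<^bold>\<forall>x. p) = (\<^bold>\<forall>x. ssubst X U p)"
| "ssubst X U (\<^bold>\<forall>\<^sub>SY. p) = (\<^bold>\<forall>\<^sub>SY. if Y = X then p else ssubst X U p)"

section \<open>Classical two-sorted natural deduction\<close>

text \<open>
  \<open>T\<close> is a set of non-logical axioms and \<open>\<Gamma>\<close> a finite list of assumptions.  The eigenvariable
  conditions concern \<open>\<Gamma>\<close> only: the axioms in \<open>T\<close> stand for their universal closures.
\<close>

inductive deriv :: "fm set \<Rightarrow> fm list \<Rightarrow> fm \<Rightarrow> bool" for T :: "fm set" where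
  Axiom: "p \<in> T \<Longrightarrow> deriv T \<Gamma> p"
| Assm: "p \<in> set \<Gamma> \<Longrightarrow> deriv T \<Gamma> p"
| ImpI: "deriv T (p # \<Gamma>) q \<Longrightarrow> deriv T \<Gamma> (p \<^bold>\<longrightarrow> q)"
| ImpE: "deriv T \<Gamma> (p \<^bold>\<longrightarrow> q) \<Longrightarrow> deriv T \<Gamma> p \<Longrightarrow> deriv T \<Gamma> q"
| Class: "deriv T ((\<^bold>\<not> p) # \<Gamma>) \<^bold>\<bottom> \<Longrightarrow> deriv T \<Gamma> p"
| AllI: "deriv T \<Gamma> (subst x (Par a) p) \<Longrightarrow> a \<notin> pars p \<Longrightarrow> \<forall>q\<in>set \<Gamma>. a \<notin> pars q
    \<Longrightarrow> deriv T \<Gamma> (\<^bold>\<forall>x. p)"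
| AllE: "deriv T \<Gamma> (\<^bold>\<forall>x. p) \<Longrightarrow> vars_tm t = {} \<Longrightarrow> deriv T \<Gamma> (subst x t p)"
| SAllI: "deriv T \<Gamma> (ssubst X (SPar a) p) \<Longrightarrow> a \<notin> spars p \<Longrightarrow> \<forall>q\<in>set \<Gamma>. a \<notin> spars q
    \<Longrightarrow> deriv T \<Gamma> (\<^bold>\<forall>\<^sub>SX. p)"
| SAllE: "deriv T \<Gamma> (\<^bold>\<forall>\<^sub>SX. p) \<Longrightarrow> deriv T \<Gamma> (ssubst X (SPar a) p)"
| EqI: "deriv T \<Gamma> (t \<^bold>= t)"
| EqE: "deriv T \<Gamma> (s \<^bold>= t) \<Longrightarrow> deriv T \<Gamma> (subst x s p) \<Longrightarrow> vars_tm s = {} \<Longrightarrow> vars_tm t = {}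
    \<Longrightarrow> deriv T \<Gamma> (subst x t p)"

definition provable :: "fm set \<Rightarrow> fm \<Rightarrow> bool" (infix "\<^bold>\<turnstile>" 50)
  where "T \<^bold>\<turnstile> p \<longleftrightarrow> deriv T [] p"

section \<open>The theory \<open>RCA\<^sub>0\<close>\<close>

text \<open>Bounded-quantifier formulas; they may contain number and set parameters.\<close>

inductive bounded_fm :: "fm \<Rightarrow> bool" where
  "bounded_fm \<^bold>\<bottom>"
| "bounded_fm (s \<^bold>= t)"
| "bounded_fm (s \<^bold>< t)"
| "bounded_fm (t \<^bold>\<in> A)"
| "bounded_fm p \<Longrightarrow> bounded_fm q \<Longrightarrow> bounded_fm (p \<^bold>\<longrightarrow> q)"
| "bounded_fm p \<Longrightarrow> x \<notin> vars_tm t \<Longrightarrow> bounded_fm (\<^bold>\<forall>x. V x \<^bold>< t \<^bold>\<longrightarrow> p)"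
| "bounded_fm p \<Longrightarrow> x \<notin> vars_tm t \<Longrightarrow> bounded_fm (\<^bold>\<exists>x. V x \<^bold>< t \<^bold>\<and> p)"

definition Sigma01 :: "fm set"
  where "Sigma01 = {\<^bold>\<exists>x. p | x p. bounded_fm p}"

definition Pi01 :: "fm set"
  where "Pi01 = {\<^bold>\<forall>x. p | x p. bounded_fm p}"

definition basic_axioms :: "fm set" where
  "basic_axioms =
    {\<^bold>\<forall>''n''. \<^bold>\<not> (V ''n'' \<^bold>+ \<^bold>1 \<^bold>= \<^bold>0),
     \<^bold>\<forall>''m''. \<^bold>\<forall>''n''. V ''m'' \<^bold>+ \<^bold>1 \<^bold>= V ''n'' \<^bold>+ \<^bold>1 \<^bold>\<longrightarrow> V ''m'' \<^bold>= V ''n'',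
     \<^bold>\<forall>''m''. V ''m'' \<^bold>+ \<^bold>0 \<^bold>= V ''m'',
     \<^bold>\<forall>''m''. \<^bold>\<forall>''n''. V ''m'' \<^bold>+ (V ''n'' \<^bold>+ \<^bold>1) \<^bold>= (V ''m'' \<^bold>+ V ''n'') \<^bold>+ \<^bold>1,
     \<^bold>\<forall>''m''. V ''m'' \<^bold>* \<^bold>0 \<^bold>= \<^bold>0,
     \<^bold>\<forall>''m''. \<^bold>\<forall>''n''. V ''m'' \<^bold>* (V ''n'' \<^bold>+ \<^bold>1) \<^bold>= V ''m'' \<^bold>* V ''n'' \<^bold>+ V ''m'',
     \<^bold>\<forall>''m''. \<^bold>\<not> (V ''m'' \<^bold>< \<^bold>0),
     \<^bold>\<forall>''m''. \<^bold>\<forall>''n''. V ''m'' \<^bold>< V ''n'' \<^bold>+ \<^bold>1 \<^bold>\<longleftrightarrow> V ''m'' \<^bold>< V ''n'' \<^bold>\<or> V ''m'' \<^bold>= V ''n''}"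

text \<open>Substituting \<open>x + 1\<close> for \<open>x\<close> is capture-free, since \<open>subst\<close> stops at quantifiers over \<open>x\<close>.\<close>

definition Sigma01_induction :: "fm set" where
  "Sigma01_induction =
    {subst x \<^bold>0 p \<^bold>\<and> (\<^bold>\<forall>x. p \<^bold>\<longrightarrow> subst x (V x \<^bold>+ \<^bold>1) p) \<^bold>\<longrightarrow> (\<^bold>\<forall>x. p) | x p. p \<in> Sigma01}"

definition Delta01_comprehension :: "fm set" where
  "Delta01_comprehension =
    {(\<^bold>\<forall>x. p \<^bold>\<longleftrightarrow> q) \<^bold>\<longrightarrow> (\<^bold>\<exists>\<^sub>SX. \<^bold>\<forall>x. V x \<^bold>\<in> SV X \<^bold>\<longleftrightarrow> p) | x X p q.
      p \<in> Sigma01 \<and> q \<in> Pi01 \<and> X \<notin> free_svars p}"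

definition RCA0 :: "fm set"
  where "RCA0 = basic_axioms \<union> Sigma01_induction \<union> Delta01_comprehension"

section \<open>Functions, finite sums and powers of two in second-order arithmetic\<close>

text \<open>
  The formula builders below bind named variables, so their arguments must not contain the names
  bound in their bodies.  Functions are sets of pairs, with the usual code \<open>(i + j)\<^sup>2 + i\<close> for the
  pair of \<open>i\<close> and \<open>j\<close>.
\<close>

fun num_tm :: "nat \<Rightarrow> tm" where
  "num_tm 0 = \<^bold>0"
| "num_tm (Suc n) = num_tm n \<^bold>+ \<^bold>1"

definition pair_tm :: "tm \<Rightarrow> tm \<Rightarrow> tm"
  where "pair_tm s t = (s \<^bold>+ t) \<^bold>* (s \<^bold>+ t) \<^bold>+ s"

definition val :: "st \<Rightarrow> tm \<Rightarrow> tm \<Rightarrow> fm"  \<comment> \<open>\<open>F(s) = t\<close>\<close>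
  where "val F s t = (pair_tm s t \<^bold>\<in> F)"

definition is_fun :: "st \<Rightarrow> fm" where  \<comment> \<open>\<open>F : N \<rightarrow> N\<close>\<close>
  "is_fun F =
    ((\<^bold>\<forall>''z''. V ''z'' \<^bold>\<in> F \<^bold>\<longrightarrow> (\<^bold>\<exists>''x''. \<^bold>\<exists>''y''. V ''z'' \<^bold>= pair_tm (V ''x'') (V ''y''))) \<^bold>\<and>
     (\<^bold>\<forall>''x''. \<^bold>\<exists>''y''. val F (V ''x'') (V ''y'')) \<^bold>\<and>
     (\<^bold>\<forall>''x''. \<^bold>\<forall>''y''. \<^bold>\<forall>''z''. val F (V ''x'') (V ''y'') \<^bold>\<and> val F (V ''x'') (V ''z'')
        \<^bold>\<longrightarrow> V ''y'' \<^bold>= V ''z''))"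

definition is_fun_into :: "nat \<Rightarrow> st \<Rightarrow> fm" where  \<comment> \<open>\<open>F : N \<rightarrow> {0,\<dots>,k-1}\<close>\<close>
  "is_fun_into k F =
    (is_fun F \<^bold>\<and> (\<^bold>\<forall>''x''. \<^bold>\<forall>''y''. val F (V ''x'') (V ''y'') \<^bold>\<longrightarrow> V ''y'' \<^bold>< num_tm k))"

definition is_sum :: "st \<Rightarrow> tm \<Rightarrow> tm \<Rightarrow> tm \<Rightarrow> fm" where
  \<comment> \<open>\<open>s = F(i) + F(i+1) + \<dots> + F(i+n-1)\<close>, where \<open>G(l)\<close> is the sum of the first \<open>l\<close> summands\<close>
  "is_sum F i n s =
    (\<^bold>\<exists>\<^sub>S''G''. is_fun (SV ''G'') \<^bold>\<and>
      val (SV ''G'') \<^bold>0 \<^bold>0 \<^bold>\<and>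
      (\<^bold>\<forall>''l''. \<^bold>\<forall>''u''. \<^bold>\<forall>''v''. val (SV ''G'') (V ''l'') (V ''u'') \<^bold>\<and> val F (i \<^bold>+ V ''l'') (V ''v'')
        \<^bold>\<longrightarrow> val (SV ''G'') (V ''l'' \<^bold>+ \<^bold>1) (V ''u'' \<^bold>+ V ''v'')) \<^bold>\<and>
      val (SV ''G'') n s)"

definition is_pow2 :: "st \<Rightarrow> fm" where  \<comment> \<open>\<open>P(t) = 2^t\<close> for all \<open>t\<close>\<close>
  "is_pow2 P =
    (is_fun P \<^bold>\<and> val P \<^bold>0 \<^bold>1 \<^bold>\<and>
     (\<^bold>\<forall>''t''. \<^bold>\<forall>''u''. val P (V ''t'') (V ''u'') \<^bold>\<longrightarrow> val P (V ''t'' \<^bold>+ \<^bold>1) (num_tm 2 \<^bold>* V ''u'')))"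

text \<open>
  \<open>n = 2^T(0) + \<dots> + 2^T(q)\<close> with \<open>T(0) < \<dots> < T(q)\<close>.  The total function \<open>T\<close> plays the role of a
  finite sequence of length \<open>q + 1\<close>; its other values are irrelevant.
\<close>

definition is_binary_expansion :: "st \<Rightarrow> tm \<Rightarrow> tm \<Rightarrow> fm" where
  "is_binary_expansion T q n =
    (is_fun T \<^bold>\<and>
     (\<^bold>\<forall>''i''. \<^bold>\<forall>''j''. \<^bold>\<forall>''u''. \<^bold>\<forall>''v''.
        V ''i'' \<^bold>< V ''j'' \<^bold>\<and> V ''j'' \<^bold>\<le> q \<^bold>\<and> val T (V ''i'') (V ''u'') \<^bold>\<and> val T (V ''j'') (V ''v'')
        \<^bold>\<longrightarrow> V ''u'' \<^bold>< V ''v'') \<^bold>\<and>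
     (\<^bold>\<exists>\<^sub>S''P''. \<^bold>\<exists>\<^sub>S''Q''. is_pow2 (SV ''P'') \<^bold>\<and> is_fun (SV ''Q'') \<^bold>\<and>
        (\<^bold>\<forall>''l''. \<^bold>\<forall>''t''. \<^bold>\<forall>''u''. val T (V ''l'') (V ''t'') \<^bold>\<and> val (SV ''P'') (V ''t'') (V ''u'')
          \<^bold>\<longrightarrow> val (SV ''Q'') (V ''l'') (V ''u'')) \<^bold>\<and>
        is_sum (SV ''Q'') \<^bold>0 (q \<^bold>+ \<^bold>1) n))"

definition is_lambda :: "tm \<Rightarrow> tm \<Rightarrow> fm" where  \<comment> \<open>\<open>\<lambda>(n) = e\<close>\<close>
  "is_lambda n e =
    (\<^bold>\<exists>\<^sub>S''T''. \<^bold>\<exists>''q''. is_binary_expansion (SV ''T'') (V ''q'') n \<^bold>\<and> val (SV ''T'') \<^bold>0 e)"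

definition is_mu :: "tm \<Rightarrow> tm \<Rightarrow> fm" where  \<comment> \<open>\<open>\<mu>(n) = e\<close>\<close>
  "is_mu n e =
    (\<^bold>\<exists>\<^sub>S''T''. \<^bold>\<exists>''q''. is_binary_expansion (SV ''T'') (V ''q'') n \<^bold>\<and> val (SV ''T'') (V ''q'') e)"

section \<open>Adjacent Hindman's Theorem\<close>

definition is_infinite :: "st \<Rightarrow> fm" where
  "is_infinite X = (\<^bold>\<forall>''x''. \<^bold>\<exists>''y''. V ''x'' \<^bold>< V ''y'' \<^bold>\<and> V ''y'' \<^bold>\<in> X)"

definition is_apart :: "st \<Rightarrow> fm" where
  "is_apart X =
    (\<^bold>\<forall>''x''. \<^bold>\<forall>''y''. V ''x'' \<^bold>\<in> X \<^bold>\<and> V ''y'' \<^bold>\<in> X \<^bold>\<and> V ''x'' \<^bold>< V ''y'' \<^bold>\<longrightarrow>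
      (\<^bold>\<exists>''a''. \<^bold>\<exists>''b''. is_mu (V ''x'') (V ''a'') \<^bold>\<and> is_lambda (V ''y'') (V ''b'') \<^bold>\<and>
        V ''a'' \<^bold>< V ''b''))"

definition enumerates :: "st \<Rightarrow> st \<Rightarrow> fm" where
  \<comment> \<open>\<open>E : N \<rightarrow> N\<close> is strictly increasing with range \<open>X\<close>\<close>
  "enumerates E X =
    (is_fun E \<^bold>\<and>
     (\<^bold>\<forall>''i''. \<^bold>\<forall>''j''. \<^bold>\<forall>''u''. \<^bold>\<forall>''v''.
        V ''i'' \<^bold>< V ''j'' \<^bold>\<and> val E (V ''i'') (V ''u'') \<^bold>\<and> val E (V ''j'') (V ''v'')
        \<^bold>\<longrightarrow> V ''u'' \<^bold>< V ''v'') \<^bold>\<and>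
     (\<^bold>\<forall>''y''. V ''y'' \<^bold>\<in> X \<^bold>\<longleftrightarrow> (\<^bold>\<exists>''i''. val E (V ''i'') (V ''y''))))"

definition in_AS :: "st \<Rightarrow> tm \<Rightarrow> fm" where
  \<comment> \<open>\<open>s = h\<^sub>i + h\<^sub>i\<^sub>+\<^sub>1 + \<dots> + h\<^sub>i\<^sub>+\<^sub>m\<close> for some \<open>i\<close> and \<open>m\<close>, where \<open>E\<close> enumerates \<open>X = {h\<^sub>0 < h\<^sub>1 < \<dots>}\<close>\<close>
  "in_AS X s =
    (\<^bold>\<exists>\<^sub>S''E''. enumerates (SV ''E'') X \<^bold>\<and>
      (\<^bold>\<exists>''i''. \<^bold>\<exists>''m''. is_sum (SV ''E'') (V ''i'') (V ''m'' \<^bold>+ \<^bold>1) s))"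

definition AHT :: "nat \<Rightarrow> fm" where
  "AHT k =
    (\<^bold>\<forall>\<^sub>S''C''. is_fun_into k (SV ''C'') \<^bold>\<longrightarrow>
      (\<^bold>\<exists>\<^sub>S''H''. is_infinite (SV ''H'') \<^bold>\<and>
        (\<^bold>\<forall>''x''. V ''x'' \<^bold>\<in> SV ''H'' \<^bold>\<longrightarrow> \<^bold>0 \<^bold>< V ''x'') \<^bold>\<and>
        is_apart (SV ''H'') \<^bold>\<and>
        (\<^bold>\<exists>''d''. V ''d'' \<^bold>< num_tm k \<^bold>\<and>
          (\<^bold>\<forall>''s''. in_AS (SV ''H'') (V ''s'') \<^bold>\<longrightarrow> val (SV ''C'') (V ''s'') (V ''d'')))))"

section \<open>Stable Ramsey's Theorem for pairs\<close>

definition is_pair_coloring :: "nat \<Rightarrow> st \<Rightarrow> fm" where  \<comment> \<open>\<open>F : [N]\<^sup>2 \<rightarrow> {0,\<dots>,k-1}\<close>\<close>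
  "is_pair_coloring k F =
    ((\<^bold>\<forall>''z''. V ''z'' \<^bold>\<in> F \<^bold>\<longrightarrow> (\<^bold>\<exists>''x''. \<^bold>\<exists>''y''. \<^bold>\<exists>''i''. V ''x'' \<^bold>< V ''y'' \<^bold>\<and> V ''i'' \<^bold>< num_tm k \<^bold>\<and>
        V ''z'' \<^bold>= pair_tm (pair_tm (V ''x'') (V ''y'')) (V ''i''))) \<^bold>\<and>
     (\<^bold>\<forall>''x''. \<^bold>\<forall>''y''. V ''x'' \<^bold>< V ''y'' \<^bold>\<longrightarrow>
        (\<^bold>\<exists>''i''. val F (pair_tm (V ''x'') (V ''y'')) (V ''i''))) \<^bold>\<and>
     (\<^bold>\<forall>''x''. \<^bold>\<forall>''y''. \<^bold>\<forall>''i''. \<^bold>\<forall>''j''.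
        val F (pair_tm (V ''x'') (V ''y'')) (V ''i'') \<^bold>\<and> val F (pair_tm (V ''x'') (V ''y'')) (V ''j'')
        \<^bold>\<longrightarrow> V ''i'' \<^bold>= V ''j''))"

definition is_stable :: "nat \<Rightarrow> st \<Rightarrow> fm" where
  "is_stable k F =
    (\<^bold>\<forall>''x''. \<^bold>\<exists>''d''. \<^bold>\<exists>''t''. V ''d'' \<^bold>< num_tm k \<^bold>\<and> V ''x'' \<^bold>< V ''t'' \<^bold>\<and>
      (\<^bold>\<forall>''s''. V ''t'' \<^bold>\<le> V ''s'' \<^bold>\<longrightarrow> val F (pair_tm (V ''x'') (V ''s'')) (V ''d'')))"

definition SRT2 :: "nat \<Rightarrow> fm" where
  "SRT2 k =
    (\<^bold>\<forall>\<^sub>S''F''. is_pair_coloring k (SV ''F'') \<^bold>\<and> is_stable k (SV ''F'') \<^bold>\<longrightarrow>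
      (\<^bold>\<exists>\<^sub>S''J''. \<^bold>\<exists>''d''. is_infinite (SV ''J'') \<^bold>\<and> V ''d'' \<^bold>< num_tm k \<^bold>\<and>
        (\<^bold>\<forall>''x''. \<^bold>\<forall>''y''. V ''x'' \<^bold>\<in> SV ''J'' \<^bold>\<and> V ''y'' \<^bold>\<in> SV ''J'' \<^bold>\<and> V ''x'' \<^bold>< V ''y''
          \<^bold>\<longrightarrow> val (SV ''F'') (pair_tm (V ''x'') (V ''y'')) (V ''d''))))"

end

theory Submission
  imports Defs "HOL-Library.Countable_Set"
begin

text \<open>
  Otherwise the countable Henkin model of \<open>RCA\<^sub>0\<close>, \<open>AHT 2\<close> and \<open>\<not> SRT2 2\<close> exists.  In it, let \<open>f\<close>
  be a coloring of pairs and color \<open>n\<close> by \<open>f(\<lambda>(n), \<mu>(n))\<close>.  A sum of adjacent elements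
  \<open>h\<^sub>i, \<dots>, h\<^sub>j\<close> of an apart set has \<open>\<lambda> = \<lambda>(h\<^sub>i)\<close> and \<open>\<mu> = \<mu>(h\<^sub>j)\<close>, so that \<open>AHT 2\<close> makes
  \<open>f(\<lambda>(h\<^sub>i), \<mu>(h\<^sub>j))\<close> constant for \<open>i < j\<close>.  If \<open>f\<close> is stable, then all \<open>\<lambda>(h\<^sub>i)\<close> have the same
  limit color, and a homogeneous set is chosen greedily among them.  The greedy choice goes on
  forever by the infinite pigeonhole principle for arbitrarily many colors (equivalent to
  \<open>\<Sigma>\<^sup>0\<^sub>2\<close> bounding), which is not available in \<open>RCA\<^sub>0\<close>.  It follows from the polarized statement
  above: if all classes of \<open>g : N \<rightarrow> K\<close> are bounded, list the colors at stage \<open>s\<close> by last occurrence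
  and read this list as a base-\<open>K\<close> numeral \<open>p(s)\<close>.  Then \<open>p\<close> converges to a cut that is not attained,
  and the coloring \<open>p(x) < p(y)\<close> contradicts the existence of maxima and minima of bounded
  \<open>\<Sigma>\<^sup>0\<^sub>1\<close> sets.
\<close>

section \<open>Renaming of parameters and weakening\<close>

text \<open>Arguing in a model avoids long derivations in the calculus, but the model may be
  nonstandard: induction on \<open>nat\<close> says nothing about its elements. Hence every
  induction, least element or new set rests on a predicate shown to be \<open>s1\<close> or
  \<open>delta\<close>, and primitive recursion is itself built from coded computations. The
  pigeonhole principle enters because the greedy set might stop below some \<open>b\<close>. Every
  later candidate is then blocked by a chosen index below \<open>b\<close>, and taking the blocker
  as its color gives a coloring with \<open>b\<close> colors. As \<open>b\<close> may be
  nonstandard, a common stage after which all colors are dead cannot be assumed to exist. The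
  numerals avoid such a stage: to compare \<open>p x\<close> with all later values, only the death
  of the one color in the last place of \<open>p x\<close> is used. The polarized statement is thus
  applied to two different colorings, \<open>f\<close> and the one given by
  \<open>p\<close>.\<close>

fun ren_tm :: "(nat \<Rightarrow> nat) \<Rightarrow> tm \<Rightarrow> tm" where
  "ren_tm f (V x) = V x"
| "ren_tm f (Par a) = Par (f a)"
| "ren_tm f \<^bold>0 = \<^bold>0"
| "ren_tm f \<^bold>1 = \<^bold>1"
| "ren_tm f (s \<^bold>+ t) = ren_tm f s \<^bold>+ ren_tm f t"
| "ren_tm f (s \<^bold>* t) = ren_tm f s \<^bold>* ren_tm f t"

fun ren_st :: "(nat \<Rightarrow> nat) \<Rightarrow> st \<Rightarrow> st" where
  "ren_st g (SV X) = SV X"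
| "ren_st g (SPar a) = SPar (g a)"

fun ren :: "(nat \<Rightarrow> nat) \<Rightarrow> (nat \<Rightarrow> nat) \<Rightarrow> fm \<Rightarrow> fm" where
  "ren f g \<^bold>\<bottom> = \<^bold>\<bottom>"
| "ren f g (s \<^bold>= t) = (ren_tm f s \<^bold>= ren_tm f t)"
| "ren f g (s \<^bold>< t) = (ren_tm f s \<^bold>< ren_tm f t)"
| "ren f g (t \<^bold>\<in> A) = (ren_tm f t \<^bold>\<in> ren_st g A)"
| "ren f g (p \<^bold>\<longrightarrow> q) = (ren f g p \<^bold>\<longrightarrow> ren f g q)"
| "ren f g (\<^bold>\<forall>x. p) = (\<^bold>\<forall>x. ren f g p)"
| "ren f g (\<^bold>\<forall>\<^sub>SX. p) = (\<^bold>\<forall>\<^sub>SX. ren f g p)"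

lemma ren_tm_id [simp]: "ren_tm (\<lambda>a. a) t = t"
  by (induction t) auto

lemma ren_st_id [simp]: "ren_st (\<lambda>a. a) A = A"
  by (cases A) auto

lemma ren_id [simp]: "ren (\<lambda>a. a) (\<lambda>a. a) p = p"
  by (induction p) auto

lemma ren_tm_cong: "(\<And>a. a \<in> pars_tm t \<Longrightarrow> f a = f' a) \<Longrightarrow> ren_tm f t = ren_tm f' t"
  by (induction t) auto

lemma ren_st_cong: "(\<And>a. a \<in> spars_st A \<Longrightarrow> g a = g' a) \<Longrightarrow> ren_st g A = ren_st g' A"
  by (cases A) auto

lemma ren_cong:
  "(\<And>a. a \<in> pars p \<Longrightarrow> f a = f' a) \<Longrightarrow> (\<And>a. a \<in> spars p \<Longrightarrow> g a = g' a) \<Longrightarrow> ren f g p = ren f' g' p"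
  by (induction p) (auto intro: ren_tm_cong ren_st_cong)

lemma vars_ren_tm [simp]: "vars_tm (ren_tm f t) = vars_tm t"
  by (induction t) auto

lemma ren_subst_tm: "ren_tm f (subst_tm x u t) = subst_tm x (ren_tm f u) (ren_tm f t)"
  by (induction t) auto

lemma ren_subst: "ren f g (subst x u p) = subst x (ren_tm f u) (ren f g p)"
  by (induction p) (auto simp: ren_subst_tm)

lemma ren_ssubst: "ren f g (ssubst X U p) = ssubst X (ren_st g U) (ren f g p)"
proof -
  have "ren_st g (ssubst_st X U A) = ssubst_st X (ren_st g U) (ren_st g A)" for A
    by (cases A) auto
  then show ?thesis
    by (induction p) auto
qed

lemma finite_pars [simp]: "finite (pars p)"
proof -
  have "finite (pars_tm t)" for t by (induction t) auto
  then show ?thesis by (induction p) auto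
qed

lemma finite_spars [simp]: "finite (spars p)"
proof -
  have "finite (spars_st A)" for A by (cases A) auto
  then show ?thesis by (induction p) auto
qed

text \<open>Weakening and renaming share one induction: an eigenparameter may occur in
  \<open>\<Delta>\<close>, so the induction hypothesis is applied to a renaming that sends it to a
  fresh parameter instead. The maps need not be injective. Closure of \<open>T\<close> under
  renaming reflects that axioms stand for their universal closures.\<close>

lemma deriv_ren:
  assumes T: "\<And>p f g. p \<in> T \<Longrightarrow> ren f g p \<in> T"
  shows "deriv T \<Gamma> p \<Longrightarrow> ren f g ` set \<Gamma> \<subseteq> set \<Delta> \<Longrightarrow> deriv T \<Delta> (ren f g p)"
proof (induction arbitrary: f g \<Delta> rule: deriv.induct)
  case (Axiom p \<Gamma>)
  then show ?case by (simp add: T deriv.Axiom)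
next
  case (Assm p \<Gamma>)
  then show ?case by (auto intro: deriv.Assm)
next
  case (ImpI p \<Gamma> q)
  have "deriv T (ren f g p # \<Delta>) (ren f g q)"
    using ImpI.prems by (intro ImpI.IH) auto
  then show ?case by (simp add: deriv.ImpI)
next
  case (ImpE \<Gamma> p q)
  then show ?case by (metis deriv.ImpE ren.simps(5))
next
  case (Class p \<Gamma>)
  have "deriv T ((\<^bold>\<not> ren f g p) # \<Delta>) (ren f g \<^bold>\<bottom>)"
    using Class.prems by (intro Class.IH) auto
  then show ?case by (simp add: deriv.Class)
next
  case (AllI \<Gamma> x a p)
  have "finite (pars (ren f g p) \<union> (\<Union>q\<in>set \<Delta>. pars q))" by auto
  then obtain b where b: "b \<notin> pars (ren f g p)" "\<forall>q\<in>set \<Delta>. b \<notin> pars q"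
    using ex_new_if_finite[OF infinite_UNIV_nat] by blast
  have ren_upd: "ren (f(a := b)) g q = ren f g q" if "a \<notin> pars q" for q
    using that by (intro ren_cong) auto
  have "deriv T \<Delta> (ren (f(a := b)) g (subst x (Par a) p))"
    using AllI.hyps AllI.prems ren_upd by (intro AllI.IH) (auto simp del: fun_upd_apply)
  then have "deriv T \<Delta> (subst x (Par b) (ren f g p))"
    using ren_upd[of p] AllI by (simp add: ren_subst)
  then show ?case using b by (auto intro: deriv.AllI)
next
  case (AllE \<Gamma> x p t)
  then have "deriv T \<Delta> (subst x (ren_tm f t) (ren f g p))"
    by (intro deriv.AllE) auto
  then show ?case by (simp add: ren_subst)
next
  case (SAllI \<Gamma> X a p)
  have "finite (spars (ren f g p) \<union> (\<Union>q\<in>set \<Delta>. spars q))" by auto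
  then obtain b where b: "b \<notin> spars (ren f g p)" "\<forall>q\<in>set \<Delta>. b \<notin> spars q"
    using ex_new_if_finite[OF infinite_UNIV_nat] by blast
  have ren_upd: "ren f (g(a := b)) q = ren f g q" if "a \<notin> spars q" for q
    using that by (intro ren_cong) auto
  have "deriv T \<Delta> (ren f (g(a := b)) (ssubst X (SPar a) p))"
    using SAllI.hyps SAllI.prems ren_upd by (intro SAllI.IH) (auto simp del: fun_upd_apply)
  then have "deriv T \<Delta> (ssubst X (SPar b) (ren f g p))"
    using ren_upd[of p] SAllI by (simp add: ren_ssubst)
  then show ?case using b by (auto intro: deriv.SAllI)
next
  case (SAllE \<Gamma> X p a)
  then have "deriv T \<Delta> (ssubst X (SPar (g a)) (ren f g p))"
    by (intro deriv.SAllE) auto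
  then show ?case by (simp add: ren_ssubst)
next
  case (EqI \<Gamma> t)
  then show ?case by (simp add: deriv.EqI)
next
  case (EqE \<Gamma> s t x p)
  have "deriv T \<Delta> (ren_tm f s \<^bold>= ren_tm f t)" "deriv T \<Delta> (subst x (ren_tm f s) (ren f g p))"
    using EqE.IH(1)[OF EqE.prems] EqE.IH(2)[OF EqE.prems] by (simp_all add: ren_subst)
  then have "deriv T \<Delta> (subst x (ren_tm f t) (ren f g p))"
    by (rule deriv.EqE[where s = "ren_tm f s"]) (simp_all add: EqE.hyps)
  then show ?case by (simp add: ren_subst)
qed

lemma deriv_weaken:
  assumes "\<And>p f g. p \<in> T \<Longrightarrow> ren f g p \<in> T" "deriv T \<Gamma> p" "set \<Gamma> \<subseteq> set \<Delta>"
  shows "deriv T \<Delta> p"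
  using deriv_ren[OF assms(1,2), of "\<lambda>a. a" "\<lambda>a. a" \<Delta>] assms(3) by (simp add: image_def subset_iff)

section \<open>Henkin sets\<close>

instance tm :: countable by countable_datatype
instance st :: countable by countable_datatype
instance fm :: countable by countable_datatype

definition fresh_par :: "fm list \<Rightarrow> nat" where
  "fresh_par \<Gamma> = (SOME a. \<forall>q\<in>set \<Gamma>. a \<notin> pars q)"

definition fresh_spar :: "fm list \<Rightarrow> nat" where
  "fresh_spar \<Gamma> = (SOME a. \<forall>q\<in>set \<Gamma>. a \<notin> spars q)"

lemma fresh_par: "q \<in> set \<Gamma> \<Longrightarrow> fresh_par \<Gamma> \<notin> pars q"
proof -
  have "finite (\<Union>q\<in>set \<Gamma>. pars q)" by auto
  then have "\<exists>a. \<forall>q\<in>set \<Gamma>. a \<notin> pars q"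
    using ex_new_if_finite[OF infinite_UNIV_nat] by blast
  then show "q \<in> set \<Gamma> \<Longrightarrow> fresh_par \<Gamma> \<notin> pars q"
    unfolding fresh_par_def by (rule someI2_ex) blast
qed

lemma fresh_spar: "q \<in> set \<Gamma> \<Longrightarrow> fresh_spar \<Gamma> \<notin> spars q"
proof -
  have "finite (\<Union>q\<in>set \<Gamma>. spars q)" by auto
  then have "\<exists>a. \<forall>q\<in>set \<Gamma>. a \<notin> spars q"
    using ex_new_if_finite[OF infinite_UNIV_nat] by blast
  then show "q \<in> set \<Gamma> \<Longrightarrow> fresh_spar \<Gamma> \<notin> spars q"
    unfolding fresh_spar_def by (rule someI2_ex) blast
qed

text \<open>Existential formulas abbreviate negated universals, so witnessing these two shapes
  covers them.\<close>

fun witness :: "fm list \<Rightarrow> fm \<Rightarrow> fm list" where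
  "witness \<Gamma> (\<^bold>\<not> (\<^bold>\<forall>x. p)) = [\<^bold>\<not> subst x (Par (fresh_par (p # \<Gamma>))) p]"
| "witness \<Gamma> (\<^bold>\<not> (\<^bold>\<forall>\<^sub>SX. p)) = [\<^bold>\<not> ssubst X (SPar (fresh_spar (p # \<Gamma>))) p]"
| "witness \<Gamma> _ = []"

definition extend :: "fm set \<Rightarrow> fm list \<Rightarrow> fm \<Rightarrow> fm list" where
  "extend T \<Gamma> p = (if deriv T (p # \<Gamma>) \<^bold>\<bottom> then \<Gamma> else witness \<Gamma> p @ p # \<Gamma>)"

primrec henkin_chain :: "fm set \<Rightarrow> fm \<Rightarrow> nat \<Rightarrow> fm list" where
  "henkin_chain T p 0 = [p]"
| "henkin_chain T p (Suc n) = extend T (henkin_chain T p n) (from_nat n)"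

definition henkin_set :: "fm set \<Rightarrow> fm \<Rightarrow> fm set" where
  "henkin_set T p = (\<Union>n. set (henkin_chain T p n))"

locale henkin =
  fixes T :: "fm set" and p0 :: fm
  assumes T_ren: "\<And>p f g. p \<in> T \<Longrightarrow> ren f g p \<in> T"
    and consistent: "\<not> deriv T [p0] \<^bold>\<bottom>"
begin

abbreviation chain :: "nat \<Rightarrow> fm list" where "chain \<equiv> henkin_chain T p0"

abbreviation H :: "fm set" where "H \<equiv> henkin_set T p0"

lemmas weaken = deriv_weaken[OF T_ren]

text \<open>If the witness caused inconsistency, \<open>Class\<close> would derive the instance at
  the fresh parameter, and the introduction rule would turn it into the universal formula whose
  negation is being added.\<close>

lemma extend_consistent:
  assumes "\<not> deriv T \<Gamma> \<^bold>\<bottom>"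
  shows "\<not> deriv T (extend T \<Gamma> p) \<^bold>\<bottom>"
proof (cases "deriv T (p # \<Gamma>) \<^bold>\<bottom>")
  case False
  consider (all) x q where "p = (\<^bold>\<not> (\<^bold>\<forall>x. q))" | (sall) X q where "p = (\<^bold>\<not> (\<^bold>\<forall>\<^sub>SX. q))"
    | (none) "witness \<Gamma> p = []"
    by (cases "(\<Gamma>, p)" rule: witness.cases) auto
  then show ?thesis
  proof cases
    case all
    let ?a = "fresh_par (q # \<Gamma>)"
    have "\<not> deriv T ((\<^bold>\<not> subst x (Par ?a) q) # p # \<Gamma>) \<^bold>\<bottom>"
    proof
      assume "deriv T ((\<^bold>\<not> subst x (Par ?a) q) # p # \<Gamma>) \<^bold>\<bottom>"
      then have "deriv T (p # \<Gamma>) (subst x (Par ?a) q)" by (rule Class)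
      then have "deriv T (p # \<Gamma>) (\<^bold>\<forall>x. q)"
        by (rule AllI) (use fresh_par[of _ "q # \<Gamma>"] in \<open>auto simp: all\<close>)
      moreover have "deriv T (p # \<Gamma>) p" by (rule Assm) simp
      ultimately show False using False ImpE unfolding all by blast
    qed
    then show ?thesis using False by (simp add: extend_def all)
  next
    case sall
    let ?a = "fresh_spar (q # \<Gamma>)"
    have "\<not> deriv T ((\<^bold>\<not> ssubst X (SPar ?a) q) # p # \<Gamma>) \<^bold>\<bottom>"
    proof
      assume "deriv T ((\<^bold>\<not> ssubst X (SPar ?a) q) # p # \<Gamma>) \<^bold>\<bottom>"
      then have "deriv T (p # \<Gamma>) (ssubst X (SPar ?a) q)" by (rule Class)
      then have "deriv T (p # \<Gamma>) (\<^bold>\<forall>\<^sub>SX. q)"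
        by (rule SAllI) (use fresh_spar[of _ "q # \<Gamma>"] in \<open>auto simp: sall\<close>)
      moreover have "deriv T (p # \<Gamma>) p" by (rule Assm) simp
      ultimately show False using False ImpE unfolding sall by blast
    qed
    then show ?thesis using False by (simp add: extend_def sall)
  next
    case none
    then show ?thesis using False by (simp add: extend_def)
  qed
qed (simp add: extend_def assms)

lemma chain_consistent: "\<not> deriv T (chain n) \<^bold>\<bottom>"
  by (induction n) (use consistent extend_consistent in auto)

lemma chain_mono: "m \<le> n \<Longrightarrow> set (chain m) \<subseteq> set (chain n)"
  by (rule lift_Suc_mono_le[of "\<lambda>n. set (chain n)"]) (auto simp: extend_def)

lemma p0_in_H: "p0 \<in> H"
  unfolding henkin_set_def by (rule UN_I[of 0]) auto

lemma finite_subset_chain: "finite A \<Longrightarrow> A \<subseteq> H \<Longrightarrow> \<exists>n. A \<subseteq> set (chain n)"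
proof (induction A rule: finite_induct)
  case (insert q A)
  then obtain m n where "q \<in> set (chain m)" "A \<subseteq> set (chain n)"
    by (auto simp: henkin_set_def)
  then have "insert q A \<subseteq> set (chain (max m n))"
    using chain_mono[of m "max m n"] chain_mono[of n "max m n"] by auto
  then show ?case by blast
qed auto

text \<open>Had \<open>q\<close> been rejected at its own stage, that stage would derive the
  negation of \<open>q\<close>, and a later stage containing \<open>\<Gamma>\<close> would derive
  both.\<close>

lemma H_deriv:
  assumes "deriv T \<Gamma> q" "set \<Gamma> \<subseteq> H"
  shows "q \<in> H"
proof -
  obtain m where m: "set \<Gamma> \<subseteq> set (chain m)"
    using finite_subset_chain assms(2) by blast
  define n where "n = to_nat q"
  define k where "k = max m n"
  have k: "set \<Gamma> \<subseteq> set (chain k)" "set (chain n) \<subseteq> set (chain k)"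
    using m chain_mono[of m k] chain_mono[of n k] by (auto simp: k_def)
  have "\<not> deriv T (q # chain n) \<^bold>\<bottom>"
  proof
    assume "deriv T (q # chain n) \<^bold>\<bottom>"
    then have "deriv T (chain n) (\<^bold>\<not> q)" by (rule ImpI)
    then have "deriv T (chain k) (\<^bold>\<not> q)" using k by (blast intro: weaken)
    moreover have "deriv T (chain k) q" using assms(1) k by (blast intro: weaken)
    ultimately show False using chain_consistent ImpE by blast
  qed
  then have "q \<in> set (chain (Suc n))" by (simp add: extend_def n_def)
  then show ?thesis unfolding henkin_set_def by blast
qed

lemma H_axiom: "q \<in> T \<Longrightarrow> q \<in> H"
  by (rule H_deriv[where \<Gamma> = "[]"]) (auto intro: Axiom)

lemma H_falsum: "\<^bold>\<bottom> \<notin> H"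
  using chain_consistent Assm by (auto simp: henkin_set_def)

lemma H_mp: "(p \<^bold>\<longrightarrow> q) \<in> H \<Longrightarrow> p \<in> H \<Longrightarrow> q \<in> H"
  by (rule H_deriv[where \<Gamma> = "[p \<^bold>\<longrightarrow> q, p]"], rule ImpE[where p = p]) (simp_all add: Assm)

lemma H_neg: "(\<^bold>\<not> p) \<in> H \<longleftrightarrow> p \<notin> H"
proof
  show "(\<^bold>\<not> p) \<in> H \<Longrightarrow> p \<notin> H" using H_mp H_falsum by blast
  assume p: "p \<notin> H"
  let ?n = "to_nat p"
  have "deriv T (p # chain ?n) \<^bold>\<bottom>"
  proof (rule ccontr)
    assume "\<not> ?thesis"
    then have "p \<in> set (chain (Suc ?n))" by (simp add: extend_def)
    with p show False unfolding henkin_set_def by blast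
  qed
  then have "deriv T (chain ?n) (\<^bold>\<not> p)" by (rule ImpI)
  then show "(\<^bold>\<not> p) \<in> H" by (rule H_deriv) (auto simp: henkin_set_def)
qed

lemma H_imp: "(p \<^bold>\<longrightarrow> q) \<in> H \<longleftrightarrow> (p \<in> H \<longrightarrow> q \<in> H)"
proof
  assume *: "p \<in> H \<longrightarrow> q \<in> H"
  show "(p \<^bold>\<longrightarrow> q) \<in> H"
  proof (cases "p \<in> H")
    case True
    with * show ?thesis
      by (intro H_deriv[where \<Gamma> = "[q]"] ImpI) (simp_all add: Assm)
  next
    case False
    then have "(\<^bold>\<not> p) \<in> H" using H_neg by blast
    moreover have "deriv T [\<^bold>\<not> p] (p \<^bold>\<longrightarrow> q)"
      by (rule ImpI, rule Class, rule ImpE[where p = p]) (simp_all add: Assm)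
    ultimately show ?thesis by (intro H_deriv[where \<Gamma> = "[\<^bold>\<not> p]"]) auto
  qed
qed (use H_mp in blast)

lemma H_all_inst: "(\<^bold>\<forall>x. p) \<in> H \<Longrightarrow> vars_tm t = {} \<Longrightarrow> subst x t p \<in> H"
  by (rule H_deriv[where \<Gamma> = "[\<^bold>\<forall>x. p]"], rule AllE) (simp_all add: Assm)

lemma H_sall_inst: "(\<^bold>\<forall>\<^sub>SX. p) \<in> H \<Longrightarrow> ssubst X (SPar a) p \<in> H"
  by (rule H_deriv[where \<Gamma> = "[\<^bold>\<forall>\<^sub>SX. p]"], rule SAllE) (simp_all add: Assm)

text \<open>A formula may have entered \<open>H\<close> at any stage, for instance as a witness;
  consistency forces its acceptance at its own stage too, and that is where its witness is
  added.\<close>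

lemma witness_in_H:
  assumes "p \<in> H"
  shows "set (witness (chain (to_nat p)) p) \<subseteq> H"
proof -
  let ?n = "to_nat p"
  have "\<not> deriv T (p # chain ?n) \<^bold>\<bottom>"
  proof
    assume "deriv T (p # chain ?n) \<^bold>\<bottom>"
    then have "deriv T (chain ?n) (\<^bold>\<not> p)" by (rule ImpI)
    then have "(\<^bold>\<not> p) \<in> H" by (rule H_deriv) (auto simp: henkin_set_def)
    with assms show False using H_neg by blast
  qed
  then have "set (witness (chain ?n) p) \<subseteq> set (chain (Suc ?n))" by (auto simp: extend_def)
  then show ?thesis unfolding henkin_set_def by blast
qed

lemma H_all: "(\<^bold>\<forall>x. p) \<in> H \<longleftrightarrow> (\<forall>a. subst x (Par a) p \<in> H)"
proof
  assume *: "\<forall>a. subst x (Par a) p \<in> H"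
  show "(\<^bold>\<forall>x. p) \<in> H"
  proof (rule ccontr)
    assume "(\<^bold>\<forall>x. p) \<notin> H"
    then have "(\<^bold>\<not> (\<^bold>\<forall>x. p)) \<in> H" using H_neg by blast
    from witness_in_H[OF this] obtain a where "(\<^bold>\<not> subst x (Par a) p) \<in> H" by auto
    with * show False using H_neg by blast
  qed
qed (simp add: H_all_inst)

lemma H_sall: "(\<^bold>\<forall>\<^sub>SX. p) \<in> H \<longleftrightarrow> (\<forall>a. ssubst X (SPar a) p \<in> H)"
proof
  assume *: "\<forall>a. ssubst X (SPar a) p \<in> H"
  show "(\<^bold>\<forall>\<^sub>SX. p) \<in> H"
  proof (rule ccontr)
    assume "(\<^bold>\<forall>\<^sub>SX. p) \<notin> H"
    then have "(\<^bold>\<not> (\<^bold>\<forall>\<^sub>SX. p)) \<in> H" using H_neg by blast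
    from witness_in_H[OF this] obtain a where "(\<^bold>\<not> ssubst X (SPar a) p) \<in> H" by auto
    with * show False using H_neg by blast
  qed
qed (simp add: H_sall_inst)

lemma H_refl: "(t \<^bold>= t) \<in> H"
  by (rule H_deriv[where \<Gamma> = "[]"]) (auto intro: EqI)

lemma H_subst:
  "(s \<^bold>= t) \<in> H \<Longrightarrow> vars_tm s = {} \<Longrightarrow> vars_tm t = {} \<Longrightarrow> subst x s p \<in> H \<Longrightarrow> subst x t p \<in> H"
  by (rule H_deriv[where \<Gamma> = "[s \<^bold>= t, subst x s p]"], rule EqE[where s = s]) (simp_all add: Assm)

lemma subst_tm_closed [simp]: "vars_tm t = {} \<Longrightarrow> subst_tm x u t = t"
  by (induction t) auto

lemma H_sym:
  assumes "(s \<^bold>= t) \<in> H" "vars_tm s = {}" "vars_tm t = {}"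
  shows "(t \<^bold>= s) \<in> H"
  using H_subst[OF assms, where x = "''x''" and p = "V ''x'' \<^bold>= s"] assms H_refl by simp

lemma H_trans:
  assumes "(s \<^bold>= t) \<in> H" "(t \<^bold>= u) \<in> H" "vars_tm s = {}" "vars_tm t = {}" "vars_tm u = {}"
  shows "(s \<^bold>= u) \<in> H"
  using H_subst[where s = t and t = u and x = "''x''" and p = "s \<^bold>= V ''x''"] assms by simp

text \<open>The parameter is the Henkin witness of \<open>\<exists>x. t = x\<close>.\<close>

lemma H_par:
  assumes "vars_tm t = {}"
  obtains a where "(t \<^bold>= Par a) \<in> H"
proof -
  have "(\<^bold>\<forall>''x''. \<^bold>\<not> (t \<^bold>= V ''x'')) \<notin> H"
    using H_all_inst[of "''x''" "\<^bold>\<not> (t \<^bold>= V ''x'')" t] H_refl[of t] assms by (auto simp: H_neg)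
  then show thesis using that assms by (auto simp: H_all H_neg)
qed

end

section \<open>Two-sorted structures\<close>

fun tval :: "(nat \<Rightarrow> 'a::{zero,one,plus,times}) \<Rightarrow> (name \<Rightarrow> 'a) \<Rightarrow> tm \<Rightarrow> 'a" where
  "tval \<rho> e (V x) = e x"
| "tval \<rho> e (Par a) = \<rho> a"
| "tval \<rho> e \<^bold>0 = 0"
| "tval \<rho> e \<^bold>1 = 1"
| "tval \<rho> e (s \<^bold>+ t) = tval \<rho> e s + tval \<rho> e t"
| "tval \<rho> e (s \<^bold>* t) = tval \<rho> e s * tval \<rho> e t"

fun sval :: "(nat \<Rightarrow> 'a set) \<Rightarrow> (name \<Rightarrow> 'a set) \<Rightarrow> st \<Rightarrow> 'a set" where
  "sval \<sigma> E (SV X) = E X"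
| "sval \<sigma> E (SPar a) = \<sigma> a"

fun eval :: "'a::{zero,one,plus,times,ord} set set \<Rightarrow> (nat \<Rightarrow> 'a) \<Rightarrow> (nat \<Rightarrow> 'a set) \<Rightarrow>
    (name \<Rightarrow> 'a) \<Rightarrow> (name \<Rightarrow> 'a set) \<Rightarrow> fm \<Rightarrow> bool" where
  "eval S \<rho> \<sigma> e E \<^bold>\<bottom> \<longleftrightarrow> False"
| "eval S \<rho> \<sigma> e E (s \<^bold>= t) \<longleftrightarrow> tval \<rho> e s = tval \<rho> e t"
| "eval S \<rho> \<sigma> e E (s \<^bold>< t) \<longleftrightarrow> tval \<rho> e s < tval \<rho> e t"
| "eval S \<rho> \<sigma> e E (t \<^bold>\<in> A) \<longleftrightarrow> tval \<rho> e t \<in> sval \<sigma> E A"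
| "eval S \<rho> \<sigma> e E (p \<^bold>\<longrightarrow> q) \<longleftrightarrow> (eval S \<rho> \<sigma> e E p \<longrightarrow> eval S \<rho> \<sigma> e E q)"
| "eval S \<rho> \<sigma> e E (\<^bold>\<forall>x. p) \<longleftrightarrow> (\<forall>u. eval S \<rho> \<sigma> (e(x := u)) E p)"
| "eval S \<rho> \<sigma> e E (\<^bold>\<forall>\<^sub>SX. p) \<longleftrightarrow> (\<forall>A\<in>S. eval S \<rho> \<sigma> e (E(X := A)) p)"

lemma eval_connectives:
  "eval S \<rho> \<sigma> e E (p \<^bold>\<or> q) \<longleftrightarrow> eval S \<rho> \<sigma> e E p \<or> eval S \<rho> \<sigma> e E q"
  "eval S \<rho> \<sigma> e E (p \<^bold>\<and> q) \<longleftrightarrow> eval S \<rho> \<sigma> e E p \<and> eval S \<rho> \<sigma> e E q"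
  "eval S \<rho> \<sigma> e E (p \<^bold>\<longleftrightarrow> q) \<longleftrightarrow> (eval S \<rho> \<sigma> e E p \<longleftrightarrow> eval S \<rho> \<sigma> e E q)"
  "eval S \<rho> \<sigma> e E (\<^bold>\<exists>x. p) \<longleftrightarrow> (\<exists>u. eval S \<rho> \<sigma> (e(x := u)) E p)"
  "eval S \<rho> \<sigma> e E (\<^bold>\<exists>\<^sub>SX. p) \<longleftrightarrow> (\<exists>A\<in>S. eval S \<rho> \<sigma> e (E(X := A)) p)"
  by auto

fun free_vars :: "fm \<Rightarrow> name set" where
  "free_vars \<^bold>\<bottom> = {}"
| "free_vars (s \<^bold>= t) = vars_tm s \<union> vars_tm t"
| "free_vars (s \<^bold>< t) = vars_tm s \<union> vars_tm t"
| "free_vars (t \<^bold>\<in> A) = vars_tm t"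
| "free_vars (p \<^bold>\<longrightarrow> q) = free_vars p \<union> free_vars q"
| "free_vars (\<^bold>\<forall>x. p) = free_vars p - {x}"
| "free_vars (\<^bold>\<forall>\<^sub>SX. p) = free_vars p"

lemma tval_cong: "(\<And>x. x \<in> vars_tm t \<Longrightarrow> e x = e' x) \<Longrightarrow> tval \<rho> e t = tval \<rho> e' t"
  by (induction t) auto

lemma tval_subst: "tval \<rho> e (subst_tm x u t) = tval \<rho> (e(x := tval \<rho> e u)) t"
  by (induction t) auto

text \<open>No capture occurs: \<open>u\<close> contains at most \<open>x\<close>, and \<open>subst\<close> stops at quantifiers over \<open>x\<close>.\<close>

lemma eval_subst:
  "vars_tm u \<subseteq> {x} \<Longrightarrow> eval S \<rho> \<sigma> e E (subst x u p) = eval S \<rho> \<sigma> (e(x := tval \<rho> e u)) E p"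
proof (induction p arbitrary: e E)
  case (Forall y p)
  show ?case
  proof (cases "y = x")
    case False
    have "tval \<rho> (e(y := v)) u = tval \<rho> e u" for v
      using Forall.prems False by (intro tval_cong) auto
    then have "eval S \<rho> \<sigma> (e(y := v)) E (subst x u p) = eval S \<rho> \<sigma> ((e(x := tval \<rho> e u))(y := v)) E p" for v
      using Forall.IH[OF Forall.prems, of "e(y := v)" E] fun_upd_twist[OF False, of e v "tval \<rho> e u"]
      by (simp del: fun_upd_apply)
    then show ?thesis using False by (simp del: fun_upd_apply)
  qed (simp del: fun_upd_apply)
qed (auto simp: tval_subst)

lemma eval_ssubst:
  "eval S \<rho> \<sigma> e E (ssubst X (SPar a) p) = eval S \<rho> \<sigma> e (E(X := \<sigma> a)) p"
proof (induction p arbitrary: e E)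
  case (Mem t A)
  then show ?case by (cases A) auto
next
  case (SForall Y p)
  show ?case
  proof (cases "Y = X")
    case False
    have "eval S \<rho> \<sigma> e (E(Y := A)) (ssubst X (SPar a) p) = eval S \<rho> \<sigma> e ((E(X := \<sigma> a))(Y := A)) p" for A
      using SForall.IH[of e "E(Y := A)"] fun_upd_twist[OF False, of E A "\<sigma> a"] by (simp del: fun_upd_apply)
    then show ?thesis using False by (simp del: fun_upd_apply)
  qed (simp del: fun_upd_apply)
qed auto

lemma free_vars_subst:
  "vars_tm u = {} \<Longrightarrow> free_vars (subst x u p) = free_vars p - {x}"
proof -
  assume u: "vars_tm u = {}"
  have "vars_tm (subst_tm x u t) = vars_tm t - {x}" for t
    by (induction t) (auto simp: u)
  then show ?thesis by (induction p) auto
qed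

lemma free_svars_subst [simp]: "free_svars (subst x u p) = free_svars p"
  by (induction p) auto

lemma free_vars_ssubst [simp]: "free_vars (ssubst X U p) = free_vars p"
  by (induction p) auto

lemma free_svars_ssubst: "free_svars (ssubst X (SPar a) p) = free_svars p - {X}"
proof -
  have "free_svars_st (ssubst_st X (SPar a) A) = free_svars_st A - {X}" for A
    by (cases A) auto
  then show ?thesis by (induction p) auto
qed

text \<open>The truth lemma passes from a quantified formula to instances of its body, which are not
  subformulas; this measure ignores what is substituted.\<close>

fun complexity :: "fm \<Rightarrow> nat" where
  "complexity (p \<^bold>\<longrightarrow> q) = Suc (complexity p + complexity q)"
| "complexity (\<^bold>\<forall>x. p) = Suc (complexity p)"
| "complexity (\<^bold>\<forall>\<^sub>SX. p) = Suc (complexity p)"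
| "complexity _ = 0"

lemma complexity_subst [simp]: "complexity (subst x u p) = complexity p"
  by (induction p) auto

lemma complexity_ssubst [simp]: "complexity (ssubst X U p) = complexity p"
  by (induction p) auto

section \<open>Bounded predicates and models of \<open>RCA\<^sub>0\<close>\<close>

definition scons :: "'a \<Rightarrow> (nat \<Rightarrow> 'a) \<Rightarrow> nat \<Rightarrow> 'a" (infixr "##" 65) where
  "u ## e = case_nat u e"

lemma scons_simps [simp]: "(u ## e) 0 = u" "(u ## e) (Suc i) = e i"
  by (simp_all add: scons_def)

lemma scons_eta [simp]: "e 0 ## (\<lambda>i. e (Suc i)) = e"
  by (auto simp: scons_def split: nat.split)

text \<open>Predicates and terms are functions of an environment, which assigns values to de Bruijn indices.\<close>

inductive trm :: "((nat \<Rightarrow> 'a::{zero,one,plus,times}) \<Rightarrow> 'a) \<Rightarrow> bool" where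
  trm_var: "trm (\<lambda>e. e i)"
| trm_const: "trm (\<lambda>e. c)"
| trm_add: "trm s \<Longrightarrow> trm t \<Longrightarrow> trm (\<lambda>e. s e + t e)"
| trm_mult: "trm s \<Longrightarrow> trm t \<Longrightarrow> trm (\<lambda>e. s e * t e)"

text \<open>The bound \<open>t e\<close> is evaluated outside the binder, which replaces the proviso
  of \<open>bounded_fm\<close> that the bound must not contain the bound variable.\<close>

inductive d0 :: "'a::{zero,one,plus,times,ord} set set \<Rightarrow> ((nat \<Rightarrow> 'a) \<Rightarrow> bool) \<Rightarrow> bool"
  for S where
  d0_False: "d0 S (\<lambda>e. False)"
| d0_eq: "trm s \<Longrightarrow> trm t \<Longrightarrow> d0 S (\<lambda>e. s e = t e)"
| d0_less: "trm s \<Longrightarrow> trm t \<Longrightarrow> d0 S (\<lambda>e. s e < t e)"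
| d0_mem: "A \<in> S \<Longrightarrow> trm t \<Longrightarrow> d0 S (\<lambda>e. t e \<in> A)"
| d0_imp: "d0 S P \<Longrightarrow> d0 S Q \<Longrightarrow> d0 S (\<lambda>e. P e \<longrightarrow> Q e)"
| d0_ball: "d0 S P \<Longrightarrow> trm t \<Longrightarrow> d0 S (\<lambda>e. \<forall>u<t e. P (u ## e))"

text \<open>The schemes range over predicates instead of formulas, so that the mathematics below
  never touches syntax; \<open>e\<close> supplies the number parameters, and set parameters enter
  through \<open>d0_mem\<close>.\<close>

locale rca0 =
  fixes S :: "'a::{zero,one,plus,times,ord} set set"
  assumes succ_nz: "x + 1 \<noteq> (0::'a)"
    and succ_inj: "x + 1 = y + (1::'a) \<Longrightarrow> x = y"
    and add_0r: "x + 0 = (x::'a)"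
    and add_succ: "x + (y + 1) = (x + y) + (1::'a)"
    and mul_0r: "x * 0 = (0::'a)"
    and mul_succ: "x * (y + 1) = x * y + (x::'a)"
    and not_less_0: "\<not> x < (0::'a)"
    and less_succ: "x < y + (1::'a) \<longleftrightarrow> x < y \<or> x = y"
    and sigma_induct: "d0 S P \<Longrightarrow> \<exists>u. P (u ## 0 ## e) \<Longrightarrow>
      (\<And>x. \<exists>u. P (u ## x ## e) \<Longrightarrow> \<exists>u. P (u ## (x + 1) ## e)) \<Longrightarrow> \<exists>u. P (u ## x ## e)"
    and delta_compr: "d0 S P \<Longrightarrow> d0 S Q \<Longrightarrow>
      (\<And>x. (\<exists>u. P (u ## x ## e)) \<longleftrightarrow> (\<forall>u. Q (u ## x ## e))) \<Longrightarrow> {x. \<exists>u. P (u ## x ## e)} \<in> S"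

section \<open>The Henkin model\<close>

text \<open>\<open>h\<close> is the quotient map of the closed terms by the equalities in
  \<open>H\<close>, left abstract so that the structure can be studied before the type that carries
  it is introduced.\<close>

locale henkin_model = henkin T p0 for T p0 +
  fixes h :: "tm \<Rightarrow> 'a::{zero,one,plus,times,ord}"
  assumes h_eq: "vars_tm s = {} \<Longrightarrow> vars_tm t = {} \<Longrightarrow> h s = h t \<longleftrightarrow> (s \<^bold>= t) \<in> H"
    and h_surj: "\<exists>t. vars_tm t = {} \<and> h t = u"
    and h_zero: "h \<^bold>0 = 0"
    and h_one: "h \<^bold>1 = 1"
    and h_add: "vars_tm s = {} \<Longrightarrow> vars_tm t = {} \<Longrightarrow> h (s \<^bold>+ t) = h s + h t"
    and h_mult: "vars_tm s = {} \<Longrightarrow> vars_tm t = {} \<Longrightarrow> h (s \<^bold>* t) = h s * h t"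
    and h_less: "vars_tm s = {} \<Longrightarrow> vars_tm t = {} \<Longrightarrow> h s < h t \<longleftrightarrow> (s \<^bold>< t) \<in> H"
begin

definition \<rho> :: "nat \<Rightarrow> 'a" where "\<rho> a = h (Par a)"

definition \<sigma> :: "nat \<Rightarrow> 'a set" where
  "\<sigma> a = {h t | t. vars_tm t = {} \<and> (t \<^bold>\<in> SPar a) \<in> H}"

definition Sets :: "'a set set" where "Sets = range \<sigma>"

abbreviation ev :: "(name \<Rightarrow> 'a) \<Rightarrow> (name \<Rightarrow> 'a set) \<Rightarrow> fm \<Rightarrow> bool" where
  "ev \<equiv> eval Sets \<rho> \<sigma>"

lemma \<rho>_surj: "\<exists>a. \<rho> a = u"
proof -
  obtain t where t: "vars_tm t = {}" "h t = u" using h_surj by blast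
  obtain a where "(t \<^bold>= Par a) \<in> H" using H_par t(1) by blast
  then have "h t = h (Par a)" using h_eq t(1) by simp
  then show ?thesis using t(2) by (auto simp: \<rho>_def)
qed

lemma tval_closed: "vars_tm t = {} \<Longrightarrow> tval \<rho> e t = h t"
  by (induction t) (auto simp: \<rho>_def h_zero h_one h_add h_mult)

lemma mem_\<sigma>: "vars_tm t = {} \<Longrightarrow> h t \<in> \<sigma> a \<longleftrightarrow> (t \<^bold>\<in> SPar a) \<in> H"
proof
  assume t: "vars_tm t = {}" and "h t \<in> \<sigma> a"
  then obtain s where s: "vars_tm s = {}" "(s \<^bold>\<in> SPar a) \<in> H" "h t = h s"
    by (auto simp: \<sigma>_def)
  then have "(s \<^bold>= t) \<in> H" using h_eq t by metis
  then show "(t \<^bold>\<in> SPar a) \<in> H"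
    using H_subst[of s t "''x''" "V ''x'' \<^bold>\<in> SPar a"] s t by simp
qed (auto simp: \<sigma>_def)

text \<open>Each element is named by a number parameter and each member of \<open>Sets\<close> by a
  set parameter, so the quantifiers of the structure range over exactly the instances decided by
  \<open>H\<close>.\<close>

lemma truth: "free_vars p = {} \<Longrightarrow> free_svars p = {} \<Longrightarrow> ev e E p \<longleftrightarrow> p \<in> H"
proof (induction p arbitrary: e E rule: measure_induct_rule[of complexity])
  case (less p)
  show ?case
  proof (cases p)
    case Falsum
    then show ?thesis using H_falsum by simp
  next
    case (Eq s t)
    then show ?thesis using less.prems by (simp add: tval_closed h_eq)
  next
    case (Less s t)
    then show ?thesis using less.prems by (simp add: tval_closed h_less)
  next
    case (Mem t A)
    then obtain a where "A = SPar a" using less.prems by (cases A) auto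
    then show ?thesis using less.prems Mem by (simp add: tval_closed mem_\<sigma>)
  next
    case (Imp q r)
    then show ?thesis using less.prems less.IH[of q e E] less.IH[of r e E] by (simp add: H_imp)
  next
    case (Forall x q)
    have "ev (e(x := \<rho> a)) E q \<longleftrightarrow> subst x (Par a) q \<in> H" for a
      using less.IH[of "subst x (Par a) q" e E] less.prems Forall
      by (simp add: eval_subst free_vars_subst)
    moreover have "ev e E p \<longleftrightarrow> (\<forall>a. ev (e(x := \<rho> a)) E q)"
      using \<rho>_surj Forall by (metis eval.simps(6))
    ultimately show ?thesis by (simp add: Forall H_all)
  next
    case (SForall X q)
    have "ev e (E(X := \<sigma> a)) q \<longleftrightarrow> ssubst X (SPar a) q \<in> H" for a
      using less.IH[of "ssubst X (SPar a) q" e E] less.prems SForall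
      by (simp add: eval_ssubst free_svars_ssubst)
    then show ?thesis by (simp add: SForall H_sall Sets_def)
  qed
qed

lemma trm_formula:
  assumes "trm f"
  shows "\<exists>t. vars_tm t \<subseteq> (\<Union>i. vars_tm (\<nu> i)) \<and> (\<forall>e. tval \<rho> e t = f (\<lambda>i. tval \<rho> e (\<nu> i)))"
  using assms
proof induction
  case (trm_var i)
  then show ?case by (intro exI[of _ "\<nu> i"]) auto
next
  case (trm_const c)
  obtain a where "\<rho> a = c" using \<rho>_surj by blast
  then show ?case by (intro exI[of _ "Par a"]) auto
next
  case (trm_add s t)
  then obtain s' t' where "vars_tm s' \<subseteq> (\<Union>i. vars_tm (\<nu> i))" "vars_tm t' \<subseteq> (\<Union>i. vars_tm (\<nu> i))"
    "\<forall>e. tval \<rho> e s' = s (\<lambda>i. tval \<rho> e (\<nu> i))" "\<forall>e. tval \<rho> e t' = t (\<lambda>i. tval \<rho> e (\<nu> i))"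
    by blast
  then show ?case by (intro exI[of _ "s' \<^bold>+ t'"]) auto
next
  case (trm_mult s t)
  then obtain s' t' where "vars_tm s' \<subseteq> (\<Union>i. vars_tm (\<nu> i))" "vars_tm t' \<subseteq> (\<Union>i. vars_tm (\<nu> i))"
    "\<forall>e. tval \<rho> e s' = s (\<lambda>i. tval \<rho> e (\<nu> i))" "\<forall>e. tval \<rho> e t' = t (\<lambda>i. tval \<rho> e (\<nu> i))"
    by blast
  then show ?case by (intro exI[of _ "s' \<^bold>* t'"]) auto
qed

text \<open>
  Letting \<open>\<nu>\<close> range over assignments of arbitrary terms to the indices makes renaming of bound
  variables unnecessary.
\<close>

lemma d0_formula:
  assumes "d0 Sets P" "finite (\<Union>i. vars_tm (\<nu> i))"
  shows "\<exists>p. bounded_fm p \<and> free_vars p \<subseteq> (\<Union>i. vars_tm (\<nu> i)) \<and> free_svars p = {} \<and>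
    (\<forall>e E. ev e E p \<longleftrightarrow> P (\<lambda>i. tval \<rho> e (\<nu> i)))"
  using assms
proof (induction arbitrary: \<nu>)
  case d0_False
  then show ?case by (intro exI[of _ "\<^bold>\<bottom>"]) (auto intro: bounded_fm.intros)
next
  case (d0_eq s t)
  obtain s' where "vars_tm s' \<subseteq> (\<Union>i. vars_tm (\<nu> i))" "\<forall>e. tval \<rho> e s' = s (\<lambda>i. tval \<rho> e (\<nu> i))"
    using trm_formula[OF d0_eq(1)] by blast
  moreover obtain t' where "vars_tm t' \<subseteq> (\<Union>i. vars_tm (\<nu> i))" "\<forall>e. tval \<rho> e t' = t (\<lambda>i. tval \<rho> e (\<nu> i))"
    using trm_formula[OF d0_eq(2)] by blast
  ultimately show ?case by (intro exI[of _ "s' \<^bold>= t'"]) (auto intro: bounded_fm.intros)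
next
  case (d0_less s t)
  obtain s' where "vars_tm s' \<subseteq> (\<Union>i. vars_tm (\<nu> i))" "\<forall>e. tval \<rho> e s' = s (\<lambda>i. tval \<rho> e (\<nu> i))"
    using trm_formula[OF d0_less(1)] by blast
  moreover obtain t' where "vars_tm t' \<subseteq> (\<Union>i. vars_tm (\<nu> i))" "\<forall>e. tval \<rho> e t' = t (\<lambda>i. tval \<rho> e (\<nu> i))"
    using trm_formula[OF d0_less(2)] by blast
  ultimately show ?case by (intro exI[of _ "s' \<^bold>< t'"]) (auto intro: bounded_fm.intros)
next
  case (d0_mem A t)
  obtain t' where "vars_tm t' \<subseteq> (\<Union>i. vars_tm (\<nu> i))" "\<forall>e. tval \<rho> e t' = t (\<lambda>i. tval \<rho> e (\<nu> i))"
    using trm_formula[OF d0_mem(2)] by blast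
  moreover obtain a where "A = \<sigma> a" using d0_mem(1) by (auto simp: Sets_def)
  ultimately show ?case by (intro exI[of _ "t' \<^bold>\<in> SPar a"]) (auto intro: bounded_fm.intros)
next
  case (d0_imp P Q)
  obtain p where "bounded_fm p" "free_vars p \<subseteq> (\<Union>i. vars_tm (\<nu> i))" "free_svars p = {}"
    "\<forall>e E. ev e E p \<longleftrightarrow> P (\<lambda>i. tval \<rho> e (\<nu> i))" using d0_imp.IH(1)[OF d0_imp.prems] by blast
  moreover obtain q where "bounded_fm q" "free_vars q \<subseteq> (\<Union>i. vars_tm (\<nu> i))" "free_svars q = {}"
    "\<forall>e E. ev e E q \<longleftrightarrow> Q (\<lambda>i. tval \<rho> e (\<nu> i))" using d0_imp.IH(2)[OF d0_imp.prems] by blast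
  ultimately show ?case by (intro exI[of _ "p \<^bold>\<longrightarrow> q"]) (auto intro: bounded_fm.intros)
next
  case (d0_ball P t)
  have "infinite (UNIV :: name set)" using infinite_UNIV_listI by blast
  then obtain x where x: "x \<notin> (\<Union>i. vars_tm (\<nu> i))"
    using ex_new_if_finite d0_ball.prems by blast
  define \<nu>' where "\<nu>' = case_nat (V x) \<nu>"
  have U: "(\<Union>i. vars_tm (\<nu>' i)) = insert x (\<Union>i. vars_tm (\<nu> i))"
  proof -
    have "(\<exists>i. z \<in> vars_tm (\<nu>' i)) \<longleftrightarrow> z \<in> vars_tm (\<nu>' 0) \<or> (\<exists>i. z \<in> vars_tm (\<nu>' (Suc i)))" for z
      by (metis not0_implies_Suc)
    then show ?thesis by (auto simp: \<nu>'_def)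
  qed
  obtain p where p: "bounded_fm p" "free_vars p \<subseteq> (\<Union>i. vars_tm (\<nu>' i))" "free_svars p = {}"
    "\<forall>e E. ev e E p \<longleftrightarrow> P (\<lambda>i. tval \<rho> e (\<nu>' i))"
    using d0_ball.IH[of \<nu>'] d0_ball.prems by (auto simp: U)
  obtain t' where t: "vars_tm t' \<subseteq> (\<Union>i. vars_tm (\<nu> i))" "\<forall>e. tval \<rho> e t' = t (\<lambda>i. tval \<rho> e (\<nu> i))"
    using trm_formula[OF d0_ball(2)] by blast
  have upd: "tval \<rho> (e(x := u)) (\<nu> i) = tval \<rho> e (\<nu> i)" for e u i
    using x by (intro tval_cong) auto
  have env: "(\<lambda>i. tval \<rho> (e(x := u)) (\<nu>' i)) = u ## (\<lambda>i. tval \<rho> e (\<nu> i))" for e u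
    unfolding \<nu>'_def scons_def by (rule ext) (simp add: upd split: nat.split)
  have bound: "tval \<rho> (e(x := u)) t' = tval \<rho> e t'" for e u
    using x t(1) by (intro tval_cong) auto
  have "ev e E (\<^bold>\<forall>x. V x \<^bold>< t' \<^bold>\<longrightarrow> p) \<longleftrightarrow>
      (\<forall>u<t (\<lambda>i. tval \<rho> e (\<nu> i)). P (u ## (\<lambda>i. tval \<rho> e (\<nu> i))))" for e E
    unfolding eval.simps bound p(4)[rule_format] env unfolding t(2)[rule_format] by simp
  moreover have "bounded_fm (\<^bold>\<forall>x. V x \<^bold>< t' \<^bold>\<longrightarrow> p)"
    using x t(1) p(1) by (intro bounded_fm.intros) blast+
  moreover have "free_vars (\<^bold>\<forall>x. V x \<^bold>< t' \<^bold>\<longrightarrow> p) \<subseteq> (\<Union>i. vars_tm (\<nu> i))"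
    using p(2) t(1) unfolding U by auto
  moreover have "free_svars (\<^bold>\<forall>x. V x \<^bold>< t' \<^bold>\<longrightarrow> p) = {}"
    using p(3) by simp
  ultimately show ?case by blast
qed

end

locale henkin_rca0 = henkin_model +
  assumes RCA0_sub: "RCA0 \<subseteq> T"
begin

lemma basic: "p \<in> basic_axioms \<Longrightarrow> ev e E p"
proof -
  assume p: "p \<in> basic_axioms"
  then have "p \<in> H" using RCA0_sub H_axiom by (auto simp: RCA0_def)
  moreover have "free_vars p = {}" "free_svars p = {}"
    using p by (auto simp: basic_axioms_def)
  ultimately show ?thesis using truth by blast
qed

text \<open>Index 0 becomes the quantified variable of a \<open>\<Sigma>\<^sup>0\<^sub>1\<close> or
  \<open>\<Pi>\<^sup>0\<^sub>1\<close> formula and index 1 the variable of the scheme; the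
  infinitely many other entries of \<open>e\<close> become parameters.\<close>

lemma d0_matrix:
  assumes "d0 Sets P"
  obtains p where "bounded_fm p" "free_vars p \<subseteq> {''x'', ''y''}" "free_svars p = {}"
    "\<And>e' E. ev e' E p \<longleftrightarrow> P (e' ''y'' ## e' ''x'' ## e)"
proof -
  have "\<forall>i. \<exists>b. \<rho> b = e i" using \<rho>_surj by blast
  then obtain a where a: "\<And>i. \<rho> (a i) = e i" by metis
  define \<nu> where "\<nu> = (V ''y'' ## V ''x'' ## (\<lambda>i. Par (a i)))"
  have U: "(\<Union>i. vars_tm (\<nu> i)) \<subseteq> {''x'', ''y''}"
    by (auto simp: \<nu>_def scons_def split: nat.splits)
  then have "finite (\<Union>i. vars_tm (\<nu> i))" by (rule finite_subset) simp
  from d0_formula[OF assms this] obtain p where p: "bounded_fm p"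
    "free_vars p \<subseteq> (\<Union>i. vars_tm (\<nu> i))" "free_svars p = {}"
    "\<forall>e E. ev e E p \<longleftrightarrow> P (\<lambda>i. tval \<rho> e (\<nu> i))" by blast
  have "(\<lambda>i. tval \<rho> e' (\<nu> i)) = e' ''y'' ## e' ''x'' ## e" for e'
    by (rule ext) (auto simp: \<nu>_def scons_def a split: nat.split)
  with p U show thesis by (intro that[of p]) auto
qed

lemma sigma_induct_Sets:
  assumes "d0 Sets P" "\<exists>u. P (u ## 0 ## e)"
    "\<And>x. \<exists>u. P (u ## x ## e) \<Longrightarrow> \<exists>u. P (u ## (x + 1) ## e)"
  shows "\<exists>u. P (u ## x ## e)"
proof -
  obtain p where p: "bounded_fm p" "free_vars p \<subseteq> {''x'', ''y''}" "free_svars p = {}"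
    "\<And>e' E. ev e' E p \<longleftrightarrow> P (e' ''y'' ## e' ''x'' ## e)"
    using d0_matrix[OF assms(1)] by blast
  define q where "q = (\<^bold>\<exists>''y''. p)"
  have fv: "free_vars q \<subseteq> {''x''}" "free_svars q = {}" using p by (auto simp: q_def)
  have q: "ev e' E q \<longleftrightarrow> (\<exists>u. P (u ## e' ''x'' ## e))" for e' E by (simp add: q_def p(4))
  define ax where "ax = (subst ''x'' \<^bold>0 q \<^bold>\<and> (\<^bold>\<forall>''x''. q \<^bold>\<longrightarrow> subst ''x'' (V ''x'' \<^bold>+ \<^bold>1) q) \<^bold>\<longrightarrow> (\<^bold>\<forall>''x''. q))"
  have "q \<in> Sigma01" using p(1) by (auto simp: Sigma01_def q_def)
  then have "ax \<in> T" using RCA0_sub by (auto simp: RCA0_def Sigma01_induction_def ax_def)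
  moreover have "free_vars (subst ''x'' (V ''x'' \<^bold>+ \<^bold>1) q) \<subseteq> {''x''}"
  proof -
    have *: "vars_tm (subst_tm ''x'' (V ''x'' \<^bold>+ \<^bold>1) t) \<subseteq> insert ''x'' (vars_tm t)" for t
      by (induction t) auto
    have "free_vars (subst ''x'' (V ''x'' \<^bold>+ \<^bold>1) r) \<subseteq> insert ''x'' (free_vars r)" for r
    proof (induction r)
      case (Eq s t)
      then show ?case using *[of s] *[of t] by auto
    next
      case (Less s t)
      then show ?case using *[of s] *[of t] by auto
    next
      case (Mem t A)
      then show ?case using *[of t] by simp
    qed auto
    with fv show ?thesis by blast
  qed
  then have "free_vars ax = {}" "free_svars ax = {}"
    using fv by (auto simp: ax_def free_vars_subst)
  ultimately have "ev undefined undefined ax" using truth H_axiom by blast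
  then show ?thesis
    using assms(2,3) by (auto simp: ax_def eval_subst q)
qed

lemma delta_compr_Sets:
  assumes "d0 Sets P" "d0 Sets Q" "\<And>x. (\<exists>u. P (u ## x ## e)) \<longleftrightarrow> (\<forall>u. Q (u ## x ## e))"
  shows "{x. \<exists>u. P (u ## x ## e)} \<in> Sets"
proof -
  obtain p where p: "bounded_fm p" "free_vars p \<subseteq> {''x'', ''y''}" "free_svars p = {}"
    "\<And>e' E. ev e' E p \<longleftrightarrow> P (e' ''y'' ## e' ''x'' ## e)"
    using d0_matrix[OF assms(1)] by blast
  obtain q where q: "bounded_fm q" "free_vars q \<subseteq> {''x'', ''y''}" "free_svars q = {}"
    "\<And>e' E. ev e' E q \<longleftrightarrow> Q (e' ''y'' ## e' ''x'' ## e)"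
    using d0_matrix[OF assms(2)] by blast
  define ax where "ax = ((\<^bold>\<forall>''x''. (\<^bold>\<exists>''y''. p) \<^bold>\<longleftrightarrow> (\<^bold>\<forall>''y''. q)) \<^bold>\<longrightarrow>
    (\<^bold>\<exists>\<^sub>S''X''. \<^bold>\<forall>''x''. V ''x'' \<^bold>\<in> SV ''X'' \<^bold>\<longleftrightarrow> (\<^bold>\<exists>''y''. p)))"
  have "ax \<in> Delta01_comprehension"
    unfolding Delta01_comprehension_def ax_def using p q
    by (intro CollectI exI[of _ "''x''"] exI[of _ "''X''"] exI[of _ "\<^bold>\<exists>''y''. p"] exI[of _ "\<^bold>\<forall>''y''. q"])
      (auto simp: Sigma01_def Pi01_def)
  then have "ax \<in> T" using RCA0_sub by (auto simp: RCA0_def)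
  moreover have "free_vars ax = {}" "free_svars ax = {}"
    using p q by (auto simp: ax_def)
  ultimately have ax: "ev undefined undefined ax" using truth H_axiom by blast
  have premise: "ev e' E (\<^bold>\<forall>''x''. (\<^bold>\<exists>''y''. p) \<^bold>\<longleftrightarrow> (\<^bold>\<forall>''y''. q)) \<longleftrightarrow>
      (\<forall>x. (\<exists>u. P (u ## x ## e)) \<longleftrightarrow> (\<forall>u. Q (u ## x ## e)))" for e' E
    by (simp only: eval_connectives(3,4) eval.simps(6) p(4) q(4)) simp
  have conclusion: "ev e' E (\<^bold>\<exists>\<^sub>S''X''. \<^bold>\<forall>''x''. V ''x'' \<^bold>\<in> SV ''X'' \<^bold>\<longleftrightarrow> (\<^bold>\<exists>''y''. p)) \<longleftrightarrow>
      (\<exists>X\<in>Sets. \<forall>x. x \<in> X \<longleftrightarrow> (\<exists>u. P (u ## x ## e)))" for e' E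
    by (simp only: eval_connectives(3,4,5) eval.simps(4,6) tval.simps sval.simps p(4)) simp
  have "\<exists>X\<in>Sets. \<forall>x. x \<in> X \<longleftrightarrow> (\<exists>u. P (u ## x ## e))"
    by (rule mp[OF ax[unfolded ax_def eval.simps(5)[where p = "\<^bold>\<forall>''x''. _"] premise conclusion]])
      (simp add: assms(3))
  then obtain X where X: "X \<in> Sets" "\<forall>x. x \<in> X \<longleftrightarrow> (\<exists>u. P (u ## x ## e))" by blast
  have "X = {x. \<exists>u. P (u ## x ## e)}" by (rule set_eqI) (simp add: X(2))
  with X(1) show ?thesis by simp
qed

lemma basic_Sets:
  shows "x + 1 \<noteq> (0::'a)" "x + 1 = y + (1::'a) \<Longrightarrow> x = y" "x + 0 = (x::'a)"
    "x + (y + 1) = (x + y) + (1::'a)" "x * 0 = (0::'a)" "x * (y + 1) = x * y + (x::'a)"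
    "\<not> x < (0::'a)" "x < y + (1::'a) \<longleftrightarrow> x < y \<or> x = y"
proof -
  have "(\<forall>p\<in>basic_axioms. ev undefined undefined p) \<longleftrightarrow>
      (\<forall>x. x + 1 \<noteq> (0::'a)) \<and> (\<forall>x y. x + 1 = y + (1::'a) \<longrightarrow> x = y) \<and> (\<forall>x. x + 0 = (x::'a)) \<and>
      (\<forall>x y. x + (y + 1) = (x + y) + (1::'a)) \<and> (\<forall>x. x * 0 = (0::'a)) \<and>
      (\<forall>x y. x * (y + 1) = x * y + (x::'a)) \<and> (\<forall>x. \<not> x < (0::'a)) \<and>
      (\<forall>x y. (x < y + (1::'a) \<longrightarrow> \<not> x < y \<longrightarrow> x = y) \<and> (\<not> x < y \<and> x \<noteq> y \<or> x < y + (1::'a)))"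
    by (simp add: basic_axioms_def)
  then have *: "(\<forall>x. x + 1 \<noteq> (0::'a)) \<and> (\<forall>x y. x + 1 = y + (1::'a) \<longrightarrow> x = y) \<and> (\<forall>x. x + 0 = (x::'a)) \<and>
      (\<forall>x y. x + (y + 1) = (x + y) + (1::'a)) \<and> (\<forall>x. x * 0 = (0::'a)) \<and>
      (\<forall>x y. x * (y + 1) = x * y + (x::'a)) \<and> (\<forall>x. \<not> x < (0::'a)) \<and>
      (\<forall>x y. (x < y + (1::'a) \<longrightarrow> \<not> x < y \<longrightarrow> x = y) \<and> (\<not> x < y \<and> x \<noteq> y \<or> x < y + (1::'a)))"
    by (rule iffD1) (simp add: basic)
  from * have a: "\<forall>x. x + 1 \<noteq> (0::'a)" "\<forall>x y. x + 1 = y + (1::'a) \<longrightarrow> x = y" "\<forall>x. x + 0 = (x::'a)"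
    "\<forall>x y. x + (y + 1) = (x + y) + (1::'a)" "\<forall>x. x * 0 = (0::'a)"
    "\<forall>x y. x * (y + 1) = x * y + (x::'a)" "\<forall>x. \<not> x < (0::'a)"
    "\<forall>x y. (x < y + (1::'a) \<longrightarrow> \<not> x < y \<longrightarrow> x = y) \<and> (\<not> x < y \<and> x \<noteq> y \<or> x < y + (1::'a))"
    by - (elim conjE, assumption)+
  show "x + 1 \<noteq> (0::'a)" by (rule a(1)[rule_format])
  show "x + 1 = y + (1::'a) \<Longrightarrow> x = y" by (rule a(2)[rule_format])
  show "x + 0 = (x::'a)" by (rule a(3)[rule_format])
  show "x + (y + 1) = (x + y) + (1::'a)" by (rule a(4)[rule_format])
  show "x * 0 = (0::'a)" by (rule a(5)[rule_format])
  show "x * (y + 1) = x * y + (x::'a)" by (rule a(6)[rule_format])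
  show "\<not> x < (0::'a)" by (rule a(7)[rule_format])
  show "x < y + (1::'a) \<longleftrightarrow> x < y \<or> x = y"
    using spec[OF spec[OF a(8), of x], of y] by argo
qed

sublocale rca0 Sets
  by unfold_locales (fact basic_Sets sigma_induct_Sets delta_compr_Sets)+

end

text \<open>Renaming commutes with substitution and preserves free set variables and the class of a
  formula, so instances of the schemes go to instances. This is the closure that
  \<open>henkin\<close> requires.\<close>

lemma RCA0_ren: "p \<in> RCA0 \<Longrightarrow> ren f g p \<in> RCA0"
proof -
  have bounded: "bounded_fm p \<Longrightarrow> bounded_fm (ren f g p)" for p
    by (induction rule: bounded_fm.induct) (auto intro: bounded_fm.intros)
  have sigma: "p \<in> Sigma01 \<Longrightarrow> ren f g p \<in> Sigma01" and pi: "p \<in> Pi01 \<Longrightarrow> ren f g p \<in> Pi01" for p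
    using bounded by (auto simp: Sigma01_def Pi01_def)
  have fsv: "free_svars (ren f g p) = free_svars p" for p
  proof -
    have "free_svars_st (ren_st g A) = free_svars_st A" for A by (cases A) auto
    then show ?thesis by (induction p) auto
  qed
  assume "p \<in> RCA0"
  then consider "p \<in> basic_axioms" | "p \<in> Sigma01_induction" | "p \<in> Delta01_comprehension"
    by (auto simp: RCA0_def)
  then show ?thesis
  proof cases
    case 1
    then have "ren f g p = p" by (auto simp: basic_axioms_def)
    then show ?thesis using 1 by (simp add: RCA0_def)
  next
    case 2
    then obtain x q where "q \<in> Sigma01"
      "p = (subst x \<^bold>0 q \<^bold>\<and> (\<^bold>\<forall>x. q \<^bold>\<longrightarrow> subst x (V x \<^bold>+ \<^bold>1) q) \<^bold>\<longrightarrow> (\<^bold>\<forall>x. q))"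
      by (auto simp: Sigma01_induction_def)
    then have "ren f g p \<in> Sigma01_induction"
      unfolding Sigma01_induction_def
      by (intro CollectI exI[of _ x] exI[of _ "ren f g q"]) (auto simp: ren_subst sigma)
    then show ?thesis by (simp add: RCA0_def)
  next
    case 3
    then obtain x X q r where "q \<in> Sigma01" "r \<in> Pi01" "X \<notin> free_svars q"
      "p = ((\<^bold>\<forall>x. q \<^bold>\<longleftrightarrow> r) \<^bold>\<longrightarrow> (\<^bold>\<exists>\<^sub>SX. \<^bold>\<forall>x. V x \<^bold>\<in> SV X \<^bold>\<longleftrightarrow> q))"
      by (auto simp: Delta01_comprehension_def)
    then have "ren f g p \<in> Delta01_comprehension"
      unfolding Delta01_comprehension_def
      by (intro CollectI exI[of _ x] exI[of _ X] exI[of _ "ren f g q"] exI[of _ "ren f g r"])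
        (auto simp: sigma pi fsv)
    then show ?thesis by (simp add: RCA0_def)
  qed
qed

section \<open>Arithmetic from the axioms\<close>

lemma trm_subst: "trm t \<Longrightarrow> (\<And>i. trm (r i)) \<Longrightarrow> trm (\<lambda>e. t (\<lambda>i. r i e))"
  by (induction rule: trm.induct) (auto intro: trm.intros)

lemma d0_subst: "d0 S P \<Longrightarrow> (\<And>i. trm (r i)) \<Longrightarrow> d0 S (\<lambda>e. P (\<lambda>i. r i e))"
proof (induction arbitrary: r rule: d0.induct)
  case (d0_ball P t)
  \<comment> \<open>The substitution under the binder: index 0 stays, and the other terms are
    shifted past it.\<close>
  define r' where "r' = (\<lambda>i. case i of 0 \<Rightarrow> (\<lambda>e. e 0) | Suc j \<Rightarrow> (\<lambda>e. r j (\<lambda>i. e (Suc i))))"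
  have "trm (r' i)" for i
    using trm_subst[OF d0_ball.prems, of "\<lambda>i e. e (Suc i)"]
    by (auto simp: r'_def intro: trm.intros split: nat.split)
  from d0_ball.IH[OF this] trm_subst[OF d0_ball.hyps(2) d0_ball.prems]
  have "d0 S (\<lambda>e. \<forall>u<t (\<lambda>i. r i e). P (\<lambda>i. r' i (u ## e)))"
    by (rule d0.d0_ball)
  moreover have "(\<lambda>i. r' i (u ## e)) = u ## (\<lambda>i. r i e)" for u e
    by (auto simp: r'_def scons_def split: nat.split)
  ultimately show ?case by simp
next
  case (d0_eq s t)
  show ?case by (rule d0.d0_eq; rule trm_subst; fact)
next
  case (d0_less s t)
  show ?case by (rule d0.d0_less; rule trm_subst; fact)
next
  case (d0_mem A t)
  show ?case by (rule d0.d0_mem, fact, rule trm_subst; fact)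
next
  case (d0_imp P Q)
  show ?case by (rule d0.d0_imp; (rule d0_imp.IH; fact))
qed (rule d0.d0_False)

lemma d0_not: "d0 S P \<Longrightarrow> d0 S (\<lambda>e. \<not> P e)"
  using d0_imp[OF _ d0_False, of S P] by simp

lemma d0_disj: "d0 S P \<Longrightarrow> d0 S Q \<Longrightarrow> d0 S (\<lambda>e. P e \<or> Q e)"
  using d0_imp[OF d0_not, of S P Q] by (simp add: disj_imp)

lemma d0_conj: "d0 S P \<Longrightarrow> d0 S Q \<Longrightarrow> d0 S (\<lambda>e. P e \<and> Q e)"
  using d0_not[OF d0_imp[OF _ d0_not], of S P Q] by simp

lemma d0_iff: "d0 S P \<Longrightarrow> d0 S Q \<Longrightarrow> d0 S (\<lambda>e. P e \<longleftrightarrow> Q e)"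
  using d0_conj[OF d0_imp d0_imp, of S P Q Q P] by (simp add: iff_conv_conj_imp)

text \<open>With the bound value as a separate argument of \<open>P\<close>, higher-order
  unification can take ordinary HOL quantifiers apart.\<close>

lemma d0_all_less: "trm t \<Longrightarrow> d0 S (\<lambda>e. P (e 0) (\<lambda>i. e (Suc i))) \<Longrightarrow> d0 S (\<lambda>e. \<forall>u<t e. P u e)"
  using d0_ball[of S "\<lambda>e. P (e 0) (\<lambda>i. e (Suc i))" t] by simp

lemma d0_ex_less: "trm t \<Longrightarrow> d0 S (\<lambda>e. P (e 0) (\<lambda>i. e (Suc i))) \<Longrightarrow> d0 S (\<lambda>e. \<exists>u<t e. P u e)"
  using d0_not[OF d0_all_less[of t S "\<lambda>u e. \<not> P u e"]] by (simp add: d0_not)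

lemmas d0_intros = trm.intros d0_False d0_eq d0_less d0_mem d0_imp d0_not d0_disj d0_conj d0_iff
  d0_all_less d0_ex_less

context rca0
begin

lemma sigma_induct_ex:
  assumes "d0 S (\<lambda>e. P (e 0) (e (Suc 0)))" "\<exists>u. P u 0" "\<And>x u. P u x \<Longrightarrow> \<exists>u. P u (x + 1)"
  shows "\<exists>u. P u x"
  using sigma_induct[OF assms(1), of "\<lambda>_. 0" x] assms(2,3) by auto

lemma d0_induct:
  assumes "d0 S (\<lambda>e. P (e 0))" "P 0" "\<And>x. P x \<Longrightarrow> P (x + 1)"
  shows "P x"
proof -
  have "d0 S (\<lambda>e. P (e (Suc 0)))"
    using d0_subst[OF assms(1), of "\<lambda>i e. e (Suc i)"] by (auto intro: trm.intros)
  from sigma_induct_ex[of "\<lambda>u. P", OF this] show ?thesis using assms(2,3) by blast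
qed

lemma add_0l: "0 + x = (x::'a)"
  by (rule d0_induct[where x = x]) (intro d0_intros, simp_all add: add_0r add_succ)

lemma add_succ_left: "(x + 1) + y = (x + y) + (1::'a)"
  by (rule d0_induct[where x = y]) (intro d0_intros, simp_all add: add_0r add_succ)

lemma add_comm: "x + y = y + (x::'a)"
  by (rule d0_induct[where x = y]) (intro d0_intros, simp_all add: add_0r add_0l add_succ add_succ_left)

lemma add_assoc': "(x + y) + z = x + (y + (z::'a))"
  by (rule d0_induct[where x = z]) (intro d0_intros, simp_all add: add_0r add_succ)

lemma add_left_comm': "x + (y + z) = y + (x + (z::'a))"
  by (metis add_comm add_assoc')

lemmas add_ac' = add_assoc' add_comm add_left_comm'

lemma mul_0l: "0 * x = (0::'a)"
  by (rule d0_induct[where x = x]) (intro d0_intros, simp_all add: mul_0r mul_succ add_0r)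

lemma mul_succ_left: "(x + 1) * y = x * y + (y::'a)"
proof (rule d0_induct[where x = y])
  show "d0 S (\<lambda>e. (x + 1) * e 0 = x * e 0 + e 0)" by (intro d0_intros)
  show "(x + 1) * (y + 1) = x * (y + 1) + (y + 1)" if "(x + 1) * y = x * y + y" for y
    unfolding mul_succ that by (simp add: add_ac')
qed (simp add: mul_0r add_0r)

lemma mul_comm: "x * y = y * (x::'a)"
  by (rule d0_induct[where x = y]) (intro d0_intros, simp_all add: mul_0r mul_0l mul_succ mul_succ_left)

lemma distrib: "x * (y + z) = x * y + x * (z::'a)"
proof (rule d0_induct[where x = z])
  show "d0 S (\<lambda>e. x * (y + e 0) = x * y + x * e 0)" by (intro d0_intros)
  show "x * (y + (z + 1)) = x * y + x * (z + 1)" if "x * (y + z) = x * y + x * z" for z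
    unfolding add_succ mul_succ that by (rule add_assoc')
qed (simp add: mul_0r add_0r)

lemma mul_1r: "x * 1 = (x::'a)"
  using mul_succ[of x 0] by (simp add: mul_0r add_0l)

lemma mul_assoc: "(x * y) * z = x * (y * (z::'a))"
  by (rule d0_induct[where x = z]) (intro d0_intros, simp_all add: mul_0r mul_1r distrib)

lemma add_right_cancel': "x + z = y + z \<Longrightarrow> x = (y::'a)"
proof (rule mp, rule d0_induct[where x = z])
  show "d0 S (\<lambda>e. x + e 0 = y + e 0 \<longrightarrow> x = y)" by (intro d0_intros)
qed (auto simp: add_0r add_succ dest: succ_inj)

lemma less_iff: "x < y \<longleftrightarrow> (\<exists>z. y = x + (z + (1::'a)))"
proof
  \<comment> \<open>The implication stands inside the quantifier to keep the induction statement
    existential with a bounded matrix.\<close>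
  have "\<exists>z. x < y \<longrightarrow> y = x + (z + 1)"
  proof (rule sigma_induct_ex[where x = y])
    show "d0 S (\<lambda>e. x < e (Suc 0) \<longrightarrow> e (Suc 0) = x + (e 0 + 1))" by (intro d0_intros)
    show "\<exists>z. x < 0 \<longrightarrow> 0 = x + (z + 1)" using not_less_0 by blast
    show "\<exists>z. x < y + 1 \<longrightarrow> y + 1 = x + (z + 1)" if "x < y \<longrightarrow> y = x + (u + 1)" for y u
    proof (cases "x < y")
      case True
      with that have "y + 1 = x + ((u + 1) + 1)" by (metis add_succ)
      then show ?thesis by blast
    next
      case False
      have "x + 1 = x + (0 + 1)" by (simp add: add_0l)
      with False show ?thesis using less_succ by blast
    qed
  qed
  then show "x < y \<Longrightarrow> \<exists>z. y = x + (z + 1)" by blast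
  have "x < x + (z + 1)" for z
  proof (rule d0_induct[where x = z])
    show "d0 S (\<lambda>e. x < x + (e 0 + 1))" by (intro d0_intros)
    show "x < x + (0 + 1)" using less_succ[of x x] by (simp add: add_0l)
    show "x < x + ((z + 1) + 1)" if "x < x + (z + 1)" for z
      using that less_succ[of x "x + (z + 1)"] by (simp add: add_succ)
  qed
  then show "\<exists>z. y = x + (z + 1) \<Longrightarrow> x < y" by blast
qed

lemma zero_or_succ: "x = 0 \<or> (\<exists>z. x = z + (1::'a))"
proof -
  have "\<exists>z. x = 0 \<or> x = z + 1"
  proof (rule sigma_induct_ex[where x = x])
    show "d0 S (\<lambda>e. e (Suc 0) = 0 \<or> e (Suc 0) = e 0 + 1)" by (intro d0_intros)
  qed blast+
  then show ?thesis by blast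
qed

lemma less_irrefl': "\<not> x < (x::'a)"
proof
  assume "x < x"
  then obtain z where "x = x + (z + 1)" by (rule exE[OF less_iff[THEN iffD1]])
  then have "0 + x = (z + 1) + x" by (simp add: add_0l add_comm)
  then show False using add_right_cancel' succ_nz by metis
qed

lemma less_trans': "x < y \<Longrightarrow> y < z \<Longrightarrow> x < (z::'a)"
proof -
  assume "x < y" "y < z"
  then obtain a b where "y = x + (a + 1)" "z = y + (b + 1)" by (auto simp: less_iff)
  then have "z = x + ((a + 1 + b) + 1)" by (simp add: add_ac')
  then show ?thesis using less_iff by blast
qed

lemma less_linear': "x < y \<or> x = y \<or> y < (x::'a)"
proof (rule d0_induct[where x = x])
  show "d0 S (\<lambda>e. e 0 < y \<or> e 0 = y \<or> y < e 0)" by (intro d0_intros)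
  show "0 < y \<or> 0 = y \<or> y < 0"
    using zero_or_succ[of y] less_iff[of 0 y] by (metis add_0l)
  show "x + 1 < y \<or> x + 1 = y \<or> y < x + 1" if "x < y \<or> x = y \<or> y < x" for x
  proof (cases "x < y")
    case True
    then obtain z where z: "y = x + (z + 1)" by (auto simp: less_iff)
    from zero_or_succ[of z] show ?thesis
    proof
      assume "\<exists>w. z = w + 1"
      then obtain w where "z = w + 1" by blast
      then have "y = (x + 1) + (w + 1)" using z by (simp add: add_ac')
      then show ?thesis using less_iff by blast
    qed (use z in \<open>simp add: add_0l\<close>)
  next
    case False
    then show ?thesis using that less_succ by blast
  qed
qed

lemma add_less_mono': "x < y \<Longrightarrow> z + x < z + (y::'a)"
  by (auto simp: less_iff add_assoc')

lemma mul_less_mono': "x < y \<Longrightarrow> 0 < z \<Longrightarrow> z * x < z * (y::'a)"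
proof -
  assume "x < y" "0 < z"
  then obtain a b where "y = x + (a + 1)" "z = b + 1" by (auto simp: less_iff add_0l)
  then have "z * y = z * x + (((b + 1) * a + b) + 1)" by (simp add: distrib mul_1r add_assoc')
  then show ?thesis using less_iff by blast
qed

lemma succ_le: "x < y \<Longrightarrow> x + 1 < y \<or> x + 1 = (y::'a)"
  using less_linear'[of "x + 1" y] less_succ[of y x] less_irrefl' less_trans' by metis

end

section \<open>A structure refuting the theorem, if there is one\<close>

abbreviation (input) target :: fm where "target \<equiv> AHT 2 \<^bold>\<longrightarrow> SRT2 2"

abbreviation henkin_counter :: "fm set" where "henkin_counter \<equiv> henkin_set RCA0 (\<^bold>\<not> target)"

text \<open>
  The type \<open>dom\<close> carries the countable Henkin model of \<open>RCA\<^sub>0 + \<not> target\<close> if that theory is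
  consistent, and the standard natural numbers otherwise, so that it is an ordered semiring
  unconditionally.
\<close>

typedef dom = "UNIV :: nat set" ..

text \<open>A choice operator is used because the map is known to exist only if the theorem fails,
  which a definition cannot assume.\<close>

definition name_of :: "tm \<Rightarrow> dom" where
  "name_of = (SOME h. (\<forall>u. \<exists>t. vars_tm t = {} \<and> h t = u) \<and>
    (\<forall>s t. vars_tm s = {} \<longrightarrow> vars_tm t = {} \<longrightarrow> h s = h t \<longleftrightarrow> (s \<^bold>= t) \<in> henkin_counter))"

definition rep_term :: "dom \<Rightarrow> tm" where
  "rep_term u = (SOME t. vars_tm t = {} \<and> name_of t = u)"

instantiation dom :: "{zero,one,plus,times,ord,minus}"
begin

definition "0 = (if RCA0 \<^bold>\<turnstile> target then Abs_dom 0 else name_of \<^bold>0)"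
definition "1 = (if RCA0 \<^bold>\<turnstile> target then Abs_dom 1 else name_of \<^bold>1)"
definition "x + y = (if RCA0 \<^bold>\<turnstile> target then Abs_dom (Rep_dom x + Rep_dom y)
  else name_of (rep_term x \<^bold>+ rep_term y))"
definition "x * y = (if RCA0 \<^bold>\<turnstile> target then Abs_dom (Rep_dom x * Rep_dom y)
  else name_of (rep_term x \<^bold>* rep_term y))"
definition "x < y \<longleftrightarrow> (if RCA0 \<^bold>\<turnstile> target then Rep_dom x < Rep_dom y
  else (rep_term x \<^bold>< rep_term y) \<in> henkin_counter)"
definition "x \<le> y \<longleftrightarrow> x < y \<or> x = (y::dom)"
text \<open>Truncated subtraction, demanded by the type class and recovered from addition.\<close>

definition "x - y = (if \<exists>z. x = y + z then THE z. x = y + z else (0::dom))"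

instance ..

end

lemma henkin_counter: "\<not> RCA0 \<^bold>\<turnstile> target \<Longrightarrow> henkin RCA0 (\<^bold>\<not> target)"
  by unfold_locales (auto simp: provable_def intro: RCA0_ren Class)

lemma RCA0_basic: "p \<in> basic_axioms \<Longrightarrow> p \<in> RCA0"
  by (simp add: RCA0_def)

text \<open>Closed terms modulo equality in \<open>H\<close> are countable, and infinite because the
  successor axioms separate the numerals; a bijection with \<open>nat\<close> transports them to
  \<open>dom\<close>.\<close>

lemma name_of_exists:
  assumes "\<not> RCA0 \<^bold>\<turnstile> target"
  shows "\<exists>h :: tm \<Rightarrow> dom. (\<forall>u. \<exists>t. vars_tm t = {} \<and> h t = u) \<and>
    (\<forall>s t. vars_tm s = {} \<longrightarrow> vars_tm t = {} \<longrightarrow> h s = h t \<longleftrightarrow> (s \<^bold>= t) \<in> henkin_counter)"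
proof -
  interpret henkin RCA0 "\<^bold>\<not> target" using assms by (rule henkin_counter)
  define cls where "cls t = {s. vars_tm s = {} \<and> (s \<^bold>= t) \<in> H}" for t
  have cls_eq: "cls s = cls t \<longleftrightarrow> (s \<^bold>= t) \<in> H" if "vars_tm s = {}" "vars_tm t = {}" for s t
  proof
    assume "cls s = cls t"
    moreover have "s \<in> cls s" using that H_refl by (simp add: cls_def)
    ultimately show "(s \<^bold>= t) \<in> H" by (simp add: cls_def)
  next
    assume "(s \<^bold>= t) \<in> H"
    then show "cls s = cls t"
      using H_trans H_sym that unfolding cls_def by (metis (lifting))
  qed
  define Q where "Q = cls ` {t. vars_tm t = {}}"
  have closed_num: "vars_tm (num_tm n) = {}" for n by (induction n) auto
  have succ_nz: "(t \<^bold>+ \<^bold>1 \<^bold>= \<^bold>0) \<notin> H" if "vars_tm t = {}" for t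
  proof -
    have "(\<^bold>\<forall>''n''. \<^bold>\<not> (V ''n'' \<^bold>+ \<^bold>1 \<^bold>= \<^bold>0)) \<in> H"
      by (rule H_axiom, rule RCA0_basic) (simp add: basic_axioms_def)
    from H_all_inst[OF this that] show ?thesis by (simp add: H_neg)
  qed
  have succ_inj: "(s \<^bold>= t) \<in> H" if "(s \<^bold>+ \<^bold>1 \<^bold>= t \<^bold>+ \<^bold>1) \<in> H" "vars_tm s = {}" "vars_tm t = {}" for s t
  proof -
    have "(\<^bold>\<forall>''m''. \<^bold>\<forall>''n''. V ''m'' \<^bold>+ \<^bold>1 \<^bold>= V ''n'' \<^bold>+ \<^bold>1 \<^bold>\<longrightarrow> V ''m'' \<^bold>= V ''n'') \<in> H"
      by (rule H_axiom, rule RCA0_basic) (simp add: basic_axioms_def)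
    from H_all_inst[OF this that(2)]
    have "(\<^bold>\<forall>''n''. s \<^bold>+ \<^bold>1 \<^bold>= V ''n'' \<^bold>+ \<^bold>1 \<^bold>\<longrightarrow> s \<^bold>= V ''n'') \<in> H" by simp
    from H_all_inst[OF this that(3)] show ?thesis using that by (simp add: H_imp)
  qed
  have num: "(num_tm m \<^bold>= num_tm n) \<in> H \<longleftrightarrow> m = n" for m n
  proof (induction m arbitrary: n)
    case 0
    then show ?case
      using succ_nz[OF closed_num] H_sym[of "\<^bold>0" "num_tm n"] closed_num[of n] H_refl
      by (cases n) auto
  next
    case (Suc m)
    then show ?case
    proof (cases n)
      case 0
      then show ?thesis using succ_nz[OF closed_num] by simp
    next
      case (Suc k)
      then show ?thesis using succ_inj[of "num_tm m" "num_tm k"] closed_num Suc.IH[of k] H_refl by auto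
    qed
  qed
  have "inj (\<lambda>n. cls (num_tm n))"
    using cls_eq closed_num num by (auto simp: inj_def)
  moreover have "range (\<lambda>n. cls (num_tm n)) \<subseteq> Q"
    using closed_num by (auto simp: Q_def)
  ultimately have "infinite Q" using finite_subset range_inj_infinite by blast
  moreover have "countable Q" by (simp add: Q_def)
  ultimately obtain b where b: "bij_betw b Q (UNIV :: nat set)"
    using countableE_infinite by blast
  define h where "h t = Abs_dom (b (cls t))" for t
  have "\<exists>t. vars_tm t = {} \<and> h t = u" for u
  proof -
    have "Rep_dom u \<in> b ` Q" using b by (simp add: bij_betw_def)
    then obtain t where "vars_tm t = {}" "b (cls t) = Rep_dom u" by (auto simp: Q_def)
    then show ?thesis by (auto simp: h_def Rep_dom_inverse)
  qed
  moreover have "h s = h t \<longleftrightarrow> (s \<^bold>= t) \<in> H" if "vars_tm s = {}" "vars_tm t = {}" for s t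
  proof -
    have "h s = h t \<longleftrightarrow> cls s = cls t"
      using that bij_betw_imp_inj_on[OF b] by (auto simp: h_def Abs_dom_inject Q_def inj_on_eq_iff)
    then show ?thesis using cls_eq that by simp
  qed
  ultimately show ?thesis by blast
qed

lemma henkin_model_counter:
  assumes "\<not> RCA0 \<^bold>\<turnstile> target"
  shows "henkin_rca0 RCA0 (\<^bold>\<not> target) name_of"
proof -
  interpret henkin RCA0 "\<^bold>\<not> target" using assms by (rule henkin_counter)
  have name_of: "\<And>u. \<exists>t. vars_tm t = {} \<and> name_of t = u"
    "\<And>s t. vars_tm s = {} \<Longrightarrow> vars_tm t = {} \<Longrightarrow> name_of s = name_of t \<longleftrightarrow> (s \<^bold>= t) \<in> H"
    using someI_ex[OF name_of_exists[OF assms]] unfolding name_of_def by blast+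
  have rep: "vars_tm (rep_term u) = {}" "name_of (rep_term u) = u" for u
    using someI_ex[OF name_of(1)[of u]] unfolding rep_term_def by blast+
  have rep_eq: "(rep_term (name_of t) \<^bold>= t) \<in> H" if "vars_tm t = {}" for t
    using rep name_of(2)[of "rep_term (name_of t)" t] that by simp
  note cong = H_subst[OF rep_eq rep(1)]
  show ?thesis
  proof unfold_locales
    fix s t assume st: "vars_tm s = {}" "vars_tm t = {}"
    let ?s = "rep_term (name_of s)" and ?t = "rep_term (name_of t)"
    show "name_of s = name_of t \<longleftrightarrow> (s \<^bold>= t) \<in> H" by (rule name_of(2)[OF st])
    have "(?s \<^bold>+ ?t \<^bold>= s \<^bold>+ t) \<in> H"
      using cong[OF st(1) st(1), of "''x''" "?s \<^bold>+ ?t \<^bold>= V ''x'' \<^bold>+ ?t"]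
        cong[OF st(2) st(2), of "''x''" "?s \<^bold>+ ?t \<^bold>= s \<^bold>+ V ''x''"] st rep H_refl by simp
    then show "name_of (s \<^bold>+ t) = name_of s + name_of t"
      using name_of(2)[of "?s \<^bold>+ ?t" "s \<^bold>+ t"] st rep by (simp add: plus_dom_def assms)
    have "(?s \<^bold>* ?t \<^bold>= s \<^bold>* t) \<in> H"
      using cong[OF st(1) st(1), of "''x''" "?s \<^bold>* ?t \<^bold>= V ''x'' \<^bold>* ?t"]
        cong[OF st(2) st(2), of "''x''" "?s \<^bold>* ?t \<^bold>= s \<^bold>* V ''x''"] st rep H_refl by simp
    then show "name_of (s \<^bold>* t) = name_of s * name_of t"
      using name_of(2)[of "?s \<^bold>* ?t" "s \<^bold>* t"] st rep by (simp add: times_dom_def assms)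
    have sym: "(u \<^bold>= rep_term (name_of u)) \<in> H" if "vars_tm u = {}" for u
      using H_sym[OF rep_eq[OF that] rep(1) that] .
    have "(s \<^bold>< t) \<in> H \<longleftrightarrow> (?s \<^bold>< ?t) \<in> H"
    proof
      show "(?s \<^bold>< ?t) \<in> H \<Longrightarrow> (s \<^bold>< t) \<in> H"
        using cong[OF st(1) st(1), of "''x''" "V ''x'' \<^bold>< ?t"]
          cong[OF st(2) st(2), of "''x''" "s \<^bold>< V ''x''"] st rep by simp
      show "(s \<^bold>< t) \<in> H \<Longrightarrow> (?s \<^bold>< ?t) \<in> H"
        using H_subst[OF sym[OF st(1)] st(1) rep(1), of "''x''" "V ''x'' \<^bold>< t"]
          H_subst[OF sym[OF st(2)] st(2) rep(1), of "''x''" "?s \<^bold>< V ''x''"] st rep by simp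
    qed
    then show "name_of s < name_of t \<longleftrightarrow> (s \<^bold>< t) \<in> H" by (simp add: less_dom_def assms)
  qed (use name_of(1) in \<open>auto simp: zero_dom_def one_dom_def assms\<close>)
qed

definition dom_sets :: "dom set set" where
  "dom_sets = (if RCA0 \<^bold>\<turnstile> target then UNIV else henkin_model.Sets RCA0 (\<^bold>\<not> target) name_of)"

text \<open>If the theorem is provable, the structure is the full standard one: comprehension is
  trivial, and induction comes from \<open>nat\<close>.\<close>

lemma rca0_dom: "rca0 dom_sets"
proof (cases "RCA0 \<^bold>\<turnstile> target")
  case True
  note ops = True zero_dom_def one_dom_def plus_dom_def times_dom_def less_dom_def
  have Rep: "Rep_dom (x + y) = Rep_dom x + Rep_dom y" "Rep_dom (x * y) = Rep_dom x * Rep_dom y"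
    "Rep_dom 0 = 0" "Rep_dom 1 = 1" "x < y \<longleftrightarrow> Rep_dom x < Rep_dom y" for x y
    by (auto simp: ops Abs_dom_inverse)
  have induct: "P x" if "P 0" "\<And>x. P x \<Longrightarrow> P (x + 1)" for P and x :: dom
  proof -
    have "P (Abs_dom n)" for n
    proof (induction n)
      case (Suc n)
      have "Abs_dom (Suc n) = Abs_dom n + 1" by (simp add: ops Abs_dom_inverse)
      with Suc that show ?case by simp
    qed (use that(1) in \<open>simp add: ops\<close>)
    then show ?thesis by (metis Rep_dom_inverse)
  qed
  show ?thesis
  proof unfold_locales
    show "\<exists>u. P (u ## x ## e)" if "\<exists>u. P (u ## 0 ## e)"
      "\<And>x. \<exists>u. P (u ## x ## e) \<Longrightarrow> \<exists>u. P (u ## (x + 1) ## e)" for P e and x :: dom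
      using induct[of "\<lambda>x. \<exists>u. P (u ## x ## e)"] that by blast
  qed (auto simp: Rep_dom_inject[symmetric] Rep dom_sets_def True algebra_simps)
next
  case False
  then interpret henkin_rca0 RCA0 "\<^bold>\<not> target" name_of by (rule henkin_model_counter)
  show ?thesis using False rca0_axioms by (simp add: dom_sets_def)
qed

interpretation dom: rca0 dom_sets by (rule rca0_dom)

instance dom :: discrete_linordered_semidom
proof
  fix a b c :: dom
  show "a + b + c = a + (b + c)" by (rule dom.add_assoc')
  show ac: "a + b = b + a" for a b :: dom by (rule dom.add_comm)
  show "0 + a = a" by (rule dom.add_0l)
  show "a * b * c = a * (b * c)" by (rule dom.mul_assoc)
  show mc: "a * b = b * a" for a b :: dom by (rule dom.mul_comm)
  show "1 * a = a" using dom.mul_1r[of a] mc[of 1 a] by simp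
  show "(a + b) * c = a * c + b * c" using dom.distrib[of c a b] mc[of c] by simp
  show "a * (b + c) = a * b + a * c" by (rule dom.distrib)
  show "0 * a = 0" by (rule dom.mul_0l)
  show "a * 0 = 0" by (rule dom.mul_0r)
  show "(0::dom) \<noteq> 1" using dom.succ_nz[of 0] dom.add_0l[of 1] by metis
  have cancel: "a = b" if "c + a = c + b" for a b c :: dom
    using that dom.add_right_cancel'[of a c b] ac by metis
  show diff_add: "a + b - a = b" for a b :: dom
    using cancel by (auto simp: minus_dom_def intro!: the_equality)
  show lt: "a < b \<longleftrightarrow> a \<le> b \<and> \<not> b \<le> a" for a b :: dom
    using dom.less_irrefl' dom.less_trans' unfolding less_eq_dom_def by metis
  show "a \<le> a" by (simp add: less_eq_dom_def)
  show "a \<le> b \<Longrightarrow> b \<le> c \<Longrightarrow> a \<le> c" using dom.less_trans' unfolding less_eq_dom_def by blast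
  show "a \<le> b \<Longrightarrow> b \<le> a \<Longrightarrow> a = b" using lt unfolding less_eq_dom_def by blast
  show "a \<le> b \<or> b \<le> a" using dom.less_linear' unfolding less_eq_dom_def by blast
  show "a \<le> b \<Longrightarrow> c + a \<le> c + b" using dom.add_less_mono' unfolding less_eq_dom_def by blast
  show "a < b \<Longrightarrow> 0 < c \<Longrightarrow> c * a < c * b" by (rule dom.mul_less_mono')
  show "(0::dom) < 1" using dom.less_succ[of 0 0] dom.add_0l[of 1] by simp
  have le_iff: "b \<le> a \<longleftrightarrow> (\<exists>z. a = b + z)" for a b :: dom
    unfolding less_eq_dom_def dom.less_iff using dom.zero_or_succ dom.add_0r by metis
  have not_le: "\<not> a < b \<longleftrightarrow> b \<le> a" for a b :: dom
    using dom.less_linear'[of a b] lt[of a b] lt[of b a] unfolding less_eq_dom_def by argo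
  show "b \<le> a \<Longrightarrow> a - b + b = a"
    unfolding le_iff using diff_add ac by metis
  have diff_zero: "a - b = 0" if "\<not> b \<le> a" for a b :: dom
    using that le_iff by (auto simp: minus_dom_def)
  show "a - b - c = a - (b + c)"
  proof (cases "b \<le> a")
    case True
    then obtain z where z: "a = b + z" using le_iff by blast
    show ?thesis
    proof (cases "c \<le> z")
      case True
      then obtain w where "z = c + w" using le_iff by blast
      then show ?thesis using z diff_add dom.add_assoc' by metis
    next
      case False
      then have "\<not> b + c \<le> a" using z le_iff cancel dom.add_assoc' by metis
      then show ?thesis using False z diff_zero diff_add by metis
    qed
  next
    case False
    then have "\<not> b + c \<le> a" using le_iff dom.add_assoc' by metis
    moreover have "0 - c = (0::dom)"
      using diff_add[of 0 0] dom.add_0l diff_zero[of c 0] le_iff dom.not_less_0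
      unfolding less_eq_dom_def by metis
    ultimately show ?thesis using False diff_zero by metis
  qed
  show "a * (b - c) = a * b - a * c"
  proof (cases "c \<le> b")
    case True
    then obtain z where "b = c + z" using le_iff by blast
    then show ?thesis using diff_add dom.distrib by metis
  next
    case False
    show ?thesis
    proof (cases "a = 0")
      case True
      then show ?thesis using diff_add[of 0 0] dom.add_0l dom.mul_0l by metis
    next
      case a: False
      then have "0 < a" using dom.less_linear'[of 0 a] dom.not_less_0 by blast
      then have "a * b < a * c" using False not_le dom.mul_less_mono' by blast
      then show ?thesis using diff_zero False dom.mul_0r not_le by metis
    qed
  qed
  show "a \<noteq> 0 \<Longrightarrow> b \<noteq> 0 \<Longrightarrow> a * b \<noteq> 0"
    using dom.mul_less_mono'[of 0 b a] dom.less_linear'[of 0] dom.not_less_0 dom.mul_0r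
      dom.less_irrefl' by metis
  have "a < a + 1" for a :: dom using dom.less_succ[of a a] by blast
  then show "a < b \<longleftrightarrow> a + 1 \<le> b"
    using dom.succ_le[of a b] dom.less_trans'[of a "a + 1" b] unfolding less_eq_dom_def by metis
qed

section \<open>Recursion theory in a model\<close>

locale rca0_arith = rca0 S for S :: "'a::discrete_linordered_semidom set set"
begin

declare not_less_0 [simp]

lemma nonneg [simp]: "0 \<le> (x::'a)"
  using not_less_0[of x] by (metis not_less)

lemma pos_iff: "0 < x \<longleftrightarrow> x \<noteq> (0::'a)"
  using nonneg[of x] by (auto simp: order_less_le)

lemma le_zero [simp]: "x \<le> 0 \<longleftrightarrow> x = (0::'a)"
  using nonneg[of x] by (auto intro: antisym)

lemma less_Suc: "x < y + 1 \<longleftrightarrow> x \<le> (y::'a)"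
  by (simp add: less_eq_iff_succ_less)

lemma succ_cases: obtains "x = 0" | y where "x = y + (1::'a)"
  using zero_or_succ by blast

lemma le_ex: "x \<le> y \<Longrightarrow> \<exists>z. y = x + (z::'a)"
  by (metis le_add_diff_inverse)

lemma less_ex: "x < y \<Longrightarrow> \<exists>z. y = x + z + (1::'a)"
  by (metis less_iff add.assoc)

subsection \<open>\<open>\<Sigma>\<^sup>0\<^sub>1\<close> and \<open>\<Delta>\<^sup>0\<^sub>1\<close> predicates\<close>

definition s1 :: "((nat \<Rightarrow> 'a) \<Rightarrow> bool) \<Rightarrow> bool" where
  "s1 P \<longleftrightarrow> (\<exists>Q. d0 S Q \<and> (\<forall>e. P e \<longleftrightarrow> (\<exists>u. Q (u ## e))))"

definition delta :: "((nat \<Rightarrow> 'a) \<Rightarrow> bool) \<Rightarrow> bool" where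
  "delta P \<longleftrightarrow> s1 P \<and> s1 (\<lambda>e. \<not> P e)"

text \<open>A total function with a \<open>\<Sigma>\<^sup>0\<^sub>1\<close> graph has a
  \<open>\<Delta>\<^sup>0\<^sub>1\<close> graph, since a wrong value is refuted by exhibiting the
  right one. Hence \<open>fn\<close> terms may be substituted into \<open>s1\<close> and
  \<open>delta\<close> predicates alike.\<close>

definition fn :: "((nat \<Rightarrow> 'a) \<Rightarrow> 'a) \<Rightarrow> bool" where
  "fn f \<longleftrightarrow> s1 (\<lambda>e. e 0 = f (\<lambda>i. e (Suc i)))"

lemma trm_scons: "trm f \<Longrightarrow> (\<And>i. trm (\<lambda>e. g e i)) \<Longrightarrow> trm (\<lambda>e. (f e ## g e) i)"
  by (cases i) auto

lemma d0_env: "d0 S Q \<Longrightarrow> (\<And>i. trm (\<lambda>e. \<xi> e i)) \<Longrightarrow> d0 S (\<lambda>e. Q (\<xi> e))"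
  using d0_subst[of S Q "\<lambda>i e. \<xi> e i"] by simp

lemmas env_intros = trm_scons trm.intros

lemma s1_d0: "d0 S P \<Longrightarrow> s1 P"
  unfolding s1_def using d0_env[of P "\<lambda>e i. e (Suc i)"]
  by (intro exI[of _ "\<lambda>e. P (\<lambda>i. e (Suc i))"]) (simp add: trm.intros)

lemma s1_env:
  assumes "s1 P" "\<And>i. trm (\<lambda>e. \<xi> e i)"
  shows "s1 (\<lambda>e. P (\<xi> e))"
proof -
  obtain Q where Q: "d0 S Q" "\<And>e. P e \<longleftrightarrow> (\<exists>u. Q (u ## e))"
    using assms(1) by (auto simp: s1_def)
  have "trm (\<lambda>e. \<xi> (\<lambda>i. e (Suc i)) i)" for i
    using trm_subst[OF assms(2), of "\<lambda>i e. e (Suc i)"] by (auto intro: trm.intros)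
  then have "d0 S (\<lambda>e. Q (e 0 ## \<xi> (\<lambda>i. e (Suc i))))"
    by (intro d0_env[OF Q(1)] env_intros)
  then show ?thesis
    unfolding s1_def using Q(2) by (intro exI[of _ "\<lambda>e. Q (e 0 ## \<xi> (\<lambda>i. e (Suc i)))"]) simp
qed

text \<open>Two unbounded quantifiers contract to one bound for both witnesses, before any pairing
  function is available.\<close>

lemma s1_ex:
  assumes "s1 (\<lambda>e. P (e 0) (\<lambda>i. e (Suc i)))"
  shows "s1 (\<lambda>e. \<exists>v. P v e)"
proof -
  obtain Q where Q: "d0 S Q" "\<And>e. P (e 0) (\<lambda>i. e (Suc i)) \<longleftrightarrow> (\<exists>u. Q (u ## e))"
    using assms by (auto simp: s1_def)
  let ?R = "\<lambda>e. \<exists>v<e 0. \<exists>u<e 0. Q (u ## v ## (\<lambda>i. e (Suc i)))"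
  have "d0 S ?R"
    by (intro d0_ex_less d0_env[OF Q(1)] env_intros)
  moreover have "(\<exists>v. P v e) \<longleftrightarrow> (\<exists>w. ?R (w ## e))" for e
  proof -
    have "(\<exists>v. P v e) \<longleftrightarrow> (\<exists>v u. Q (u ## v ## e))" using Q(2)[of "_ ## e"] by simp
    also have "\<dots> \<longleftrightarrow> (\<exists>w. \<exists>v<w. \<exists>u<w. Q (u ## v ## e))"
    proof
      assume "\<exists>v u. Q (u ## v ## e)"
      then obtain u v where "Q (u ## v ## e)" by blast
      moreover have "u < max u v + 1" "v < max u v + 1" unfolding less_Suc by simp_all
      ultimately show "\<exists>w. \<exists>v<w. \<exists>u<w. Q (u ## v ## e)" by blast
    qed blast
    finally show ?thesis by simp
  qed
  ultimately show ?thesis unfolding s1_def by blast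
qed

lemma s1_conj:
  assumes "s1 P" "s1 Q"
  shows "s1 (\<lambda>e. P e \<and> Q e)"
proof -
  obtain P' Q' where d: "d0 S P'" "d0 S Q'"
    "\<And>e. P e \<longleftrightarrow> (\<exists>u. P' (u ## e))" "\<And>e. Q e \<longleftrightarrow> (\<exists>u. Q' (u ## e))"
    using assms by (auto simp: s1_def)
  have "s1 (\<lambda>e. \<exists>u v. P' (u ## e) \<and> Q' (v ## e))"
    by (intro s1_ex s1_d0 d0_conj d0_env[OF d(1)] d0_env[OF d(2)] env_intros)
  then show ?thesis by (simp add: d(3,4))
qed

lemma s1_disj:
  assumes "s1 P" "s1 Q"
  shows "s1 (\<lambda>e. P e \<or> Q e)"
proof -
  obtain P' Q' where d: "d0 S P'" "d0 S Q'"
    "\<And>e. P e \<longleftrightarrow> (\<exists>u. P' (u ## e))" "\<And>e. Q e \<longleftrightarrow> (\<exists>u. Q' (u ## e))"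
    using assms by (auto simp: s1_def)
  have "s1 (\<lambda>e. \<exists>u. P' (u ## e) \<or> Q' (u ## e))"
    by (intro s1_ex s1_d0 d0_disj d0_env[OF d(1)] d0_env[OF d(2)] env_intros)
  then show ?thesis by (simp add: d(3,4) ex_disj_distrib)
qed

text \<open>\<open>\<Sigma>\<^sup>0\<^sub>1\<close> bounding, which moves an unbounded existential
  quantifier out of a bounded universal one. The clause \<open>x < t\<close> in the induction
  statement lets the induction run over all \<open>y\<close>.\<close>

lemma collection:
  assumes Q: "d0 S Q" and ex: "\<And>x. x < t \<Longrightarrow> \<exists>u. Q (u ## x ## e)"
  shows "\<exists>b. \<forall>x<t. \<exists>u<b. Q (u ## x ## e)"
proof -
  let ?R = "\<lambda>e. \<forall>x<e (Suc 0). x < t \<longrightarrow> (\<exists>u<e 0. Q (u ## x ## (\<lambda>i. e (Suc (Suc i)))))"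
  have "\<exists>b. ?R (b ## y ## e)" for y
  proof (rule sigma_induct)
    show "d0 S ?R"
      by (intro d0_intros d0_env[OF Q] env_intros)
    show "\<exists>b. ?R (b ## (y + 1) ## e)" if "\<exists>b. ?R (b ## y ## e)" for y
    proof -
      from that obtain b where b: "\<forall>x<y. x < t \<longrightarrow> (\<exists>u<b. Q (u ## x ## e))" by auto
      obtain u where u: "y < t \<Longrightarrow> Q (u ## y ## e)" using ex by blast
      have "\<exists>v<max b (u + 1). Q (v ## x ## e)" if "x < y + 1" "x < t" for x
      proof (cases "x = y")
        case True
        then show ?thesis using u that by (intro exI[of _ u]) (auto simp: less_max_iff_disj less_Suc)
      next
        case False
        then have "x < y" using that by (simp add: less_Suc)
        then show ?thesis using b that by (meson less_max_iff_disj)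
      qed
      then show ?thesis by (intro exI[of _ "max b (u + 1)"]) simp
    qed
  qed (simp add: not_less_0)
  from this[of t] show ?thesis by simp
qed

lemma s1_all_less_trm:
  assumes "trm t" "s1 (\<lambda>e. P (e 0) (\<lambda>i. e (Suc i)))"
  shows "s1 (\<lambda>e. \<forall>x<t e. P x e)"
proof -
  obtain Q where Q: "d0 S Q" "\<And>e. P (e 0) (\<lambda>i. e (Suc i)) \<longleftrightarrow> (\<exists>u. Q (u ## e))"
    using assms(2) by (auto simp: s1_def)
  have "trm (\<lambda>e. t (\<lambda>i. e (Suc i)))"
    using trm_subst[OF assms(1), of "\<lambda>i e. e (Suc i)"] by (auto intro: trm.intros)
  then have "s1 (\<lambda>e. \<exists>b. \<forall>x<t e. \<exists>u<b. Q (u ## x ## e))"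
    by (intro s1_ex s1_d0 d0_all_less d0_ex_less d0_env[OF Q(1)] env_intros)
  moreover have "(\<forall>x<t e. P x e) \<longleftrightarrow> (\<exists>b. \<forall>x<t e. \<exists>u<b. Q (u ## x ## e))" for e
    using collection[OF Q(1), of "t e" e] Q(2)[of "_ ## e"] by auto
  ultimately show ?thesis by simp
qed

lemma fn_s1:
  assumes "fn f" "s1 (\<lambda>e. P (e 0) (\<lambda>i. e (Suc i)))"
  shows "s1 (\<lambda>e. P (f e) e)"
proof -
  have "s1 (\<lambda>e. \<exists>v. v = f e \<and> P v e)"
    using assms unfolding fn_def by (intro s1_ex s1_conj)
  then show ?thesis by simp
qed

lemma fn_shift:
  assumes "fn f"
  shows "fn (\<lambda>e. f (\<lambda>i. e (Suc i)))"
  unfolding fn_def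
  using s1_env[OF assms[unfolded fn_def], of "\<lambda>e. e 0 ## (\<lambda>i. e (Suc (Suc i)))"]
  by (simp add: env_intros)

lemma fn_trm: "trm f \<Longrightarrow> fn f"
  unfolding fn_def
  by (intro s1_d0 d0_intros trm_subst[where t = f and r = "\<lambda>i e. e (Suc i)"])

lemma fn_const: "fn (\<lambda>e. c)" and fn_var: "fn (\<lambda>e. e i)"
  by (intro fn_trm trm.intros)+

lemma fn_graph:
  assumes "fn f" "trm t" "\<And>i. trm (\<lambda>e. \<xi> e i)"
  shows "s1 (\<lambda>e. t e = f (\<xi> e))"
  using s1_env[OF assms(1)[unfolded fn_def], of "\<lambda>e. t e ## \<xi> e"] assms(2,3)
  by (simp add: trm_scons)

lemma s1_fn2:
  assumes "fn f" "fn g" "s1 (\<lambda>e. R (e 0) (e (Suc 0)))"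
  shows "s1 (\<lambda>e. R (f e) (g e))"
proof -
  have "s1 (\<lambda>e. R (e (Suc 0)) (e 0))"
    using s1_env[OF assms(3), of "\<lambda>e. e (Suc 0) ## e 0 ## e"] by (simp add: env_intros)
  then have "s1 (\<lambda>e. R (e 0) (g (\<lambda>i. e (Suc i))))"
    using fn_s1[OF fn_shift[OF assms(2)], of "\<lambda>v e. R (e 0) v"] by simp
  then show ?thesis by (rule fn_s1[OF assms(1)])
qed

lemma s1_fn1: "fn f \<Longrightarrow> s1 (\<lambda>e. R (e 0)) \<Longrightarrow> s1 (\<lambda>e. R (f e))"
  by (rule fn_s1[where P = "\<lambda>v e. R v"])

lemma fn_fn1:
  assumes "fn (\<lambda>e. h (e 0))" "fn f"
  shows "fn (\<lambda>e. h (f e))"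
proof -
  have "s1 (\<lambda>e. \<exists>u. u = f (\<lambda>i. e (Suc i)) \<and> e 0 = h u)"
    by (intro s1_ex s1_conj fn_graph[OF assms(2)] env_intros
        fn_graph[OF assms(1), where \<xi> = "\<lambda>e. e", simplified])
  then show ?thesis by (simp add: fn_def)
qed

lemma fn_fn2:
  assumes "fn (\<lambda>e. h (e 0) (e (Suc 0)))" "fn f" "fn g"
  shows "fn (\<lambda>e. h (f e) (g e))"
proof -
  have "s1 (\<lambda>e. \<exists>u v. u = f (\<lambda>i. e (Suc i)) \<and> v = g (\<lambda>i. e (Suc i)) \<and> e 0 = h u v)"
    by (intro s1_ex s1_conj fn_graph[OF assms(2)] fn_graph[OF assms(3)] env_intros
        fn_graph[OF assms(1), where \<xi> = "\<lambda>e. e (Suc 0) ## e 0 ## e", simplified])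
  then show ?thesis by (simp add: fn_def)
qed

lemma fn_graphI:
  assumes "\<And>v e. v = f e \<longleftrightarrow> R v e" "s1 (\<lambda>e. R (e 0) (\<lambda>i. e (Suc i)))"
  shows "fn f"
  unfolding fn_def using assms(2) by (simp add: assms(1))

lemma fn_add: "fn f \<Longrightarrow> fn g \<Longrightarrow> fn (\<lambda>e. f e + g e)"
  by (rule fn_fn2) (intro fn_trm trm.intros)

lemma fn_mult: "fn f \<Longrightarrow> fn g \<Longrightarrow> fn (\<lambda>e. f e * g e)"
  by (rule fn_fn2) (intro fn_trm trm.intros)

lemma delta_s1: "delta P \<Longrightarrow> s1 P"
  by (simp add: delta_def)

lemma delta_d0: "d0 S P \<Longrightarrow> delta P"
  by (simp add: delta_def s1_d0 d0_not)

lemma delta_not: "delta P \<Longrightarrow> delta (\<lambda>e. \<not> P e)"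
  by (simp add: delta_def)

lemma delta_conj: "delta P \<Longrightarrow> delta Q \<Longrightarrow> delta (\<lambda>e. P e \<and> Q e)"
  unfolding delta_def de_Morgan_conj by (elim conjE, intro conjI s1_conj s1_disj)

lemma delta_disj: "delta P \<Longrightarrow> delta Q \<Longrightarrow> delta (\<lambda>e. P e \<or> Q e)"
  unfolding delta_def de_Morgan_disj by (elim conjE, intro conjI s1_conj s1_disj)

lemma delta_imp: "delta P \<Longrightarrow> delta Q \<Longrightarrow> delta (\<lambda>e. P e \<longrightarrow> Q e)"
  unfolding imp_conv_disj by (rule delta_disj[OF delta_not])

lemma delta_iff: "delta P \<Longrightarrow> delta Q \<Longrightarrow> delta (\<lambda>e. P e \<longleftrightarrow> Q e)"
  unfolding iff_conv_conj_imp by (rule delta_conj; rule delta_imp)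

lemma delta_fn1: "delta (\<lambda>e. R (e 0)) \<Longrightarrow> fn f \<Longrightarrow> delta (\<lambda>e. R (f e))"
  unfolding delta_def using s1_fn1[of f R] s1_fn1[of f "\<lambda>x. \<not> R x"] by simp

lemma delta_fn2: "delta (\<lambda>e. R (e 0) (e (Suc 0))) \<Longrightarrow> fn f \<Longrightarrow> fn g \<Longrightarrow> delta (\<lambda>e. R (f e) (g e))"
  unfolding delta_def using s1_fn2[of f g R] s1_fn2[of f g "\<lambda>x y. \<not> R x y"] by simp

lemma delta_eq: "fn f \<Longrightarrow> fn g \<Longrightarrow> delta (\<lambda>e. f e = g e)"
  by (rule delta_fn2) (intro delta_d0 d0_intros)

lemma delta_less: "fn f \<Longrightarrow> fn g \<Longrightarrow> delta (\<lambda>e. f e < g e)"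
  by (rule delta_fn2) (intro delta_d0 d0_intros)

lemma delta_le: "fn f \<Longrightarrow> fn g \<Longrightarrow> delta (\<lambda>e. f e \<le> g e)"
  using delta_not[OF delta_less, of g f] by (simp add: not_less)

lemma delta_mem: "A \<in> S \<Longrightarrow> fn f \<Longrightarrow> delta (\<lambda>e. f e \<in> A)"
  by (rule delta_fn1) (intro delta_d0 d0_intros)

lemma s1_all_less:
  assumes "fn f" "s1 (\<lambda>e. P (e 0) (\<lambda>i. e (Suc i)))"
  shows "s1 (\<lambda>e. \<forall>x<f e. P x e)"
proof -
  have "s1 (\<lambda>e. P (e 0) (\<lambda>i. e (Suc (Suc i))))"
    using s1_env[OF assms(2), of "\<lambda>e. e 0 ## (\<lambda>i. e (Suc (Suc i)))"] by (simp add: env_intros)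
  then have "s1 (\<lambda>e. \<forall>x<e 0. P x (\<lambda>i. e (Suc i)))"
    by (intro s1_all_less_trm trm.intros)
  then show ?thesis by (rule fn_s1[OF assms(1)])
qed

lemma s1_ex_less:
  assumes "fn f" "s1 (\<lambda>e. P (e 0) (\<lambda>i. e (Suc i)))"
  shows "s1 (\<lambda>e. \<exists>x<f e. P x e)"
  by (intro s1_ex s1_conj delta_s1[OF delta_less] fn_var fn_shift assms)

lemma delta_all_less: "fn f \<Longrightarrow> delta (\<lambda>e. P (e 0) (\<lambda>i. e (Suc i))) \<Longrightarrow> delta (\<lambda>e. \<forall>x<f e. P x e)"
  unfolding delta_def using s1_ex_less[of f "\<lambda>x e. \<not> P x e"] s1_all_less[of f P] by simp

lemma delta_ex_less: "fn f \<Longrightarrow> delta (\<lambda>e. P (e 0) (\<lambda>i. e (Suc i))) \<Longrightarrow> delta (\<lambda>e. \<exists>x<f e. P x e)"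
  unfolding delta_def using s1_all_less[of f "\<lambda>x e. \<not> P x e"] s1_ex_less[of f P] by simp

lemma delta_all_le: "fn f \<Longrightarrow> delta (\<lambda>e. P (e 0) (\<lambda>i. e (Suc i))) \<Longrightarrow> delta (\<lambda>e. \<forall>x\<le>f e. P x e)"
  using delta_all_less[of "\<lambda>e. f e + 1" P] by (simp add: fn_add fn_const less_Suc)

lemma delta_ex_le: "fn f \<Longrightarrow> delta (\<lambda>e. P (e 0) (\<lambda>i. e (Suc i))) \<Longrightarrow> delta (\<lambda>e. \<exists>x\<le>f e. P x e)"
  using delta_ex_less[of "\<lambda>e. f e + 1" P] by (simp add: fn_add fn_const less_Suc)

lemma fn_if:
  assumes "delta P" "fn f" "fn g"
  shows "fn (\<lambda>e. if P e then f e else g e)"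
proof (rule fn_graphI)
  show "v = (if P e then f e else g e) \<longleftrightarrow> P e \<and> v = f e \<or> \<not> P e \<and> v = g e" for v e by auto
  have "s1 (\<lambda>e. P (\<lambda>i. e (Suc i)))" "s1 (\<lambda>e. \<not> P (\<lambda>i. e (Suc i)))"
    using s1_env[of P "\<lambda>e i. e (Suc i)"] s1_env[of "\<lambda>e. \<not> P e" "\<lambda>e i. e (Suc i)"] assms(1)
    by (auto simp: delta_def trm.intros)
  then show "s1 (\<lambda>e. P (\<lambda>i. e (Suc i)) \<and> e 0 = f (\<lambda>i. e (Suc i)) \<or>
      \<not> P (\<lambda>i. e (Suc i)) \<and> e 0 = g (\<lambda>i. e (Suc i)))"
    using assms(2,3) by (intro s1_disj s1_conj) (auto simp: fn_def)
qed

lemmas rec_intros = fn_const fn_var fn_add fn_mult fn_if delta_not delta_eq delta_less delta_le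
  delta_mem delta_all_less delta_ex_less delta_all_le delta_ex_le delta_conj delta_disj delta_imp
  delta_iff

lemmas s1_intros = s1_ex s1_all_less s1_ex_less s1_conj s1_disj

lemma compr: "delta (\<lambda>e. P (e 0)) \<Longrightarrow> {x. P x} \<in> S"
proof -
  assume "delta (\<lambda>e. P (e 0))"
  then obtain Q R where QR: "d0 S Q" "d0 S R" "\<And>e. P (e 0) \<longleftrightarrow> (\<exists>u. Q (u ## e))"
    "\<And>e. \<not> P (e 0) \<longleftrightarrow> (\<exists>u. R (u ## e))"
    by (auto simp: delta_def s1_def)
  have Q: "P x \<longleftrightarrow> (\<exists>u. Q (u ## x ## (\<lambda>_. 0)))" for x using QR(3)[of "x ## (\<lambda>_. 0)"] by simp
  have R: "\<not> P x \<longleftrightarrow> (\<exists>u. R (u ## x ## (\<lambda>_. 0)))" for x using QR(4)[of "x ## (\<lambda>_. 0)"] by simp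
  have "{x. \<exists>u. Q (u ## x ## (\<lambda>_. 0))} \<in> S"
    using Q R by (intro delta_compr[OF QR(1) d0_not[OF QR(2)]]) metis
  then show ?thesis using Q by simp
qed

subsection \<open>Induction and least elements\<close>

lemma s1_induct:
  assumes "s1 (\<lambda>e. P (e 0))" "P 0" "\<And>x. P x \<Longrightarrow> P (x + 1)"
  shows "P x"
proof -
  obtain Q where Q: "d0 S Q" "\<And>e. P (e 0) \<longleftrightarrow> (\<exists>u. Q (u ## e))"
    using assms(1) by (auto simp: s1_def)
  have *: "P x \<longleftrightarrow> (\<exists>u. Q (u ## x ## (\<lambda>_. 0)))" for x using Q(2)[of "x ## (\<lambda>_. 0)"] by simp
  show ?thesis unfolding * by (rule sigma_induct[OF Q(1)]) (use assms(2,3) * in auto)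
qed

lemma pi_least:
  assumes "s1 (\<lambda>e. \<not> P (e 0))" "P x"
  obtains m where "P m" "\<And>y. y < m \<Longrightarrow> \<not> P y"
proof -
  have "\<exists>m. P m \<and> (\<forall>y<m. \<not> P y)"
  proof (rule ccontr)
    assume no: "\<not> ?thesis"
    have "\<forall>y<z. \<not> P y" for z
    proof (rule s1_induct[where x = z])
      show "s1 (\<lambda>e. \<forall>y<e 0. \<not> P y)" by (intro s1_intros fn_var assms(1))
      show "\<forall>y<z + 1. \<not> P y" if "\<forall>y<z. \<not> P y" for z
        using that no by (metis less_Suc order_le_less)
    qed simp
    from this[of "x + 1"] show False using assms(2) by (auto simp: less_Suc)
  qed
  then show thesis using that by blast
qed

lemma s1_least:
  assumes "s1 (\<lambda>e. P (e 0))" "P x"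
  obtains m where "P m" "\<And>y. y < m \<Longrightarrow> \<not> P y"
proof -
  have "\<exists>m. P m \<and> (\<forall>y<m. \<not> P y)"
  proof (rule ccontr)
    assume no: "\<not> ?thesis"
    text \<open>Descending induction: \<open>P\<close> has an element below \<open>x + 1 - w\<close> for all \<open>w \<le> x + 1\<close>.\<close>
    have "\<exists>z y. (z + w = x + 1 \<or> x + 1 < w) \<and> (y < z \<or> x + 1 < w) \<and> P y" for w
    proof (rule s1_induct[where x = w])
      show "s1 (\<lambda>e. \<exists>z y. (z + e 0 = x + 1 \<or> x + 1 < e 0) \<and> (y < z \<or> x + 1 < e 0) \<and> P y)"
        by (intro s1_intros delta_s1[OF delta_eq] delta_s1[OF delta_less] rec_intros)
          (rule s1_fn1[OF fn_var assms(1)])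
      show "\<exists>z y. (z + 0 = x + 1 \<or> x + 1 < 0) \<and> (y < z \<or> x + 1 < 0) \<and> P y"
        using assms(2) by (intro exI[of _ "x + 1"] exI[of _ x]) (auto simp: less_Suc)
      show "\<exists>z y. (z + (w + 1) = x + 1 \<or> x + 1 < w + 1) \<and> (y < z \<or> x + 1 < w + 1) \<and> P y"
        if IH: "\<exists>z y. (z + w = x + 1 \<or> x + 1 < w) \<and> (y < z \<or> x + 1 < w) \<and> P y" for w
      proof (cases "x + 1 < w + 1")
        case True
        then show ?thesis using assms(2) by blast
      next
        case False
        then obtain z y where zy: "z + w = x + 1" "y < z" "P y"
          using IH by (metis less_Suc order_less_imp_le)
        obtain z' where z: "z = z' + 1" using zy(2) not_less_0 by (cases z rule: succ_cases) auto
        obtain y' where "y' < y" "P y'" using no zy(3) by blast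
        then have "y' < z'" using zy(2) z by (simp add: less_Suc)
        then show ?thesis using \<open>P y'\<close> zy(1) z by (metis add.assoc add.commute)
      qed
    qed
    from this[of "x + 1"] obtain z y where "z + (x + 1) = x + 1" "y < z" by auto
    then show False using not_less_0 by simp
  qed
  then show thesis using that by blast
qed

lemma delta_induct:
  "delta (\<lambda>e. P (e 0)) \<Longrightarrow> P 0 \<Longrightarrow> (\<And>x. P x \<Longrightarrow> P (x + 1)) \<Longrightarrow> P x"
  by (rule s1_induct) (auto simp: delta_def)

text \<open>Being an upper bound is a \<open>\<Pi>\<^sup>0\<^sub>1\<close> property, so there is a
  least upper bound; it satisfies \<open>P\<close>, for otherwise its predecessor would be a bound
  as well.\<close>

lemma s1_greatest:
  assumes P: "s1 (\<lambda>e. P (e 0))" and "P x" and bound: "\<And>y. P y \<Longrightarrow> y \<le> b"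
  obtains m where "P m" "\<And>y. P y \<Longrightarrow> y \<le> m"
proof -
  have "s1 (\<lambda>e. \<exists>y. P y \<and> e 0 < y)"
    by (intro s1_intros s1_fn1[OF fn_var P] delta_s1[OF delta_less] rec_intros)
  then obtain m where m: "\<not> (\<exists>y. P y \<and> m < y)" "\<And>z. z < m \<Longrightarrow> \<exists>y. P y \<and> z < y"
    using pi_least[of "\<lambda>b. \<not> (\<exists>y. P y \<and> b < y)" b] bound by (metis not_less)
  have "P m"
  proof (cases m rule: succ_cases)
    case 1
    then show ?thesis using m(1) assms(2) by (metis not_less_iff_gr_or_eq not_less_0)
  next
    case (2 z)
    then obtain y where "P y" "z < y" using m(2)[of z] by (auto simp: less_Suc)
    then show ?thesis using m(1) 2 by (metis less_Suc not_less_iff_gr_or_eq order_less_le)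
  qed
  then show thesis using that m(1) by (meson not_less)
qed

subsection \<open>Finite sets coded by divisibility\<close>

text \<open>Goedel's moduli, used with divisibility instead of remainders: a product of moduli codes
  the set of its indices, so adding an element is one multiplication.\<close>

definition code_mem :: "'a \<Rightarrow> 'a \<Rightarrow> 'a \<Rightarrow> bool" where
  "code_mem m n j \<longleftrightarrow> m * (j + 1) + 1 dvd n"

lemma le_mult_pos: "0 < d \<Longrightarrow> q \<le> d * (q::'a)"
  using mult_right_mono[of 1 d q] by (simp add: less_iff_succ_less_eq)

lemma code_mem_bounded: "code_mem m n j \<longleftrightarrow> (\<exists>q\<le>n. n = (m * (j + 1) + 1) * q)"
proof
  assume "code_mem m n j"
  then obtain q where q: "n = (m * (j + 1) + 1) * q" by (auto simp: code_mem_def dvd_def)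
  have "0 < m * (j + 1) + 1" by (simp add: pos_iff succ_nz)
  then have "q \<le> n" unfolding q by (rule le_mult_pos)
  with q show "\<exists>q\<le>n. n = (m * (j + 1) + 1) * q" by blast
qed (auto simp: code_mem_def dvd_def)

lemma delta_code_mem:
  "fn f \<Longrightarrow> fn g \<Longrightarrow> fn h \<Longrightarrow> delta (\<lambda>e. code_mem (f e) (g e) (h e))"
  unfolding code_mem_bounded by (intro rec_intros fn_shift)

text \<open>Plays the part of a factorial: primitive recursion is obtained only later, by means of
  these codes.\<close>

lemma common_multiple: "\<exists>m. 0 < m \<and> (\<forall>i<b. i + 1 dvd (m::'a))"
proof (rule s1_induct[where x = b])
  show "s1 (\<lambda>e. \<exists>m. 0 < m \<and> (\<forall>i<e 0. i + 1 dvd m))"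
  proof -
    have "(i + 1 dvd m) = (\<exists>q\<le>m. m = (i + 1) * q)" for i m :: 'a
      using le_mult_pos[of "i + 1"] by (auto simp: dvd_def pos_iff succ_nz)
    then show ?thesis
      by (simp only:) (intro s1_intros delta_s1[OF delta_less] delta_s1[OF delta_ex_le] rec_intros)
  qed
  show "\<exists>m. 0 < m \<and> (\<forall>i<0. i + 1 dvd (m::'a))" by (intro exI[of _ 1]) simp
  show "\<exists>m. 0 < m \<and> (\<forall>i<b + 1. i + 1 dvd (m::'a))"
    if "\<exists>m. 0 < m \<and> (\<forall>i<b. i + 1 dvd m)" for b
  proof -
    from that obtain m where m: "0 < m" "\<forall>i<b. i + 1 dvd m" by blast
    have "i + 1 dvd m * (b + 1)" if "i < b + 1" for i
      using that m(2) unfolding less_Suc order_le_less by auto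
    moreover have "0 < m * (b + 1)" using m(1) by (simp add: pos_iff succ_nz)
    ultimately show ?thesis by blast
  qed
qed

text \<open>
  The moduli \<open>m (i + 1) + 1\<close> are pairwise coprime in the following sense, because
  \<open>(j + 1) (m (i + 1) + 1)\<close> and \<open>(i + 1) (m (j + 1) + 1)\<close> differ by \<open>i - j\<close>, which divides \<open>m\<close>.
\<close>

lemma moduli_coprime:
  assumes m: "\<And>i. i < b \<Longrightarrow> i + 1 dvd m" and ij: "i < b" "j < b" "i \<noteq> j"
    and dvd: "m * (i + 1) + 1 dvd n * (m * (j + 1) + 1)"
  shows "m * (i + 1) + 1 dvd (n::'a)"
proof -
  let ?a = "m * (i + 1) + 1" and ?b = "m * (j + 1) + 1"
  have "\<exists>k. k dvd m \<and> ?a dvd n * k"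
  proof (cases "i < j")
    case True
    then obtain k where k: "j = i + k + 1" using less_ex by blast
    have "k < j" unfolding k less_Suc by simp
    then have "k < b" using ij(2) by simp
    then have "k + 1 dvd m" by (rule m)
    moreover have "n * (j + 1) * ?a = n * ?b * (i + 1) + n * (k + 1)"
      unfolding k by (simp add: algebra_simps)
    then have "?a dvd n * (k + 1)"
      using dvd_add_right_iff[of ?a "n * ?b * (i + 1)" "n * (k + 1)"] dvd_mult2[OF dvd, of "i + 1"]
        dvd_triv_right[of ?a "n * (j + 1)"] by simp
    ultimately show ?thesis by blast
  next
    case False
    then obtain k where k: "i = j + k + 1" using less_ex ij(3) by (metis linorder_neqE)
    have "k < i" unfolding k less_Suc by simp
    then have "k < b" using ij(1) by simp
    then have "k + 1 dvd m" by (rule m)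
    moreover have "n * ?b * (i + 1) = n * (j + 1) * ?a + n * (k + 1)"
      unfolding k by (simp add: algebra_simps)
    then have "?a dvd n * (k + 1)"
      using dvd_add_right_iff[of ?a "n * (j + 1) * ?a" "n * (k + 1)"]
        dvd_mult2[OF dvd, of "i + 1"] by simp
    ultimately show ?thesis by blast
  qed
  then have "?a dvd n * m" by (meson dvd_refl dvd_trans mult_dvd_mono)
  then have "?a dvd n * m * (i + 1)" by (rule dvd_mult2)
  \<comment> \<open>As \<open>?a\<close> is one more than a multiple of \<open>m\<close>,
    divisibility passes from \<open>n * m\<close> to \<open>n\<close>.\<close>
  moreover have "n * ?a = n * m * (i + 1) + n" by (simp add: algebra_simps)
  ultimately show ?thesis
    using dvd_add_right_iff[of ?a "n * m * (i + 1)" n] dvd_triv_right[of ?a n] by simp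
qed

text \<open>The indices are decided one after the other, starting from the code \<open>1\<close>,
  which no modulus divides. Accepting \<open>y\<close> multiplies the code by its modulus, and by
  \<open>moduli_coprime\<close> this affects no other index below \<open>b\<close>.\<close>

lemma code_exists:
  assumes X: "delta (\<lambda>e. X (e 0))"
  shows "\<exists>m n. \<forall>j<b. code_mem m n j \<longleftrightarrow> X j"
proof -
  obtain m where m: "0 < m" "\<And>i. i < b \<Longrightarrow> i + 1 dvd m" using common_multiple by blast
  have "\<exists>n. \<forall>i<b. code_mem m n i \<longleftrightarrow> i < y \<and> X i" for y
  proof (rule s1_induct[where x = y])
    show "s1 (\<lambda>e. \<exists>n. \<forall>i<b. code_mem m n i \<longleftrightarrow> i < e 0 \<and> X i)"
      by (intro s1_ex delta_s1 rec_intros delta_code_mem delta_fn1[OF X])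
    show "\<exists>n. \<forall>i<b. code_mem m n i \<longleftrightarrow> i < 0 \<and> X i"
    proof (intro exI[of _ 1] allI impI)
      fix i
      have "0 < m * (i + 1)" using m(1) by (simp add: pos_iff succ_nz)
      then have "1 < m * (i + 1) + 1" by (metis add_0l less_add_same_cancel2)
      moreover have "m * (i + 1) + 1 \<le> (m * (i + 1) + 1) * q" if "1 = (m * (i + 1) + 1) * q" for q
      proof -
        have "0 < q" using that by (auto simp: pos_iff)
        then show ?thesis using le_mult_pos[of q "m * (i + 1) + 1"] by (simp add: mult.commute)
      qed
      ultimately have "\<not> m * (i + 1) + 1 dvd 1"
        unfolding dvd_def by (metis not_less)
      then show "code_mem m 1 i \<longleftrightarrow> i < 0 \<and> X i" by (simp add: code_mem_def)
    qed
    show "\<exists>n. \<forall>i<b. code_mem m n i \<longleftrightarrow> i < y + 1 \<and> X i"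
      if "\<exists>n. \<forall>i<b. code_mem m n i \<longleftrightarrow> i < y \<and> X i" for y
    proof -
      from that obtain n where n: "\<And>i. i < b \<Longrightarrow> code_mem m n i \<longleftrightarrow> i < y \<and> X i" by blast
      show ?thesis
      proof (cases "X y \<and> y < b")
        case True
        have "code_mem m (n * (m * (y + 1) + 1)) i \<longleftrightarrow> i < y + 1 \<and> X i" if "i < b" for i
        proof (cases "i = y")
          case False
          have "code_mem m (n * (m * (y + 1) + 1)) i \<longleftrightarrow> code_mem m n i"
            using moduli_coprime[of b m i y n] m(2) that True False
            by (auto simp: code_mem_def)
          then show ?thesis using n[OF that] False by (auto simp: less_Suc)
        qed (use True in \<open>simp add: code_mem_def less_Suc\<close>)
        then show ?thesis by blast
      next
        case False
        then show ?thesis using n by (intro exI[of _ n]) (auto simp: less_Suc order_le_less)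
      qed
    qed
  qed
  from this[of b] show ?thesis by auto
qed

subsection \<open>Primitive recursion\<close>

definition pr :: "'a \<Rightarrow> 'a \<Rightarrow> 'a" where
  "pr x y = (x + y) * (x + y) + x"

lemma fn_pr: "fn f \<Longrightarrow> fn g \<Longrightarrow> fn (\<lambda>e. pr (f e) (g e))"
  unfolding pr_def by (intro rec_intros)

text \<open>With s = x + y, the value of \<open>pr\<close> is at least the square of s and less than
  the square of s + 1.\<close>

lemma pr_less: "x + y < x' + y' \<Longrightarrow> pr x y < pr x' y'"
proof -
  assume "x + y < x' + y'"
  then have le: "x + y + 1 \<le> x' + y'" by (simp add: less_iff_succ_less_eq)
  have "(x + y + 1) * (x + y + 1) = (x + y) * (x + y) + x + (x + y + y) + 1"
    by (simp add: algebra_simps)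
  then have "(x + y) * (x + y) + x < (x + y + 1) * (x + y + 1)"
    using less_Suc[of "(x + y) * (x + y) + x" "(x + y) * (x + y) + x + (x + y + y)"] by simp
  also have "\<dots> \<le> (x' + y') * (x' + y')" using le by (intro mult_mono) auto
  also have "\<dots> \<le> pr x' y'" by (simp add: pr_def)
  finally show ?thesis by (simp add: pr_def)
qed

lemma pr_inj [simp]: "pr x y = pr x' y' \<longleftrightarrow> x = x' \<and> y = y'"
proof
  assume eq: "pr x y = pr x' y'"
  then have "x + y = x' + y'" using pr_less[of x y x' y'] pr_less[of x' y' x y] by (metis linorder_neqE order_less_irrefl)
  with eq show "x = x' \<and> y = y'" by (auto simp: pr_def)
qed auto

lemma pr_bounds: "x \<le> pr x y" "y \<le> pr x y"
proof -
  have "x + y \<le> (x + y) * (x + y) + x"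
  proof (cases "x + y = 0")
    case False
    then have "x + y \<le> (x + y) * (x + y)" by (intro le_mult_pos) (simp add: pos_iff)
    then show ?thesis by (metis add_increasing2 nonneg)
  qed simp
  then show "y \<le> pr x y" unfolding pr_def by (metis add_increasing nonneg order_refl order_trans)
  show "x \<le> pr x y" by (simp add: pr_def)
qed

context
  fixes a :: 'a and G :: "'a \<Rightarrow> 'a \<Rightarrow> 'a"
  assumes G: "fn (\<lambda>e. G (e 0) (e (Suc 0)))"
begin

text \<open>\<open>code_exists\<close> controls a code only below a given bound, so pairs from
  \<open>b\<close> on are disregarded.\<close>

definition entry :: "'a \<Rightarrow> 'a \<Rightarrow> 'a \<Rightarrow> 'a \<Rightarrow> 'a \<Rightarrow> bool" where
  "entry b m n i v \<longleftrightarrow> pr i v < b \<and> code_mem m n (pr i v)"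

text \<open>A code may contain stray pairs, so single-valuedness up to \<open>x\<close> is made part
  of the notion; it is what makes any two computations agree.\<close>

definition computation :: "'a \<Rightarrow> 'a \<Rightarrow> 'a \<Rightarrow> 'a \<Rightarrow> bool" where
  "computation b m n x \<longleftrightarrow> entry b m n 0 a \<and>
    (\<forall>i<x. \<exists>v<b. entry b m n i v \<and> entry b m n (i + 1) (G i v)) \<and>
    (\<forall>i\<le>x. \<forall>v<b. \<forall>w<b. entry b m n i v \<and> entry b m n i w \<longrightarrow> v = w)"

definition result :: "'a \<Rightarrow> 'a \<Rightarrow> bool" where
  "result x v \<longleftrightarrow> (\<exists>b m n. computation b m n x \<and> entry b m n x v)"

lemma delta_entry: "fn b \<Longrightarrow> fn m \<Longrightarrow> fn n \<Longrightarrow> fn i \<Longrightarrow> fn v \<Longrightarrow>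
    delta (\<lambda>e. entry (b e) (m e) (n e) (i e) (v e))"
  unfolding entry_def by (intro rec_intros delta_code_mem fn_pr)

lemma s1_result: "s1 (\<lambda>e. result (e i) (e j))"
  unfolding result_def computation_def
  by (intro s1_ex delta_s1 rec_intros delta_entry fn_fn2[OF G])

lemma entry_less: "entry b m n i v \<Longrightarrow> v < b"
  using pr_bounds(2)[of v i] by (auto simp: entry_def)

lemma computation_unique:
  "computation b m n x \<Longrightarrow> i \<le> x \<Longrightarrow> entry b m n i v \<Longrightarrow> entry b m n i w \<Longrightarrow> v = w"
  using entry_less unfolding computation_def by metis

lemma result_unique:
  assumes "result x v" "result x v'"
  shows "v = v'"
proof -
  obtain b m n b' m' n' where c: "computation b m n x" "entry b m n x v"
    "computation b' m' n' x" "entry b' m' n' x v'"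
    using assms by (auto simp: result_def)
  have "i \<le> x \<longrightarrow> (\<forall>u<b. \<forall>u'<b'. entry b m n i u \<and> entry b' m' n' i u' \<longrightarrow> u = u')" for i
  proof (rule delta_induct[where x = i])
    show "delta (\<lambda>e. e 0 \<le> x \<longrightarrow> (\<forall>u<b. \<forall>u'<b'. entry b m n (e 0) u \<and> entry b' m' n' (e 0) u' \<longrightarrow> u = u'))"
      by (intro rec_intros delta_entry)
    have "entry b m n 0 a" "entry b' m' n' 0 a" using c by (auto simp: computation_def)
    then show "0 \<le> x \<longrightarrow> (\<forall>u<b. \<forall>u'<b'. entry b m n 0 u \<and> entry b' m' n' 0 u' \<longrightarrow> u = u')"
      using computation_unique[OF c(1)] computation_unique[OF c(3)] by metis
    show "i + 1 \<le> x \<longrightarrow> (\<forall>u<b. \<forall>u'<b'. entry b m n (i + 1) u \<and> entry b' m' n' (i + 1) u' \<longrightarrow> u = u')"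
      if IH: "i \<le> x \<longrightarrow> (\<forall>u<b. \<forall>u'<b'. entry b m n i u \<and> entry b' m' n' i u' \<longrightarrow> u = u')" for i
    proof (intro impI allI)
      fix u u' assume i: "i + 1 \<le> x" and u: "entry b m n (i + 1) u \<and> entry b' m' n' (i + 1) u'"
      have "i < x" using i by (simp add: less_iff_succ_less_eq)
      then obtain w w' where w: "entry b m n i w" "entry b m n (i + 1) (G i w)"
        "entry b' m' n' i w'" "entry b' m' n' (i + 1) (G i w')"
        using c(1,3) unfolding computation_def by blast
      then have "w = w'" using IH entry_less \<open>i < x\<close> by (metis order_less_imp_le)
      then show "u = u'"
        using computation_unique[OF c(1) i] computation_unique[OF c(3) i] u w by metis
    qed
  qed
  then show ?thesis using c(2,4) entry_less by blast
qed

lemma result_0: "result 0 a"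
proof -
  have "delta (\<lambda>e. e 0 = pr 0 a)" by (intro rec_intros)
  then obtain m n where mn: "\<And>j. j < pr 0 a + 1 \<Longrightarrow> code_mem m n j \<longleftrightarrow> j = pr 0 a"
    using code_exists[of "\<lambda>j. j = pr 0 a" "pr 0 a + 1"] by metis
  have "entry (pr 0 a + 1) m n i v \<longleftrightarrow> i = 0 \<and> v = a" for i v
    unfolding entry_def using mn[of "pr i v"] mn[of "pr 0 a"] by (auto simp: less_Suc)
  then have "computation (pr 0 a + 1) m n 0" "entry (pr 0 a + 1) m n 0 a"
    by (auto simp: computation_def)
  then show ?thesis unfolding result_def by metis
qed

lemma result_succ:
  assumes "result x v"
  shows "result (x + 1) (G x v)"
proof -
  obtain b m n where c: "computation b m n x" "entry b m n x v"
    using assms by (auto simp: result_def)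
  \<comment> \<open>Old entries at indices above \<open>x\<close> are dropped, since one at
    \<open>x + 1\<close> might disagree with the new value.\<close>
  define X where "X j \<longleftrightarrow> (\<exists>i\<le>x. \<exists>u<b. j = pr i u \<and> entry b m n i u) \<or> j = pr (x + 1) (G x v)" for j
  define b' where "b' = max b (pr (x + 1) (G x v) + 1)"
  have "delta (\<lambda>e. X (e 0))"
    unfolding X_def by (intro rec_intros delta_entry fn_pr)
  then obtain m' n' where mn: "\<And>j. j < b' \<Longrightarrow> code_mem m' n' j \<longleftrightarrow> X j"
    using code_exists[of X b'] by metis
  have entry': "entry b' m' n' i u \<longleftrightarrow> i \<le> x \<and> entry b m n i u \<or> i = x + 1 \<and> u = G x v" for i u
  proof -
    have X: "X (pr i u) \<longleftrightarrow> i \<le> x \<and> entry b m n i u \<or> i = x + 1 \<and> u = G x v"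
      unfolding X_def using entry_less by auto
    have "X (pr i u) \<Longrightarrow> pr i u < b'"
      unfolding X by (auto simp: entry_def b'_def less_max_iff_disj less_Suc)
    then show ?thesis using mn[of "pr i u"] X by (auto simp: entry_def[of b'])
  qed
  have le: "b \<le> b'" by (simp add: b'_def)
  have "\<exists>u<b'. entry b' m' n' i u \<and> entry b' m' n' (i + 1) (G i u)" if "i < x + 1" for i
  proof (cases "i = x")
    case True
    have "entry b' m' n' x v" "entry b' m' n' (x + 1) (G x v)" using c(2) by (auto simp: entry')
    then show ?thesis unfolding True using c(2) le by (meson entry_less less_le_trans)
  next
    case False
    then have i: "i < x" "i + 1 \<le> x" using that by (auto simp: less_Suc less_iff_succ_less_eq[symmetric])
    then obtain u where "u < b" "entry b m n i u" "entry b m n (i + 1) (G i u)"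
      using c(1) unfolding computation_def by blast
    then show ?thesis using i le by (intro exI[of _ u]) (auto simp: entry')
  qed
  moreover have "entry b' m' n' 0 a" using c(1) by (auto simp: entry' computation_def)
  moreover have "u = w" if "i \<le> x + 1" "entry b' m' n' i u" "entry b' m' n' i w" for i u w
    using that computation_unique[OF c(1)] unfolding entry'
    by (metis less_iff_succ_less_eq less_irrefl)
  ultimately have "computation b' m' n' (x + 1)" unfolding computation_def by blast
  moreover have "entry b' m' n' (x + 1) (G x v)" by (simp add: entry')
  ultimately show ?thesis unfolding result_def by blast
qed

lemma prim_rec:
  obtains F where "F 0 = a" "\<And>x. F (x + 1) = G x (F x)" "fn (\<lambda>e. F (e 0))"
proof -
  have ex: "\<exists>v. result x v" for x
  proof (rule s1_induct[where x = x])
    show "s1 (\<lambda>e. \<exists>v. result (e 0) v)"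
      using s1_ex[of "\<lambda>v e. result (e 0) v"] s1_result[of "Suc 0" 0] by simp
  qed (use result_0 result_succ in blast)+
  define F where "F x = (THE v. result x v)" for x
  have F: "v = F x \<longleftrightarrow> result x v" for x v
    unfolding F_def using ex result_unique by (metis theI)
  have "fn (\<lambda>e. F (e 0))"
    by (rule fn_graphI[where R = "\<lambda>v e. result (e 0) v"]) (use F s1_result in auto)
  moreover have "F 0 = a" using F result_0 by metis
  moreover have "F (x + 1) = G x (F x)" for x using F result_succ by metis
  ultimately show thesis using that by blast
qed

end

lemma delta_env: "delta P \<Longrightarrow> (\<And>i. trm (\<lambda>e. \<xi> e i)) \<Longrightarrow> delta (\<lambda>e. P (\<xi> e))"
  unfolding delta_def using s1_env[of P \<xi>] s1_env[of "\<lambda>e. \<not> P e" \<xi>] by simp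

text \<open>Unbounded search: minimality adds only a bounded quantifier, so the graph of the least
  witness is still \<open>delta\<close>.\<close>

lemma least_fn2:
  assumes R: "delta (\<lambda>e. R (e 0) (e (Suc 0)) (e (Suc (Suc 0))))" and ex: "\<And>x y. \<exists>v. R v x y"
  obtains h where "fn (\<lambda>e. h (e 0) (e (Suc 0)))" "\<And>x y. R (h x y) x y"
proof -
  have R3: "delta (\<lambda>e. R (e i) (e j) (e k))" for i j k
    using delta_env[OF R, of "\<lambda>e. e i ## e j ## e k ## e"] by (simp add: env_intros)
  have Rc: "s1 (\<lambda>e. R (e 0) x y)" for x y
    using delta_s1[OF delta_env[OF R, of "\<lambda>e. e 0 ## x ## y ## e"]] by (simp add: env_intros)
  define least where "least v x y \<longleftrightarrow> R v x y \<and> (\<forall>w<v. \<not> R w x y)" for v x y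
  have "\<exists>v. least v x y" for x y
    using ex[of x y] s1_least[OF Rc] unfolding least_def by metis
  moreover have "v = w" if "least v x y" "least w x y" for v w x y
    using that unfolding least_def by (metis linorder_neqE)
  ultimately obtain h where h: "\<And>v x y. v = h x y \<longleftrightarrow> least v x y" by metis
  have "fn (\<lambda>e. h (e 0) (e (Suc 0)))"
    by (rule fn_graphI[where R = "\<lambda>v e. least v (e 0) (e (Suc 0))"], rule h, unfold least_def)
      (intro delta_s1 rec_intros R3)
  moreover have "R (h x y) x y" for x y using h[of "h x y" x y] by (simp add: least_def)
  ultimately show thesis using that by blast
qed

lemma least_fn1:
  assumes R: "delta (\<lambda>e. R (e 0) (e (Suc 0)))" and ex: "\<And>x. \<exists>v. R v x"
  obtains h where "fn (\<lambda>e. h (e 0))" "\<And>x. R (h x) x"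
proof -
  obtain h where h: "fn (\<lambda>e. h (e 0) (e (Suc 0)))" "\<And>x y. R (h x y) x"
    using least_fn2[of "\<lambda>v x y. R v x"] assms by metis
  have "fn (\<lambda>e. h (e 0) 0)" by (rule fn_fn2[OF h(1) fn_var fn_const])
  then show thesis using that[of "\<lambda>x. h x 0"] h(2) by blast
qed

section \<open>Digits\<close>

lemma leading_less:
  assumes "c < c'" "d < w"
  shows "c * w + d < c' * w + (d'::'a)"
proof -
  have "c * w + d < c * w + w" using assms(2) by simp
  also have "\<dots> = (c + 1) * w" by (simp add: distrib_right)
  also have "\<dots> \<le> c' * w" using assms(1) by (intro mult_right_mono) (auto simp: less_iff_succ_less_eq)
  also have "\<dots> \<le> c' * w + d'" by simp
  finally show ?thesis .
qed

lemma division_unique: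
  assumes "a * w + b = a' * w + b'" "b < w" "b' < (w::'a)"
  shows "a = a' \<and> b = b'"
proof -
  have "a = a'" using leading_less[of a a' b w b'] leading_less[of a' a b' w b] assms by (metis linorder_neqE order_less_irrefl)
  then show ?thesis using assms by simp
qed

lemma division_exists: "0 < w \<Longrightarrow> \<exists>a b. p = a * w + b \<and> b < (w::'a)"
proof (rule s1_induct[where x = p])
  show "s1 (\<lambda>e. \<exists>a b. e 0 = a * w + b \<and> b < w)"
    by (intro s1_intros delta_s1[OF delta_eq] delta_s1[OF delta_less] rec_intros)
  show "\<exists>a b. 0 = a * w + b \<and> b < w" if "0 < w" using that by (intro exI[of _ 0]) auto
  show "\<exists>a b. p + 1 = a * w + b \<and> b < w" if w: "0 < w" and "\<exists>a b. p = a * w + b \<and> b < w" for p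
  proof -
    from that obtain a b where ab: "p = a * w + b" "b < w" by blast
    show ?thesis
    proof (cases "b + 1 = w")
      case True
      then have "p + 1 = (a + 1) * w + 0" using ab by (simp add: distrib_right add.assoc)
      then show ?thesis using w by blast
    next
      case False
      then have "b + 1 < w" using ab(2) by (metis less_iff_succ_less_eq order_le_less)
      then show ?thesis using ab by (metis add.assoc)
    qed
  qed
qed

lemma less_mult_iff: "a * w \<le> p \<Longrightarrow> p < r * w \<Longrightarrow> (a + 1) * w \<le> r * (w::'a)"
  by (metis le_less_trans less_iff_succ_less_eq mult_less_cancel_right mult_right_mono nonneg not_less)

lemma block_bound:
  assumes "B < w" "u < (K::'a)"
  shows "B * K + u < K * w"
proof -
  have "B * K + u < B * K + K" using assms(2) by simp
  also have "\<dots> = (B + 1) * K" by (simp add: distrib_right)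
  also have "\<dots> \<le> w * K" using assms(1) by (intro mult_right_mono) (auto simp: less_iff_succ_less_eq)
  finally show ?thesis by (simp add: mult.commute)
qed

section \<open>Numerals in a base \<open>K\<close> that may be nonstandard\<close>

context
  fixes K :: 'a and pw :: "'a \<Rightarrow> 'a"
  assumes K: "0 < K" and pw_0: "pw 0 = 1" and pw_succ: "\<And>x. pw (x + 1) = K * pw x"
    and pw_fn: "fn (\<lambda>e. pw (e 0))"
begin

lemma fn_pw: "fn f \<Longrightarrow> fn (\<lambda>e. pw (f e))"
  by (rule fn_fn1[OF pw_fn])

lemma pw_succ_left: "pw (1 + x) = K * pw x"
  using pw_succ[of x] by (simp add: add.commute)

lemmas pw_succs = pw_succ pw_succ_left

lemma pw_pos: "0 < pw e"
  by (rule delta_induct[where x = e])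
    (use K in \<open>auto intro!: rec_intros fn_pw simp: pw_0 pw_succ pos_iff\<close>)

lemma pw_add: "pw (x + y) = pw x * pw y"
proof (rule delta_induct[where x = y])
  show "delta (\<lambda>e. pw (x + e 0) = pw x * pw (e 0))" by (intro rec_intros fn_pw)
  show "pw (x + (y + 1)) = pw x * pw (y + 1)" if "pw (x + y) = pw x * pw y" for y
    using that by (simp add: add.assoc[symmetric] pw_succ mult.left_commute)
qed (simp add: pw_0)

lemma pw_less: "e < e' \<Longrightarrow> \<exists>r. pw e' = pw (e + 1) * r"
proof -
  assume "e < e'"
  then obtain z where "e' = (e + 1) + z" using le_ex less_iff_succ_less_eq by metis
  then show ?thesis using pw_add by blast
qed

definition digit :: "'a \<Rightarrow> 'a \<Rightarrow> 'a \<Rightarrow> bool" where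
  "digit p e u \<longleftrightarrow> (\<exists>A\<le>p. \<exists>B<pw e. p = A * pw (e + 1) + u * pw e + B)"

lemma digitI: "B < pw e \<Longrightarrow> p = A * pw (e + 1) + u * pw e + B \<Longrightarrow> digit p e u"
proof -
  assume B: "B < pw e" and p: "p = A * pw (e + 1) + u * pw e + B"
  have "A \<le> A * pw (e + 1)" using le_mult_pos[OF pw_pos, of A "e + 1"] by (simp add: mult.commute)
  also have "\<dots> \<le> p" unfolding p by (simp add: add.assoc)
  finally show ?thesis using B p unfolding digit_def by blast
qed

lemma delta_digit: "fn p \<Longrightarrow> fn e \<Longrightarrow> fn u \<Longrightarrow> delta (\<lambda>x. digit (p x) (e x) (u x))"
  unfolding digit_def by (intro rec_intros fn_pw fn_shift)

lemma digit_parts_unique: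
  assumes "A * pw (e + 1) + u * pw e + B = A' * pw (e + 1) + u' * pw e + B'"
    "B < pw e" "B' < pw e" "u < K" "u' < K"
  shows "A = A' \<and> u = u' \<and> B = B'"
proof -
  have "(A * K + u) * pw e + B = (A' * K + u') * pw e + B'"
    using assms(1) by (simp add: pw_succs algebra_simps)
  then have "A * K + u = A' * K + u' \<and> B = B'" by (rule division_unique) fact+
  then show ?thesis using division_unique assms(4,5) by blast
qed

lemma digit_unique: "digit p e u \<Longrightarrow> digit p e u' \<Longrightarrow> u < K \<Longrightarrow> u' < K \<Longrightarrow> u = u'"
  unfolding digit_def using digit_parts_unique by metis

lemma digit_exists: "\<exists>A B u. u < K \<and> B < pw e \<and> p = A * pw (e + 1) + u * pw e + B"
proof -
  obtain a B where a: "p = a * pw e + B" "B < pw e" using division_exists pw_pos by metis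
  obtain A u where "a = A * K + u" "u < K" using division_exists K by metis
  then have "p = A * pw (e + 1) + u * pw e + B" using a(1) by (simp add: pw_succs algebra_simps)
  then show ?thesis using a(2) \<open>u < K\<close> by blast
qed

text \<open>The numeral \<open>p'\<close> arises from \<open>p\<close> by deleting the digit \<open>u\<close> at position \<open>e\<close> and appending it.\<close>

definition moved :: "'a \<Rightarrow> 'a \<Rightarrow> 'a \<Rightarrow> 'a \<Rightarrow> bool" where
  "moved e u p p' \<longleftrightarrow>
    (\<exists>A\<le>p. \<exists>B<pw e. p = A * pw (e + 1) + u * pw e + B \<and> p' = A * pw (e + 1) + B * K + u)"

lemma delta_moved: "fn e \<Longrightarrow> fn u \<Longrightarrow> fn p \<Longrightarrow> fn p' \<Longrightarrow> delta (\<lambda>x. moved (e x) (u x) (p x) (p' x))"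
  unfolding moved_def by (intro rec_intros fn_pw fn_shift)

lemma moved_digit: "moved e u p p' \<Longrightarrow> digit p e u"
  by (auto simp: moved_def digit_def)

lemma moved_exists: "digit p e u \<Longrightarrow> \<exists>p'. moved e u p p'"
  by (auto simp: moved_def digit_def)

text \<open>Only the lowest \<open>e + 1\<close> places are rearranged. The statement keeps the
  whole leading part \<open>A'\<close>, not just the digit \<open>v\<close>, because
  \<open>cut_sequence\<close> compares leading parts.\<close>

lemma moved_above:
  assumes "moved e u p p'" "u < K" "e < e'" "p = A' * pw (e' + 1) + v * pw e' + B'" "B' < pw e'"
  shows "\<exists>B''<pw e'. p' = A' * pw (e' + 1) + v * pw e' + B''"
proof -
  obtain A B where p: "p = A * pw (e + 1) + u * pw e + B" "B < pw e" and p': "p' = A * pw (e + 1) + B * K + u"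
    using assms(1) by (auto simp: moved_def)
  obtain r where r: "pw e' = pw (e + 1) * r" using pw_less assms(3) by blast
  obtain b c where bc: "B' = b * pw (e + 1) + c" "c < pw (e + 1)" using division_exists pw_pos by metis
  have "(A' * K * r + v * r + b) * pw (e + 1) + c = A * pw (e + 1) + (u * pw e + B)"
    using p(1) assms(4) bc(1) r by (simp add: pw_succ[of e'] pw_succ_left[of e'] algebra_simps)
  moreover have "u * pw e + B < pw (e + 1)"
    using less_mult_iff[of u "pw e" "u * pw e" K] assms(2) p(2)
    unfolding pw_succ by (metis add_strict_left_mono distrib_right less_iff_succ_less_eq
        less_le_trans mult_1 mult_right_mono nonneg)
  ultimately have A: "A = A' * K * r + v * r + b" using division_unique bc(2) by metis
  have "p' = A' * pw (e' + 1) + v * pw e' + (b * pw (e + 1) + (B * K + u))"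
    unfolding p' A by (simp add: pw_succ[of e'] pw_succ_left[of e'] r algebra_simps)
  moreover have "b * pw (e + 1) + (B * K + u) < pw e'"
  proof -
    have "b * pw (e + 1) + (B * K + u) < (b + 1) * pw (e + 1)"
      using block_bound[OF p(2) assms(2)] by (simp add: distrib_right pw_succ)
    also have "\<dots> \<le> r * pw (e + 1)"
      using assms(5) r bc by (intro less_mult_iff[where p = B']) (auto simp: mult.commute)
    finally show ?thesis using r by (simp add: mult.commute)
  qed
  ultimately show ?thesis by blast
qed

lemma moved_above_digit: "moved e u p p' \<Longrightarrow> u < K \<Longrightarrow> e < e' \<Longrightarrow> digit p e' v \<Longrightarrow> digit p' e' v"
  using moved_above digitI unfolding digit_def[of p] by metis

text \<open>Digits below the deleted one shift up by one place to make room for the appended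
  digit.\<close>

lemma moved_below_digit:
  assumes "moved e u p p'" "u < K" "e' < e" "digit p e' v" "v < K"
  shows "digit p' (e' + 1) v"
proof -
  obtain A B where p: "p = A * pw (e + 1) + u * pw e + B" "B < pw e" and p': "p' = A * pw (e + 1) + B * K + u"
    using assms(1) by (auto simp: moved_def)
  obtain A' B' where e': "p = A' * pw (e' + 1) + v * pw e' + B'" "B' < pw e'"
    using assms(4) by (auto simp: digit_def)
  obtain r where r: "pw e = pw (e' + 1) * r" using pw_less assms(3) by blast
  obtain b c where bc: "B = b * pw (e' + 1) + c" "c < pw (e' + 1)" using division_exists pw_pos by metis
  have "((A * K + u) * r + b) * pw (e' + 1) + c = A' * pw (e' + 1) + (v * pw e' + B')"
    using p(1) e'(1) bc(1) r by (simp add: pw_succ[of e] pw_succ_left[of e] algebra_simps)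
  moreover have "v * pw e' + B' < pw (e' + 1)"
    using assms(5) e'(2) unfolding pw_succ by (metis add_strict_left_mono distrib_right
        less_iff_succ_less_eq less_le_trans mult_1 mult_right_mono nonneg)
  ultimately have c: "c = v * pw e' + B'" using division_unique bc(2) by metis
  have "p' = (A * r + b) * pw ((e' + 1) + 1) + v * pw (e' + 1) + (B' * K + u)"
    unfolding p' bc(1) c by (simp add: pw_succs r algebra_simps)
  moreover have "B' * K + u < pw (e' + 1)" using block_bound[OF e'(2) assms(2)] by (simp add: pw_succ)
  ultimately show ?thesis by (intro digitI)
qed

lemma moved_first_digit:
  assumes "moved e u p p'" "u < K"
  shows "digit p' 0 u"
proof -
  obtain A B where p': "p' = A * pw (e + 1) + B * K + u"
    using assms(1) by (auto simp: moved_def)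
  show ?thesis
    by (rule digitI[where A = "A * pw e + B" and B = 0])
      (use p' in \<open>auto simp: pw_0 pw_succs pw_succ[of 0, simplified] algebra_simps\<close>)
qed

section \<open>Permutations of the colors as numerals, and the sequence \<open>p\<close>\<close>

definition permutation :: "'a \<Rightarrow> bool" where
  "permutation p \<longleftrightarrow> p < pw K \<and> (\<forall>u<K. \<exists>e<K. digit p e u) \<and>
    (\<forall>u<K. \<forall>e<K. \<forall>e'<K. digit p e u \<and> digit p e' u \<longrightarrow> e = e')"

lemma delta_permutation: "fn p \<Longrightarrow> delta (\<lambda>x. permutation (p x))"
  unfolding permutation_def by (intro rec_intros delta_digit fn_shift)

lemma moved_permutation:
  assumes m: "moved e u p p'" and "u < K" "e < K" and perm: "permutation p"
  shows "permutation p'"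
proof -
  \<comment> \<open>The cyclic shift that the move induces on positions.\<close>
  define \<pi> where "\<pi> f = (if f = e then 0 else if f < e then f + 1 else f)" for f
  have \<pi>_less: "f < K \<Longrightarrow> \<pi> f < K" for f
    using assms(3) K le_less_trans[of "f + 1" e K] less_iff_succ_less_eq[of f e] by (auto simp: \<pi>_def)
  have \<pi>: "digit p' (\<pi> f) v" if "digit p f v" "v < K" for f v
  proof -
    have "f = e \<Longrightarrow> v = u" using digit_unique[OF that(1)] moved_digit[OF m] assms(2) that(2) by blast
    then show ?thesis
      using moved_first_digit[OF m assms(2)] moved_below_digit[OF m assms(2) _ that]
        moved_above_digit[OF m assms(2) _ that(1)] by (auto simp: \<pi>_def not_less_iff_gr_or_eq)
  qed
  have \<pi>_surj: "\<exists>f<K. \<pi> f = f'" if "f' < K" for f'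
  proof (cases f' rule: succ_cases)
    case 1
    then show ?thesis using assms(3) by (auto simp: \<pi>_def)
  next
    case (2 f)
    have "f < f'" unfolding 2 by (simp add: less_Suc)
    show ?thesis
    proof (cases "f' \<le> e")
      case True
      then have "f < e" using \<open>f < f'\<close> by simp
      then show ?thesis using assms(3) 2 by (intro exI[of _ f]) (auto simp: \<pi>_def)
    qed (use that in \<open>auto simp: \<pi>_def intro!: exI[of _ f']\<close>)
  qed
  \<comment> \<open>Since \<open>\<pi>\<close> is onto and digits are unique, a color of
    \<open>p'\<close> already stood in \<open>p\<close> at a position that \<open>\<pi>\<close>
    sends to its present one. So two positions of the same color in \<open>p'\<close> come from a
    single one in \<open>p\<close>.\<close>
  have origin: "\<exists>f<K. \<pi> f = f' \<and> digit p f v" if *: "digit p' f' v" "v < K" "f' < K" for f' v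
  proof -
    obtain f where f: "f < K" "\<pi> f = f'" using \<pi>_surj *(3) by blast
    obtain A B w where "w < K" "B < pw f" "p = A * pw (f + 1) + w * pw f + B"
      using digit_exists by blast
    then have "digit p f w" by (intro digitI)
    then have "w = v" using \<pi> \<open>w < K\<close> digit_unique *(1,2) f(2) by metis
    then show ?thesis using f \<open>digit p f w\<close> by blast
  qed
  have "p' < pw K"
  proof -
    obtain A B where p: "p = A * pw (e + 1) + u * pw e + B" "B < pw e" and p': "p' = A * pw (e + 1) + B * K + u"
      using m by (auto simp: moved_def)
    obtain r where r: "pw K = pw (e + 1) * r" using pw_less assms(3) by blast
    have "p' < (A + 1) * pw (e + 1)"
      unfolding p' using block_bound[OF p(2) assms(2)] by (simp add: distrib_right pw_succ add.assoc)
    also have "\<dots> \<le> r * pw (e + 1)"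
      using perm p(1) r by (intro less_mult_iff[where p = p]) (auto simp: permutation_def mult.commute add.assoc)
    finally show ?thesis using r by (simp add: mult.commute)
  qed
  moreover have "\<exists>f<K. digit p' f v" if "v < K" for v
    using perm \<pi> \<pi>_less that unfolding permutation_def by metis
  moreover have "f = f'" if "v < K" "f < K" "f' < K" "digit p' f v" "digit p' f' v" for v f f'
    using origin perm that unfolding permutation_def by metis
  ultimately show ?thesis unfolding permutation_def by blast
qed

lemma permutation_exists: "\<exists>p. permutation p"
proof -
  \<comment> \<open>The identity arrangement, digit \<open>n\<close> at position \<open>n\<close>,
    is built by adding one leading digit at a time.\<close>
  have "fn (\<lambda>e. e (Suc 0) + e 0 * pw (e 0))" by (intro rec_intros fn_pw)
  from prim_rec[where G = "\<lambda>n v. v + n * pw n", OF this, of 0]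
  obtain q where q: "q 0 = 0" "\<And>n. q (n + 1) = q n + n * pw n" "fn (\<lambda>e. q (e 0))" by blast
  have "n \<le> K \<longrightarrow> q n < pw n \<and> (\<forall>e<n. digit (q n) e e)" for n
  proof (rule delta_induct[where x = n])
    show "delta (\<lambda>e. e 0 \<le> K \<longrightarrow> q (e 0) < pw (e 0) \<and> (\<forall>i<e 0. digit (q (e 0)) i i))"
      by (intro rec_intros fn_pw delta_digit fn_fn1[OF q(3)])
    show "n + 1 \<le> K \<longrightarrow> q (n + 1) < pw (n + 1) \<and> (\<forall>e<n + 1. digit (q (n + 1)) e e)"
      if IH: "n \<le> K \<longrightarrow> q n < pw n \<and> (\<forall>e<n. digit (q n) e e)" for n
    proof
      assume n: "n + 1 \<le> K"
      then have n': "n < K" by (simp add: less_iff_succ_less_eq)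
      then have IH: "q n < pw n" "\<And>e. e < n \<Longrightarrow> digit (q n) e e" using IH by auto
      have "q n + n * pw n < (n + 1) * pw n" using IH(1) by (simp add: distrib_right add.commute[of "q n"])
      also have "\<dots> \<le> K * pw n" using n by (intro mult_right_mono) auto
      finally have 1: "q (n + 1) < pw (n + 1)" by (simp add: q pw_succ)
      have "digit (q (n + 1)) e e" if "e < n + 1" for e
      proof (cases "e = n")
        case True
        then show ?thesis using IH(1) by (intro digitI[where A = 0 and B = "q n"]) (auto simp: q add.commute[of "q n"])
      next
        case False
        then have e: "e < n" using that by (simp add: less_Suc)
        obtain A B where AB: "q n = A * pw (e + 1) + e * pw e + B" "B < pw e"
          using IH(2)[OF e] by (auto simp: digit_def)
        obtain r where r: "pw n = pw (e + 1) * r" using pw_less e by blast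
        have "q (n + 1) = (A + n * r) * pw (e + 1) + e * pw e + B"
          unfolding q(2) AB(1) r by (simp add: algebra_simps)
        then show ?thesis by (rule digitI[OF AB(2)])
      qed
      with 1 show "q (n + 1) < pw (n + 1) \<and> (\<forall>e<n + 1. digit (q (n + 1)) e e)" by blast
    qed
  qed (simp add: q pw_0)
  from this[of K] have q': "q K < pw K" "\<And>e. e < K \<Longrightarrow> digit (q K) e e" by auto
  then have "permutation (q K)"
    unfolding permutation_def using digit_unique by metis
  then show ?thesis by blast
qed

text \<open>
  The colors less than \<open>K\<close>, in the order of their last occurrences, form the base-\<open>K\<close> expansion of
  \<open>p s\<close>.  If every color dies out, then more and more leading digits of \<open>p s\<close> become constant, but
  no \<open>p x\<close> is a limit: its last digit ends up at a leading position where \<open>p x\<close> has another digit.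
\<close>

lemma cut_sequence:
  assumes g: "fn (\<lambda>e. g (e 0))" and g_less: "\<And>x. g x < K"
    and dies: "\<And>i. i < K \<Longrightarrow> \<exists>s. \<forall>x\<ge>s. g x \<noteq> i"
  obtains p where "fn (\<lambda>e. p (e 0))" "\<And>x. p x < pw K"
    "\<And>x. (\<exists>s. \<forall>y\<ge>s. p y < p x) \<or> (\<exists>s. \<forall>y\<ge>s. p x < p y)"
proof -
  \<comment> \<open>The second alternative leaves the numeral alone if the color is missing; it
    makes the relation total, as the choice of a step function requires.\<close>
  define R where "R v q u \<longleftrightarrow> (\<exists>e<K. moved e u q v) \<or> (\<forall>e<K. \<not> digit q e u) \<and> v = q" for v q u
  have R1: "delta (\<lambda>e. R (e 0) (e (Suc 0)) (e (Suc (Suc 0))))"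
    unfolding R_def by (intro rec_intros delta_moved delta_digit)
  have R2: "\<exists>v. R v q u" for q u
    using moved_exists unfolding R_def by metis
  obtain st where st: "fn (\<lambda>e. st (e 0) (e (Suc 0)))" "\<And>q u. R (st q u) q u"
    by (rule least_fn2[of R, OF R1 R2]) (rule that)
  obtain p0 where p0: "permutation p0" using permutation_exists by blast
  have "fn (\<lambda>e. st (e (Suc 0)) (g (e 0)))"
    by (intro fn_fn2[OF st(1)] fn_fn1[OF g] fn_var)
  from prim_rec[where G = "\<lambda>s v. st v (g s)", OF this, of p0]
  obtain p where p: "p 0 = p0" "\<And>s. p (s + 1) = st (p s) (g s)" "fn (\<lambda>e. p (e 0))" by blast
  have fn_p: "fn f \<Longrightarrow> fn (\<lambda>e. p (f e))" for f by (rule fn_fn1[OF p(3)])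
  have step: "\<exists>e<K. moved e (g s) (p s) (p (s + 1))" if "permutation (p s)" for s
    using st(2)[of "p s" "g s"] that g_less[of s] unfolding R_def permutation_def p(2) by metis
  have perm: "permutation (p s)" for s
  proof (rule delta_induct[where x = s])
    show "delta (\<lambda>e. permutation (p (e 0)))" by (intro delta_permutation fn_p fn_var)
    show "permutation (p (s + 1))" if "permutation (p s)" for s
      using step[OF that] moved_permutation that g_less by blast
  qed (simp add: p(1) p0)
  have "(\<exists>s. \<forall>y\<ge>s. p y < p x) \<or> (\<exists>s. \<forall>y\<ge>s. p x < p y)" for x
  proof -
    \<comment> \<open>The color in the last place of \<open>p x\<close> will decide the comparison
      with later values; from \<open>s0\<close> on it does not occur any more.\<close>
    obtain i where i: "i < K" "digit (p x) 0 i" using digit_exists digitI by metis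
    obtain s0 where s0: "\<And>y. s0 \<le> y \<Longrightarrow> g y \<noteq> i" using dies i(1) by blast
    \<comment> \<open>The positions of \<open>i\<close> from stage \<open>s0\<close> on. A dead
      color only drifts towards the leading end, so the greatest of them is its final position; it
      exists because the set is bounded and \<open>\<Sigma>\<^sup>0\<^sub>1\<close>.\<close>
    let ?Q = "\<lambda>e. e < K \<and> (\<exists>s. s0 \<le> s \<and> digit (p s) e i)"
    have Q1: "s1 (\<lambda>e. ?Q (e 0))"
      by (intro s1_intros delta_s1[OF delta_less] delta_s1[OF delta_le] delta_s1[OF delta_digit]
          rec_intros fn_p)
    obtain e0 where "e0 < K" "digit (p s0) e0 i"
      using perm[of s0] i(1) unfolding permutation_def by blast
    then have Q2: "?Q e0" by blast
    have Q3: "f \<le> K" if "?Q f" for f by (rule order_less_imp_le[OF conjunct1[OF that]])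
    obtain e where e: "?Q e" "\<And>f. ?Q f \<Longrightarrow> f \<le> e"
      by (rule s1_greatest[of ?Q, OF Q1 Q2 Q3]) blast+
    then obtain s A B where s: "s0 \<le> s" "p s = A * pw (e + 1) + i * pw e + B" "B < pw e"
      by (auto simp: digit_def)
    \<comment> \<open>The moved color is not \<open>i\<close>, so the move does not occur at
      \<open>e\<close>; a move above \<open>e\<close> would push \<open>i\<close> to
      \<open>e + 1\<close>, against maximality. In particular some position lies below
      \<open>e\<close>.\<close>
    have lower: "\<exists>f<e. moved f (g t) (p t) (p (t + 1))" if t: "s0 \<le> t" "digit (p t) e i" for t
    proof -
      obtain f where f: "f < K" "moved f (g t) (p t) (p (t + 1))" using step perm by blast
      have "f \<noteq> e"
        using digit_unique[OF moved_digit[OF f(2)], of i] t s0[OF t(1)] g_less i(1) by blast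
      moreover have "\<not> e < f"
      proof
        assume "e < f"
        then have "digit (p (t + 1)) (e + 1) i"
          using moved_below_digit[OF f(2) g_less] t(2) i(1) by blast
        moreover have "e + 1 < K" "s0 \<le> t + 1"
          using \<open>e < f\<close> f(1) t(1) by (auto simp: less_iff_succ_less_eq intro: order_trans add_increasing2 le_less_trans)
            (metis less_iff_succ_less_eq less_le_trans order_le_less_trans)
        ultimately have "e + 1 \<le> e" using e(2) by blast
        then show False by (metis less_iff_succ_less_eq order_less_irrefl)
      qed
      ultimately show ?thesis using f(2) by (metis linorder_neqE)
    qed
    have "0 < e" using lower[OF s(1) digitI[OF s(3,2)]] by (auto simp: pos_iff)
    \<comment> \<open>From stage \<open>s\<close> on, all digits from position \<open>e\<close>
      upwards are frozen.\<close>
    have stable: "\<exists>B<pw e. p (s + t) = A * pw (e + 1) + i * pw e + B" for t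
    proof (rule delta_induct[where x = t])
      show "delta (\<lambda>x. \<exists>B<pw e. p (s + x 0) = A * pw (e + 1) + i * pw e + B)"
        by (intro rec_intros fn_p)
      show "\<exists>B<pw e. p (s + (t + 1)) = A * pw (e + 1) + i * pw e + B"
        if "\<exists>B<pw e. p (s + t) = A * pw (e + 1) + i * pw e + B" for t
      proof -
        from that obtain B where B: "B < pw e" "p (s + t) = A * pw (e + 1) + i * pw e + B" by blast
        have "s0 \<le> s + t" using s(1) by (metis add_increasing2 nonneg)
        then obtain f where f: "f < e" "moved f (g (s + t)) (p (s + t)) (p (s + t + 1))"
          using lower digitI[OF B] by blast
        from moved_above[OF f(2) g_less f(1) B(2,1)] show ?thesis by (simp add: add.assoc)
      qed
    qed (use s in auto)
    obtain A0 B0 v where v: "v < K" "B0 < pw e" "p x = A0 * pw (e + 1) + v * pw e + B0"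
      using digit_exists by blast
    have "v \<noteq> i"
      using perm[of x] i digitI[OF v(2,3)] e(1) \<open>0 < e\<close> K unfolding permutation_def by (metis order_less_irrefl)
    then have neq: "A0 * K + v \<noteq> A * K + i" using division_unique v(1) i(1) by blast
    have px: "p x = (A0 * K + v) * pw e + B0"
      unfolding v(3) by (simp add: pw_succs algebra_simps)
    have py: "\<exists>B<pw e. p y = (A * K + i) * pw e + B" if y: "s \<le> y" for y
    proof -
      obtain t where "y = s + t" using le_ex y by blast
      then obtain B where "B < pw e" "p y = A * pw (e + 1) + i * pw e + B" using stable[of t] by blast
      then show ?thesis by (auto simp: pw_succs algebra_simps intro!: exI[of _ B])
    qed
    from neq consider "A0 * K + v < A * K + i" | "A * K + i < A0 * K + v" by (metis linorder_neqE)
    then show ?thesis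
    proof cases
      case 1
      then have "\<forall>y\<ge>s. p x < p y" using py leading_less v(2) px by metis
      then show ?thesis by blast
    next
      case 2
      then have "\<forall>y\<ge>s. p y < p x" using py leading_less px by metis
      then show ?thesis by blast
    qed
  qed
  then show thesis using that p(3) perm unfolding permutation_def by blast
qed

end

section \<open>From the polarized theorem to stable Ramsey\<close>

text \<open>A form of the increasing polarized Ramsey theorem for pairs. \<open>L i\<close> and
  \<open>M i\<close> stand for the lowest and the highest binary position of the i-th element of an
  apart set, whence the interleaving. \<open>R\<close> may be any coloring, not only a stable
  one.\<close>

definition polarized :: bool where
  "polarized \<longleftrightarrow> (\<forall>R. delta (\<lambda>e. R (e 0) (e (Suc 0))) \<longrightarrow>
    (\<exists>L M. fn (\<lambda>e. L (e 0)) \<and> fn (\<lambda>e. M (e 0)) \<and> (\<forall>i. L i \<le> M i \<and> M i < L (i + 1)) \<and>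
      ((\<forall>i j. i < j \<longrightarrow> R (L i) (M j)) \<or> (\<forall>i j. i < j \<longrightarrow> \<not> R (L i) (M j)))))"

lemma polarizedE:
  assumes polarized "delta (\<lambda>e. R (e 0) (e (Suc 0)))"
  obtains L M where "fn (\<lambda>e. L (e 0))" "fn (\<lambda>e. M (e 0))" "\<And>i. L i \<le> M i" "\<And>i. M i < L (i + 1)"
    "(\<forall>i j. i < j \<longrightarrow> R (L i) (M j)) \<or> (\<forall>i j. i < j \<longrightarrow> \<not> R (L i) (M j))"
  using assms(1)[unfolded polarized_def, rule_format, OF assms(2)] that by blast

lemma increasing:
  assumes L: "fn (\<lambda>e. L (e 0))" and step: "\<And>i. L i < L (i + 1)"
  shows "i \<le> L i" "i < j \<Longrightarrow> L i < L j"
proof -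
  have fn_L: "fn f \<Longrightarrow> fn (\<lambda>e. L (f e))" for f by (rule fn_fn1[OF L])
  show "i \<le> L i"
  proof (rule delta_induct[where x = i])
    show "delta (\<lambda>e. e 0 \<le> L (e 0))" by (intro rec_intros fn_L)
    show "i + 1 \<le> L (i + 1)" if "i \<le> L i" for i
      using le_less_trans[OF that step] by (simp add: less_iff_succ_less_eq)
  qed simp
  have "L i < L (i + t + 1)" for t
  proof (rule delta_induct[where x = t])
    show "delta (\<lambda>e. L i < L (i + e 0 + 1))" by (intro rec_intros fn_L)
    show "L i < L (i + (t + 1) + 1)" if "L i < L (i + t + 1)" for t
      using less_trans[OF that step] by (simp add: add.assoc)
  qed (use step in simp)
  then show "i < j \<Longrightarrow> L i < L j" using less_ex by metis
qed

text \<open>The case that matters is a nonstandard \<open>K\<close>, for which the colors cannot be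
  treated one by one.\<close>

lemma polarized_pigeonhole:
  assumes polarized and g: "fn (\<lambda>e. g (e 0))" and g_less: "\<And>x. g x < K"
  shows "\<exists>i<K. \<forall>s. \<exists>x\<ge>s. g x = i"
proof (rule ccontr)
  assume "\<not> ?thesis"
  then have dies: "\<exists>s. \<forall>x\<ge>s. g x \<noteq> i" if "i < K" for i using that by metis
  have "0 < K" using g_less[of 0] by (metis nonneg le_less_trans)
  have "fn (\<lambda>e. K * e (Suc 0))" by (intro rec_intros)
  from prim_rec[where G = "\<lambda>_ v. K * v", OF this, of 1]
  obtain pw where pw: "pw 0 = 1" "\<And>x. pw (x + 1) = K * pw x" "fn (\<lambda>e. pw (e 0))" by blast
  obtain p where p: "fn (\<lambda>e. p (e 0))" "\<And>x. p x < pw K"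
    "\<And>x. (\<exists>s. \<forall>y\<ge>s. p y < p x) \<or> (\<exists>s. \<forall>y\<ge>s. p x < p y)"
    by (rule cut_sequence[OF \<open>0 < K\<close> pw g g_less dies]) (assumption | rule that)+
  have fn_p: "fn f \<Longrightarrow> fn (\<lambda>e. p (f e))" for f by (rule fn_fn1[OF p(1)])
  have R: "delta (\<lambda>e. p (e 0) < p (e (Suc 0)))" by (intro rec_intros fn_p)
  obtain L M where LM: "fn (\<lambda>e. L (e 0))" "fn (\<lambda>e. M (e 0))" "\<And>i. L i \<le> M i" "\<And>i. M i < L (i + 1)"
    "(\<forall>i j. i < j \<longrightarrow> p (L i) < p (M j)) \<or> (\<forall>i j. i < j \<longrightarrow> \<not> p (L i) < p (M j))"
    by (rule polarizedE[OF \<open>polarized\<close> R]) (rule that)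
  have fn_L: "fn f \<Longrightarrow> fn (\<lambda>e. L (f e))" for f by (rule fn_fn1[OF LM(1)])
  have L: "i \<le> L i" for i using increasing(1)[OF LM(1)] LM(3,4) le_less_trans by metis
  then have M: "i \<le> M i" for i using LM(3) order_trans by metis
  have late: "\<exists>j>i. s \<le> L j \<and> s \<le> M j" for i s
  proof -
    have "i < max s (i + 1)" "s \<le> max s (i + 1)" by (auto simp: less_max_iff_disj less_Suc)
    then show ?thesis using L M order_trans by metis
  qed
  \<comment> \<open>The values of \<open>p\<close> at \<open>L\<close> form a bounded
    \<open>\<Sigma>\<^sup>0\<^sub>1\<close> set, so the greatest and the least of them are attained.
    Late values of \<open>p\<close> all lie on one side of such a \<open>p (L i)\<close>. One side
    contradicts extremality at a late \<open>L j\<close>, the other the color of the pair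
    \<open>L i\<close>, \<open>M j\<close>.\<close>
  have s1: "s1 (\<lambda>e. \<exists>i. p (L i) = e 0)" by (intro s1_intros delta_s1[OF delta_eq] rec_intros fn_p fn_L)
  from LM(5) show False
  proof
    assume R: "\<forall>i j. i < j \<longrightarrow> p (L i) < p (M j)"
    obtain m where "\<exists>i. p (L i) = m" "\<And>y. \<exists>i. p (L i) = y \<Longrightarrow> y \<le> m"
      by (rule s1_greatest[OF s1, of "p (L 0)" "pw K"]) (use p(2) order_less_imp_le in blast)+
    then obtain i where i: "\<And>j. p (L j) \<le> p (L i)" by metis
    from p(3)[of "L i"] show False using late R i by (metis not_less order_less_asym)
  next
    assume R: "\<forall>i j. i < j \<longrightarrow> \<not> p (L i) < p (M j)"
    obtain m where "\<exists>i. p (L i) = m" "\<And>y. y < m \<Longrightarrow> \<not> (\<exists>i. p (L i) = y)"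
      by (rule s1_least[OF s1, of "p (L 0)"]) blast+
    then obtain i where i: "\<And>j. \<not> p (L j) < p (L i)" by metis
    from p(3)[of "L i"] show False using late R i by metis
  qed
qed

text \<open>Only the color \<open>R\<close> is treated: the other one is the same lemma for the
  complement of \<open>R\<close>.\<close>

lemma stable_homogeneous_aux:
  assumes polarized and R: "delta (\<lambda>e. R (e 0) (e (Suc 0)))"
    and stable: "\<And>x. \<exists>t. (\<forall>s\<ge>t. R x s) \<or> (\<forall>s\<ge>t. \<not> R x s)"
    and L: "fn (\<lambda>e. L (e 0))" and LM: "\<And>i. L i \<le> M i" "\<And>i. M i < L (i + 1)"
      "\<And>i j. i < j \<Longrightarrow> R (L i) (M j)"
  shows "\<exists>J\<in>S. (\<forall>x. \<exists>y\<in>J. x < y) \<and> (\<forall>x\<in>J. \<forall>y\<in>J. x < y \<longrightarrow> R x y)"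
proof -
  have fn_L: "fn f \<Longrightarrow> fn (\<lambda>e. L (f e))" for f by (rule fn_fn1[OF L])
  have delta_R: "fn f \<Longrightarrow> fn h \<Longrightarrow> delta (\<lambda>e. R (f e) (h e))" for f h by (rule delta_fn2[OF R])
  have L_succ: "L i < L (i + 1)" for i using LM(1,2) le_less_trans by blast
  note L_inc = increasing[OF L L_succ]
  \<comment> \<open>Stability gives \<open>L i\<close> a limit color, and
    \<open>R (L i) (M j)\<close> for arbitrarily large \<open>M j\<close> tells which one it
    is.\<close>
  have lim: "\<exists>t. \<forall>s\<ge>t. R (L i) s" for i
  proof -
    obtain t where t: "(\<forall>s\<ge>t. R (L i) s) \<or> (\<forall>s\<ge>t. \<not> R (L i) s)" using stable by blast
    have j: "i < max t (i + 1)" by (auto simp: less_max_iff_disj less_Suc)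
    have "t \<le> M (max t (i + 1))"
      using order_trans[OF _ order_trans[OF L_inc(1) LM(1)], of t "max t (i + 1)"] by simp
    then show ?thesis using t LM(3)[OF j] by blast
  qed
  text \<open>\<open>J\<close> is the greedy homogeneous set of indices; \<open>(m, n)\<close> codes an initial segment of it.\<close>
  define seg where "seg m n y \<longleftrightarrow> (\<forall>j<y. code_mem m n j \<longleftrightarrow> (\<forall>i<j. code_mem m n i \<longrightarrow> R (L i) (L j)))" for m n y
  have delta_seg: "fn m \<Longrightarrow> fn n \<Longrightarrow> fn y \<Longrightarrow> delta (\<lambda>e. seg (m e) (n e) (y e))" for m n y
    unfolding seg_def by (intro rec_intros delta_code_mem delta_R fn_L fn_shift)
  have seg_ex: "\<exists>m n. seg m n y" for y
  proof (rule s1_induct[where x = y])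
    show "s1 (\<lambda>e. \<exists>m n. seg m n (e 0))" by (intro s1_ex delta_s1 delta_seg rec_intros)
    show "\<exists>m n. seg m n (y + 1)" if "\<exists>m n. seg m n y" for y
    proof -
      from that obtain m n where mn: "seg m n y" by blast
      define X where "X j \<longleftrightarrow> j < y \<and> code_mem m n j \<or> j = y \<and> (\<forall>i<y. code_mem m n i \<longrightarrow> R (L i) (L y))" for j
      have "delta (\<lambda>e. X (e 0))" unfolding X_def by (intro rec_intros delta_code_mem delta_R fn_L)
      then obtain m' n' where X: "\<And>j. j < y + 1 \<Longrightarrow> code_mem m' n' j \<longleftrightarrow> X j"
        using code_exists[of X "y + 1"] by blast
      have old: "code_mem m' n' j \<longleftrightarrow> code_mem m n j" if "j < y" for j
        using X[of j] that by (auto simp: X_def less_Suc)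
      have new: "code_mem m' n' y \<longleftrightarrow> (\<forall>i<y. code_mem m n i \<longrightarrow> R (L i) (L y))"
        using X[of y] by (auto simp: X_def less_Suc)
      have "code_mem m' n' j \<longleftrightarrow> (\<forall>i<j. code_mem m' n' i \<longrightarrow> R (L i) (L j))" if "j < y + 1" for j
      proof (cases "j = y")
        case False
        then have j: "j < y" using that by (simp add: less_Suc)
        have "code_mem m n j \<longleftrightarrow> (\<forall>i<j. code_mem m n i \<longrightarrow> R (L i) (L j))"
          using mn j unfolding seg_def by blast
        then show ?thesis using old j less_trans by metis
      qed (use old new in auto)
      then show ?thesis unfolding seg_def by blast
    qed
  qed (simp add: seg_def)
  have seg_unique: "code_mem m n j \<longleftrightarrow> code_mem m' n' j"
    if segs: "seg m n y" "seg m' n' y'" "j < y" "j < y'" for m n y m' n' y' j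
  proof -
    have "\<forall>i<z. i < y \<and> i < y' \<longrightarrow> (code_mem m n i \<longleftrightarrow> code_mem m' n' i)" for z
    proof (rule delta_induct[where x = z])
      show "delta (\<lambda>e. \<forall>i<e 0. i < y \<and> i < y' \<longrightarrow> (code_mem m n i \<longleftrightarrow> code_mem m' n' i))"
        by (intro rec_intros delta_code_mem)
      show "\<forall>i<z + 1. i < y \<and> i < y' \<longrightarrow> (code_mem m n i \<longleftrightarrow> code_mem m' n' i)"
        if IH: "\<forall>i<z. i < y \<and> i < y' \<longrightarrow> (code_mem m n i \<longleftrightarrow> code_mem m' n' i)" for z
      proof (intro allI impI)
        fix i assume i: "i < z + 1" "i < y \<and> i < y'"
        have "code_mem m n k \<longleftrightarrow> code_mem m' n' k" if "k < i" for k
          using IH i that by (meson less_Suc less_le_trans less_trans)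
        then show "code_mem m n i \<longleftrightarrow> code_mem m' n' i"
          using segs(1,2) i(2) unfolding seg_def by metis
      qed
    qed simp
    from this[of "j + 1"] show ?thesis using segs(3,4) by (simp add: less_Suc)
  qed
  \<comment> \<open>All coded segments agree by \<open>seg_unique\<close>, so \<open>J\<close> and
    its complement are both existential statements about codes.\<close>
  define J where "J j \<longleftrightarrow> (\<exists>m n. seg m n (j + 1) \<and> code_mem m n j)" for j
  have not_J: "\<not> J j \<longleftrightarrow> (\<exists>m n. seg m n (j + 1) \<and> \<not> code_mem m n j)" for j
    unfolding J_def using seg_ex[of "j + 1"] seg_unique[of _ _ "j + 1" _ _ "j + 1" j] less_Suc[of j j] by blast
  have J0: "delta (\<lambda>e. J (e 0))"
    unfolding delta_def not_J unfolding J_def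
    by (intro conjI s1_intros delta_s1[OF delta_seg] delta_s1[OF delta_not] delta_s1[OF delta_code_mem]
        delta_code_mem rec_intros)
  have delta_J: "fn f \<Longrightarrow> delta (\<lambda>e. J (f e))" for f by (rule delta_fn1[OF J0])
  have J: "J j \<longleftrightarrow> (\<forall>i<j. J i \<longrightarrow> R (L i) (L j))" for j
  proof -
    obtain m n where mn: "seg m n (j + 1)" using seg_ex by blast
    have "J i \<longleftrightarrow> code_mem m n i" if "i \<le> j" for i
      unfolding J_def using seg_unique[OF _ mn, of _ _ "i + 1" i] seg_ex[of "i + 1"] that less_Suc by blast
    then show ?thesis using mn unfolding seg_def by (metis less_Suc order_less_imp_le order_refl)
  qed
  \<comment> \<open>If \<open>J\<close> had no element from \<open>b\<close> on, every index
    \<open>b + y\<close> would be rejected because of some \<open>g y\<close> in \<open>J\<close>,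
    and \<open>g y < b\<close>. By the pigeonhole principle one \<open>i\<close> rejects arbitrarily
    large indices, although the limit color of \<open>L i\<close> is \<open>R\<close>.\<close>
  have unbounded: "\<exists>j\<ge>b. J j" for b
  proof (rule ccontr)
    assume no: "\<not> ?thesis"
    define B where "B v y \<longleftrightarrow> J v \<and> \<not> R (L v) (L (b + y))" for v y
    have B1: "\<exists>v. B v y" for y
      using J[of "b + y"] no unfolding B_def by (metis le_add_same_cancel1 nonneg)
    have B2: "delta (\<lambda>e. B (e 0) (e (Suc 0)))"
      unfolding B_def by (intro rec_intros delta_J delta_R fn_L)
    obtain g where g: "fn (\<lambda>e. g (e 0))" "\<And>y. B (g y) y"
      by (rule least_fn1[of B, OF B2 B1]) (rule that)
    have "g y < b" for y using g(2)[of y] no unfolding B_def by (meson not_less)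
    then obtain i where i: "\<And>s. \<exists>y\<ge>s. g y = i" using polarized_pigeonhole[OF assms(1) g(1)] by metis
    obtain t where t: "\<And>s. t \<le> s \<Longrightarrow> R (L i) s" using lim by blast
    obtain y where y: "t \<le> y" "g y = i" using i by blast
    have "t \<le> L (b + y)" using L_inc(1)[of "b + y"] y(1) by (metis add_increasing nonneg order_trans)
    then show False using t g(2)[of y] y(2) unfolding B_def by blast
  qed
  \<comment> \<open>The image of \<open>J\<close> under \<open>L\<close> is again
    \<open>delta\<close>, since \<open>j \<le> L j\<close> bounds the search for the index.\<close>
  have "delta (\<lambda>e. \<exists>j\<le>e 0. e 0 = L j \<and> J j)" by (intro rec_intros fn_L delta_J)
  then have "{x. \<exists>j\<le>x. x = L j \<and> J j} \<in> S" by (rule compr)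
  moreover have "\<exists>y\<in>{x. \<exists>j\<le>x. x = L j \<and> J j}. x < y" for x
  proof -
    obtain j where j: "x + 1 \<le> j" "J j" using unbounded by blast
    have "x < L j" using order_trans[OF j(1) L_inc(1)] by (simp add: less_iff_succ_less_eq)
    then show ?thesis using j(2) L_inc(1) by blast
  qed
  moreover have "R x y" if xy: "x \<in> {x. \<exists>j\<le>x. x = L j \<and> J j}" "y \<in> {x. \<exists>j\<le>x. x = L j \<and> J j}" "x < y" for x y
  proof -
    obtain i j where ij: "x = L i" "J i" "y = L j" "J j" using xy by blast
    have "i < j" using xy(3) L_inc(2)[of j i] ij by (metis linorder_neqE order_less_asym)
    then show ?thesis using J[of j] ij by blast
  qed
  ultimately show ?thesis by blast
qed

lemma stable_homogeneous:
  assumes polarized and R: "delta (\<lambda>e. R (e 0) (e (Suc 0)))"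
    and stable: "\<And>x. \<exists>t. (\<forall>s\<ge>t. R x s) \<or> (\<forall>s\<ge>t. \<not> R x s)"
  shows "\<exists>J\<in>S. (\<forall>x. \<exists>y\<in>J. x < y) \<and>
    ((\<forall>x\<in>J. \<forall>y\<in>J. x < y \<longrightarrow> R x y) \<or> (\<forall>x\<in>J. \<forall>y\<in>J. x < y \<longrightarrow> \<not> R x y))"
proof -
  obtain L M where LM: "fn (\<lambda>e. L (e 0))" "\<And>i. L i \<le> M i" "\<And>i. M i < L (i + 1)"
    "(\<forall>i j. i < j \<longrightarrow> R (L i) (M j)) \<or> (\<forall>i j. i < j \<longrightarrow> \<not> R (L i) (M j))"
    by (rule polarizedE[OF \<open>polarized\<close> R]) (rule that)
  from LM(4) show ?thesis
  proof
    assume "\<forall>i j. i < j \<longrightarrow> R (L i) (M j)"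
    then show ?thesis using stable_homogeneous_aux[OF assms LM(1-3)] by metis
  next
    assume "\<forall>i j. i < j \<longrightarrow> \<not> R (L i) (M j)"
    moreover have "\<exists>t. (\<forall>s\<ge>t. \<not> R x s) \<or> (\<forall>s\<ge>t. \<not> \<not> R x s)" for x using stable[of x] by metis
    ultimately show ?thesis
      using stable_homogeneous_aux[OF assms(1) delta_not[OF R] _ LM(1-3)] by metis
  qed
qed

section \<open>Semantics of the defined notions\<close>

text \<open>This and the following predicates have the shape in which simplification leaves the
  evaluated formulas, hence forms such as \<open>\<not> j < q \<and> j \<noteq> q\<close> for the
  negation of \<open>j \<le> q\<close>.\<close>

definition is_fun_set :: "'a set \<Rightarrow> bool" where
  "is_fun_set A \<longleftrightarrow> (\<forall>z. z \<in> A \<longrightarrow> (\<exists>x y. z = pr x y)) \<and> (\<forall>x. \<exists>y. pr x y \<in> A) \<and>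
    (\<forall>x y. pr x y \<in> A \<longrightarrow> (\<forall>z. pr x z \<in> A \<longrightarrow> y = z))"

definition sum_in :: "'a set \<Rightarrow> 'a \<Rightarrow> 'a \<Rightarrow> 'a \<Rightarrow> bool" where
  "sum_in A i n s \<longleftrightarrow> (\<exists>G\<in>S. pr 0 0 \<in> G \<and> is_fun_set G \<and>
    (\<forall>l u. pr l u \<in> G \<longrightarrow> (\<forall>v. pr (i + l) v \<in> A \<longrightarrow> pr (l + 1) (u + v) \<in> G)) \<and> pr n s \<in> G)"

definition pow2_set :: "'a set \<Rightarrow> bool" where
  "pow2_set P \<longleftrightarrow> is_fun_set P \<and> pr 0 1 \<in> P \<and> (\<forall>t u. pr t u \<in> P \<longrightarrow> pr (t + 1) (2 * u) \<in> P)"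

definition expansion :: "'a set \<Rightarrow> 'a \<Rightarrow> 'a \<Rightarrow> bool" where
  "expansion T q n \<longleftrightarrow> is_fun_set T \<and>
    (\<forall>i j. i < j \<longrightarrow> (\<forall>u. pr i u \<in> T \<longrightarrow>
      \<not> j < q \<and> j \<noteq> q \<or> (\<forall>v. pr j v \<in> T \<longrightarrow> u < v))) \<and>
    (\<exists>P\<in>S. pow2_set P \<and> (\<exists>Q\<in>S. is_fun_set Q \<and>
      (\<forall>l t. pr l t \<in> T \<longrightarrow> (\<forall>u. pr t u \<in> P \<longrightarrow> pr l u \<in> Q)) \<and> sum_in Q 0 (q + 1) n))"

definition apart_set :: "'a set \<Rightarrow> bool" where
  "apart_set H \<longleftrightarrow> (\<forall>x y. x \<in> H \<and> y \<in> H \<and> x < y \<longrightarrow>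
    (\<exists>a b. (\<exists>T\<in>S. \<exists>q. expansion T q x \<and> pr q a \<in> T) \<and>
      (\<exists>T\<in>S. \<exists>q. expansion T q y \<and> pr 0 b \<in> T) \<and> a < b))"

definition enumerates_set :: "'a set \<Rightarrow> 'a set \<Rightarrow> bool" where
  "enumerates_set A H \<longleftrightarrow> is_fun_set A \<and>
    (\<forall>i j. i < j \<longrightarrow> (\<forall>u. pr i u \<in> A \<longrightarrow> (\<forall>v. pr j v \<in> A \<longrightarrow> u < v))) \<and>
    (\<forall>y. (y \<in> H \<longrightarrow> (\<exists>i. pr i y \<in> A)) \<and> ((\<forall>i. pr i y \<notin> A) \<or> y \<in> H))"

definition adjacent_sum :: "'a set \<Rightarrow> 'a \<Rightarrow> bool" where
  "adjacent_sum H s \<longleftrightarrow> (\<exists>A\<in>S. enumerates_set A H \<and> (\<exists>i m. sum_in A i (m + 1) s))"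

lemma tval_num_tm [simp]: "tval \<rho> e (num_tm 2) = (2::'a)"
  by (simp add: eval_nat_numeral)

lemma tval_pair_tm [simp]: "tval \<rho> e (pair_tm s t) = pr (tval \<rho> e s) (tval \<rho> e t)"
  by (simp add: pair_tm_def pr_def)

lemma eval_val [simp]:
  "eval S \<rho> \<sigma> e E (val F s t) \<longleftrightarrow> pr (tval \<rho> e s) (tval \<rho> e t) \<in> sval \<sigma> E F"
  by (simp add: val_def)

lemma eval_is_fun [simp]: "eval S \<rho> \<sigma> e E (is_fun F) \<longleftrightarrow> is_fun_set (sval \<sigma> E F)"
  unfolding is_fun_def is_fun_set_def by simp

text \<open>The names bound in \<open>is_sum\<close> are fixed strings; the side conditions keep the
  arguments from being captured by them.\<close>

lemma eval_is_sum [simp]: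
  assumes "F \<noteq> SV ''G''" "{''l'', ''u'', ''v''} \<inter> (vars_tm i \<union> vars_tm n \<union> vars_tm s) = {}"
  shows "eval S \<rho> \<sigma> e E (is_sum F i n s) \<longleftrightarrow> sum_in (sval \<sigma> E F) (tval \<rho> e i) (tval \<rho> e n) (tval \<rho> e s)"
proof -
  have F: "sval \<sigma> (E(''G'' := A)) F = sval \<sigma> E F" for A
    using assms(1) by (cases F) auto
  have "tval \<rho> (e(''l'' := x, ''u'' := y, ''v'' := z)) i = tval \<rho> e i" for x y z
    using assms(2) by (intro tval_cong) auto
  then show ?thesis
    unfolding is_sum_def sum_in_def
    by (simp add: F)
qed

lemma eval_is_pow2 [simp]: "eval S \<rho> \<sigma> e E (is_pow2 P) \<longleftrightarrow> pow2_set (sval \<sigma> E P)"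
  unfolding is_pow2_def pow2_set_def by simp

lemma eval_expansion [simp]:
  "eval S \<rho> \<sigma> e E (is_binary_expansion (SV ''T'') (V ''q'') (V ''x'')) \<longleftrightarrow>
    expansion (E ''T'') (e ''q'') (e ''x'')"
  "eval S \<rho> \<sigma> e E (is_binary_expansion (SV ''T'') (V ''q'') (V ''y'')) \<longleftrightarrow>
    expansion (E ''T'') (e ''q'') (e ''y'')"
  unfolding is_binary_expansion_def expansion_def
  by simp_all

lemma eval_is_apart [simp]: "eval S \<rho> \<sigma> e E (is_apart X) \<longleftrightarrow> apart_set (sval \<sigma> E X)"
  unfolding is_apart_def apart_set_def is_mu_def is_lambda_def by simp

lemma eval_enumerates [simp]:
  "eval S \<rho> \<sigma> e E (enumerates A X) \<longleftrightarrow> enumerates_set (sval \<sigma> E A) (sval \<sigma> E X)"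
  unfolding enumerates_def enumerates_set_def by simp

lemma eval_in_AS [simp]:
  "eval S \<rho> \<sigma> e E (in_AS (SV ''H'') (V ''s'')) \<longleftrightarrow> adjacent_sum (E ''H'') (e ''s'')"
  unfolding in_AS_def adjacent_sum_def by simp

lemma eval_is_infinite [simp]:
  "eval S \<rho> \<sigma> e E (is_infinite X) \<longleftrightarrow> (\<forall>x. \<exists>y>x. y \<in> sval \<sigma> E X)"
  unfolding is_infinite_def by simp

lemma eval_is_fun_into [simp]:
  "eval S \<rho> \<sigma> e E (is_fun_into 2 X) \<longleftrightarrow>
    is_fun_set (sval \<sigma> E X) \<and> (\<forall>x y. pr x y \<in> sval \<sigma> E X \<longrightarrow> y < 2)"
  unfolding is_fun_into_def by simp

lemma eval_AHT:
  "eval S \<rho> \<sigma> e E (AHT 2) \<longleftrightarrow> (\<forall>C\<in>S. is_fun_set C \<and> (\<forall>x y. pr x y \<in> C \<longrightarrow> y < 2) \<longrightarrow>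
    (\<exists>H\<in>S. apart_set H \<and> (\<forall>x. \<exists>y>x. y \<in> H) \<and> (\<forall>x. x \<in> H \<longrightarrow> 0 < x) \<and>
      (\<exists>d<2. \<forall>s. adjacent_sum H s \<longrightarrow> pr s d \<in> C)))"
  unfolding AHT_def by simp

lemma eval_is_pair_coloring [simp]:
  "eval S \<rho> \<sigma> e E (is_pair_coloring 2 X) \<longleftrightarrow>
    (\<forall>z. z \<in> sval \<sigma> E X \<longrightarrow> (\<exists>x y. x < y \<and> (\<exists>i<2. z = pr (pr x y) i))) \<and>
    (\<forall>x y. x < y \<longrightarrow> (\<exists>i. pr (pr x y) i \<in> sval \<sigma> E X)) \<and>
    (\<forall>x y i. pr (pr x y) i \<in> sval \<sigma> E X \<longrightarrow> (\<forall>j. pr (pr x y) j \<in> sval \<sigma> E X \<longrightarrow> i = j))"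
  unfolding is_pair_coloring_def by simp

lemma eval_is_stable [simp]:
  "eval S \<rho> \<sigma> e E (is_stable 2 X) \<longleftrightarrow>
    (\<forall>x. \<exists>d<2. \<exists>t>x. \<forall>s. \<not> t < s \<and> t \<noteq> s \<or> pr (pr x s) d \<in> sval \<sigma> E X)"
  unfolding is_stable_def by simp

lemma eval_SRT2:
  "eval S \<rho> \<sigma> e E (SRT2 2) \<longleftrightarrow> (\<forall>F\<in>S.
    (\<forall>z. z \<in> F \<longrightarrow> (\<exists>x y. x < y \<and> (\<exists>i<2. z = pr (pr x y) i))) \<and>
    (\<forall>x y. x < y \<longrightarrow> (\<exists>i. pr (pr x y) i \<in> F)) \<and>
    (\<forall>x y i. pr (pr x y) i \<in> F \<longrightarrow> (\<forall>j. pr (pr x y) j \<in> F \<longrightarrow> i = j)) \<and>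
    (\<forall>x. \<exists>d<2. \<exists>t>x. \<forall>s. \<not> t < s \<and> t \<noteq> s \<or> pr (pr x s) d \<in> F) \<longrightarrow>
    (\<exists>J\<in>S. \<exists>d<2. (\<forall>x. \<exists>y>x. y \<in> J) \<and>
      (\<forall>x. x \<in> J \<longrightarrow> (\<forall>y. y \<in> J \<longrightarrow> x < y \<longrightarrow> pr (pr x y) d \<in> F))))"
  unfolding SRT2_def by simp

section \<open>Binary expansions and the coloring\<close>

text \<open>Searching \<open>x\<close> up to \<open>z\<close> is enough by \<open>pr_bounds\<close>
  and makes membership \<open>delta\<close>.\<close>

definition graph :: "('a \<Rightarrow> 'a) \<Rightarrow> 'a set" where
  "graph F = {z. \<exists>x\<le>z. z = pr x (F x)}"

lemma mem_graph [simp]: "pr x y \<in> graph F \<longleftrightarrow> y = F x"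
  using pr_bounds(1)[of x "F x"] by (auto simp: graph_def)

lemma graph_in_S:
  assumes "fn (\<lambda>e. F (e 0))"
  shows "graph F \<in> S"
  unfolding graph_def by (intro compr rec_intros fn_pr fn_fn1[OF assms])

lemma is_fun_graph: "is_fun_set (graph F)"
  unfolding is_fun_set_def by simp (auto simp: graph_def)

text \<open>Turns sets of the structure that code functions into HOL functions, on which the
  \<open>fn\<close> calculus and \<open>delta_induct\<close> work.\<close>

lemma fun_set_function:
  assumes "A \<in> S" "is_fun_set A"
  obtains F where "fn (\<lambda>e. F (e 0))" "\<And>x y. pr x y \<in> A \<longleftrightarrow> y = F x"
proof -
  have "\<exists>y. \<forall>z. pr x z \<in> A \<longleftrightarrow> z = y" for x
    using assms(2) unfolding is_fun_set_def by metis
  then obtain F where F: "\<And>x z. pr x z \<in> A \<longleftrightarrow> z = F x" by metis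
  have "fn (\<lambda>e. F (e 0))"
  proof (rule fn_graphI[where R = "\<lambda>v e. pr (e 0) v \<in> A"])
    show "s1 (\<lambda>e. pr (e (Suc 0)) (e 0) \<in> A)" by (intro delta_s1 delta_mem assms(1) fn_pr fn_var)
  qed (simp add: F)
  then show thesis using that F by blast
qed

lemma mult_pos_cancel: "0 < c \<Longrightarrow> c * a = c * b \<Longrightarrow> a = (b::'a)"
  using mul_less_mono'[of a b c] mul_less_mono'[of b a c] by (metis linorder_neqE order_less_irrefl)

lemma odd_neq_even: "2 * r + 1 \<noteq> 2 * (s::'a)"
proof
  assume "2 * r + 1 = 2 * s"
  then have "r * 2 + 1 = s * 2 + 0" by (simp add: mult.commute)
  from division_unique[OF this] show False
    by (metis less_iff_succ_less_eq one_add_one order_refl zero_less_numeral zero_neq_one)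
qed

section \<open>Powers of two, lowest and highest binary positions\<close>

context
  fixes pw :: "'a \<Rightarrow> 'a"
  assumes pw_0: "pw 0 = 1" and pw_succ: "\<And>x. pw (x + 1) = 2 * pw x"
    and pw_fn: "fn (\<lambda>e. pw (e 0))"
begin

lemmas pow = pw_pos[OF zero_less_numeral pw_0 pw_succ pw_fn] pw_less[OF zero_less_numeral pw_0 pw_succ pw_fn]

lemma fn_pow: "fn f \<Longrightarrow> fn (\<lambda>e. pw (f e))"
  by (rule fn_fn1[OF pw_fn])

lemma pow_mono: "a < b \<Longrightarrow> pw (a + 1) \<le> pw b"
proof -
  assume "a < b"
  then obtain r where r: "pw b = pw (a + 1) * r" using pow(2) by blast
  then have "0 < r" using pow(1)[of b] by (auto simp: pos_iff)
  then show ?thesis using le_mult_pos[of r "pw (a + 1)"] r by (simp add: mult.commute)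
qed

lemma less_pow_succ: "pw a < pw (a + 1)"
  using pow(1)[of a] by (simp add: pw_succ mult_2)

lemma pow_less_cancel: "pw a < pw b \<Longrightarrow> a < b"
  using pow_mono[of b a] less_pow_succ[of b] by (metis less_le_trans linorder_neqE order_less_asym)

lemma less_pow: "a < pw a"
proof (rule delta_induct[where x = a])
  show "delta (\<lambda>e. e 0 < pw (e 0))" by (intro rec_intros fn_pow)
  show "a + 1 < pw (a + 1)" if "a < pw a" for a
    using le_less_trans[OF _ less_pow_succ, of "a + 1" a] that by (simp add: less_iff_succ_less_eq)
qed (simp add: pw_0)

text \<open>Arithmetical versions of \<lambda> and \<mu>, by an odd cofactor and by two enclosing
  powers of two. They are \<open>delta\<close>, so that a coloring can be defined from them, whereas
  \<open>is_lambda\<close> and \<open>is_mu\<close> quantify over sets.\<close>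

definition lam :: "'a \<Rightarrow> 'a \<Rightarrow> bool" where
  "lam n a \<longleftrightarrow> (\<exists>r\<le>n. n = pw a * (2 * r + 1))"

definition mu :: "'a \<Rightarrow> 'a \<Rightarrow> bool" where
  "mu n b \<longleftrightarrow> pw b \<le> n \<and> n < pw (b + 1)"

lemma delta_lam: "fn n \<Longrightarrow> fn a \<Longrightarrow> delta (\<lambda>e. lam (n e) (a e))"
  unfolding lam_def by (intro rec_intros fn_pow fn_shift)

lemma delta_mu: "fn n \<Longrightarrow> fn b \<Longrightarrow> delta (\<lambda>e. mu (n e) (b e))"
  unfolding mu_def by (intro rec_intros fn_pow)

lemma lamI: "n = pw a * (2 * r + 1) \<Longrightarrow> lam n a"
proof -
  assume n: "n = pw a * (2 * r + 1)"
  have "r \<le> 2 * r + 1" by (simp add: mult_2 add.assoc)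
  also have "\<dots> \<le> n" unfolding n by (rule le_mult_pos[OF pow(1)])
  finally show ?thesis unfolding lam_def using n by blast
qed

lemma lam_unique:
  assumes "lam n a" "lam n a'"
  shows "a = a'"
proof -
  have "\<not> a < a'" if a: "lam n a" "lam n a'" for a a'
  proof
    assume "a < a'"
    then obtain z where z: "pw a' = pw (a + 1) * z" using pow(2) by blast
    obtain r r' where r: "n = pw a * (2 * r + 1)" "n = pw a' * (2 * r' + 1)"
      using a unfolding lam_def by blast
    have "pw a * (2 * r + 1) = pw a * (2 * (z * (2 * r' + 1)))"
      using r unfolding z pw_succ by (simp add: ac_simps)
    then have "2 * r + 1 = 2 * (z * (2 * r' + 1))" by (rule mult_pos_cancel[OF pow(1)])
    then show False using odd_neq_even by blast
  qed
  then show ?thesis using assms by (metis linorder_neqE)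
qed

lemma mu_unique: "mu n b \<Longrightarrow> mu n b' \<Longrightarrow> b = b'"
  unfolding mu_def using pow_mono by (metis le_less_trans less_le_trans linorder_neqE order_less_irrefl)

lemma lam_bounds: "lam n a \<Longrightarrow> pw a \<le> n" "lam n a \<Longrightarrow> a \<le> n"
proof -
  show *: "lam n a \<Longrightarrow> pw a \<le> n"
    using le_mult_pos[of "2 * r + 1" "pw a" for r] unfolding lam_def
    by (metis mult.commute pos_iff succ_nz)
  show "lam n a \<Longrightarrow> a \<le> n" using * less_pow[of a] by simp
qed

lemma mu_bound: "mu n b \<Longrightarrow> b \<le> n"
  using less_pow[of b] unfolding mu_def by (meson order_less_imp_le order_trans)

lemma lam_le_mu: "lam n a \<Longrightarrow> mu n b \<Longrightarrow> a \<le> b"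
  using pow_less_cancel[of a "b + 1"] lam_bounds(1) unfolding mu_def less_Suc by (meson le_less_trans)

text \<open>There is no carry: \<open>y\<close> is a multiple of \<open>pw a'\<close>, and
  \<open>x < pw a'\<close>. For the upper bound, \<open>y\<close> is less than
  \<open>pw (b' + 1)\<close> and both are multiples of \<open>pw a'\<close>, which leaves room for
  another \<open>pw a'\<close>.\<close>

lemma add_blocks:
  assumes x: "lam x a" "mu x b" and y: "lam y a'" "mu y b'" and "b < a'"
  shows "lam (x + y) a" "mu (x + y) b'"
proof -
  obtain r r' where r: "x = pw a * (2 * r + 1)" "y = pw a' * (2 * r' + 1)"
    using x y unfolding lam_def by blast
  have "a < a'" using lam_le_mu[OF x] assms(5) by simp
  then obtain z where z: "pw a' = pw (a + 1) * z" using pow(2) by blast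
  show "lam (x + y) a"
    by (rule lamI[where r = "r + z * (2 * r' + 1)"]) (simp only: r z pw_succ, simp add: algebra_simps)
  have "a' < b' + 1" using lam_le_mu[OF y] by (simp add: less_Suc)
  then obtain m where "pw (b' + 1) = pw (a' + 1) * m" using pow(2) by blast
  then have m: "pw (b' + 1) = (2 * m) * pw a'" unfolding pw_succ[of a'] by (simp add: ac_simps)
  have "x < pw (b + 1)" "y < pw (b' + 1)" "pw b' \<le> y" using x y by (auto simp: mu_def)
  have "x + y < pw a' + y" using \<open>x < _\<close> pow_mono[OF assms(5)] by simp
  also have "\<dots> = ((2 * r' + 1) + 1) * pw a'" unfolding r by (simp add: algebra_simps)
  also have "\<dots> \<le> (2 * m) * pw a'"
    by (rule less_mult_iff[where p = y]) (use r(2) \<open>y < _\<close> m in \<open>simp_all add: mult.commute\<close>)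
  also have "\<dots> = pw (b' + 1)" by (rule m[symmetric])
  finally have "x + y < pw (b' + 1)" .
  moreover have "pw b' \<le> x + y" using \<open>pw b' \<le> y\<close> by (metis add_increasing nonneg)
  ultimately show "mu (x + y) b'" by (simp add: mu_def)
qed

text \<open>Serves twice: for the powers of two in a binary expansion, and for adjacent elements of
  an apart set.\<close>

lemma sum_blocks:
  assumes fns: "fn (\<lambda>e. \<tau> (e 0))" "fn (\<lambda>e. b (e 0))"
    and \<tau>: "\<tau> 0 = 0" "\<And>l. \<tau> (l + 1) = \<tau> l + f l"
    and f: "\<And>l. l \<le> q \<Longrightarrow> lam (f l) (a l)" "\<And>l. l \<le> q \<Longrightarrow> mu (f l) (b l)"
    and gap: "\<And>l. l < q \<Longrightarrow> b l < a (l + 1)"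
  shows "lam (\<tau> (q + 1)) (a 0)" "mu (\<tau> (q + 1)) (b q)"
proof -
  have "l \<le> q \<longrightarrow> lam (\<tau> (l + 1)) (a 0) \<and> mu (\<tau> (l + 1)) (b l)" for l
  proof (rule delta_induct[where x = l])
    show "delta (\<lambda>e. e 0 \<le> q \<longrightarrow> lam (\<tau> (e 0 + 1)) (a 0) \<and> mu (\<tau> (e 0 + 1)) (b (e 0)))"
      by (intro rec_intros delta_lam delta_mu fn_fn1[OF fns(1)] fn_fn1[OF fns(2)])
    have "\<tau> (0 + 1) = f 0" using \<tau>(2)[of 0] \<tau>(1) by simp
    then show "0 \<le> q \<longrightarrow> lam (\<tau> (0 + 1)) (a 0) \<and> mu (\<tau> (0 + 1)) (b 0)" using f[of 0] by simp
    show "l + 1 \<le> q \<longrightarrow> lam (\<tau> ((l + 1) + 1)) (a 0) \<and> mu (\<tau> ((l + 1) + 1)) (b (l + 1))"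
      if IH: "l \<le> q \<longrightarrow> lam (\<tau> (l + 1)) (a 0) \<and> mu (\<tau> (l + 1)) (b l)" for l
    proof
      assume l: "l + 1 \<le> q"
      then have "l < q" by (simp add: less_iff_succ_less_eq)
      then have "lam (\<tau> (l + 1)) (a 0)" "mu (\<tau> (l + 1)) (b l)" using IH by auto
      from add_blocks[OF this f[OF l] gap[OF \<open>l < q\<close>]]
      show "lam (\<tau> ((l + 1) + 1)) (a 0) \<and> mu (\<tau> ((l + 1) + 1)) (b (l + 1))" by (simp add: \<tau>(2)[of "l + 1"])
    qed
  qed
  from this[of q] show "lam (\<tau> (q + 1)) (a 0)" "mu (\<tau> (q + 1)) (b q)" by auto
qed

section \<open>Evaluation of coded sums and expansions\<close>

lemma sum_in_function:
  assumes "sum_in A i n s" "\<And>x y. pr x y \<in> A \<longleftrightarrow> y = f x"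
  obtains \<tau> where "fn (\<lambda>e. \<tau> (e 0))" "\<tau> 0 = 0" "\<And>l. \<tau> (l + 1) = \<tau> l + f (i + l)" "s = \<tau> n"
proof -
  obtain G where G: "G \<in> S" "pr 0 0 \<in> G" "is_fun_set G"
    "\<And>l u v. pr l u \<in> G \<Longrightarrow> pr (i + l) v \<in> A \<Longrightarrow> pr (l + 1) (u + v) \<in> G" "pr n s \<in> G"
    using assms(1) unfolding sum_in_def by blast
  obtain \<tau> where \<tau>: "fn (\<lambda>e. \<tau> (e 0))" "\<And>x y. pr x y \<in> G \<longleftrightarrow> y = \<tau> x"
    by (rule fun_set_function[OF G(1,3)]) (rule that)
  have "\<tau> (l + 1) = \<tau> l + f (i + l)" for l
    using G(4)[of l "\<tau> l" "f (i + l)"] assms(2) \<tau>(2) by metis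
  moreover have "\<tau> 0 = 0" "s = \<tau> n" using G(2,5) \<tau>(2) by auto
  ultimately show thesis using that \<tau>(1) by blast
qed

lemma pow2_set_pow:
  assumes "P \<in> S" "pow2_set P"
  shows "pr x y \<in> P \<longleftrightarrow> y = pw x"
proof -
  have P: "is_fun_set P" "pr 0 1 \<in> P" "\<And>t u. pr t u \<in> P \<Longrightarrow> pr (t + 1) (2 * u) \<in> P"
    using assms(2) unfolding pow2_set_def by auto
  obtain g where g: "fn (\<lambda>e. g (e 0))" "\<And>x y. pr x y \<in> P \<longleftrightarrow> y = g x"
    by (rule fun_set_function[OF assms(1) P(1)]) (rule that)
  have "g x = pw x"
  proof (rule delta_induct[where x = x])
    show "delta (\<lambda>e. g (e 0) = pw (e 0))" by (intro rec_intros fn_fn1[OF g(1)] fn_pow)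
    show "g (x + 1) = pw (x + 1)" if "g x = pw x" for x
      using P(3)[of x "g x"] g(2) that by (simp add: pw_succ)
  qed (use P(2) g(2) in \<open>simp add: pw_0\<close>)
  then show ?thesis using g(2) by simp
qed

text \<open>The implications go only from expansions to \<open>lam\<close> and \<open>mu\<close>, as
  apartness supplies the expansions. The summands are blocks \<open>pw (t l)\<close> whose lowest
  and highest positions are both \<open>t l\<close>.\<close>

lemma expansion_lam_mu:
  assumes "T \<in> S" "expansion T q n"
  shows "pr 0 a \<in> T \<Longrightarrow> lam n a" "pr q b \<in> T \<Longrightarrow> mu n b"
    "\<exists>a. lam n a" "\<exists>b. mu n b"
proof -
  note exp = assms(2)[unfolded expansion_def]
  have T: "is_fun_set T" "\<And>i j u v. i < j \<Longrightarrow> pr i u \<in> T \<Longrightarrow> j \<le> q \<Longrightarrow> pr j v \<in> T \<Longrightarrow> u < v"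
    using exp order_le_less by blast+
  obtain P where P: "P \<in> S" "pow2_set P" and Q: "\<exists>Q\<in>S. is_fun_set Q \<and>
      (\<forall>l t. pr l t \<in> T \<longrightarrow> (\<forall>u. pr t u \<in> P \<longrightarrow> pr l u \<in> Q)) \<and> sum_in Q 0 (q + 1) n"
    using exp by blast
  from Q obtain Q where Q: "is_fun_set Q" "sum_in Q 0 (q + 1) n"
    "\<forall>l t. pr l t \<in> T \<longrightarrow> (\<forall>u. pr t u \<in> P \<longrightarrow> pr l u \<in> Q)" by blast
  obtain t where t: "fn (\<lambda>e. t (e 0))" "\<And>x y. pr x y \<in> T \<longleftrightarrow> y = t x"
    by (rule fun_set_function[OF assms(1) T(1)]) (rule that)
  have "pr l (pw (t l)) \<in> Q" for l
    using Q(3) t(2) pow2_set_pow[OF P] by simp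
  then have Qt: "pr x y \<in> Q \<longleftrightarrow> y = pw (t x)" for x y
    using Q(1) unfolding is_fun_set_def by metis
  obtain \<tau> where \<tau>: "fn (\<lambda>e. \<tau> (e 0))" "\<tau> 0 = 0" "\<And>l. \<tau> (l + 1) = \<tau> l + pw (t (0 + l))" "n = \<tau> (q + 1)"
    by (rule sum_in_function[OF Q(2) Qt]) (rule that)
  have "lam (pw x) x" "mu (pw x) x" for x
    using less_pow_succ[of x] by (auto intro!: lamI[where r = 0] simp: mu_def)
  moreover have "t l < t (l + 1)" if "l < q" for l
    using T(2)[of l "l + 1"] t(2) that by (metis less_Suc less_iff_succ_less_eq order_refl)
  ultimately have *: "lam n (t 0)" "mu n (t q)"
    using sum_blocks[OF \<tau>(1) t(1) \<tau>(2,3), where a = t and q = q] \<tau>(4) by simp_all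
  show "pr 0 a \<in> T \<Longrightarrow> lam n a" "pr q b \<in> T \<Longrightarrow> mu n b" using * t(2) by auto
  show "\<exists>a. lam n a" "\<exists>b. mu n b" using * by blast+
qed

section \<open>Enumerations and adjacent sums inside the structure\<close>

lemma enumeration_exists:
  assumes H: "H \<in> S" and infinite: "\<And>x. \<exists>y>x. y \<in> H" and pos: "\<And>x. x \<in> H \<Longrightarrow> 0 < x"
  obtains h where "fn (\<lambda>e. h (e 0))" "\<And>i. h i < h (i + 1)" "\<And>y. y \<in> H \<longleftrightarrow> (\<exists>i. y = h i)"
proof -
  define N where "N v x \<longleftrightarrow> v \<in> H \<and> x < v \<and> (\<forall>w<v. w \<in> H \<longrightarrow> \<not> x < w)" for v x
  have N1: "delta (\<lambda>e. N (e 0) (e (Suc 0)))" unfolding N_def by (intro rec_intros H)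
  have N2: "\<exists>v. N v x" for x
  proof -
    have P: "s1 (\<lambda>e. e 0 \<in> H \<and> x < e 0)" by (intro delta_s1 rec_intros H)
    obtain y where y: "y \<in> H \<and> x < y" using infinite by blast
    obtain m where "m \<in> H \<and> x < m" "\<And>w. w < m \<Longrightarrow> \<not> (w \<in> H \<and> x < w)"
      by (rule s1_least[of "\<lambda>v. v \<in> H \<and> x < v", OF P y]) (rule that)
    then have "N m x" unfolding N_def by simp
    then show ?thesis ..
  qed
  obtain s where s: "fn (\<lambda>e. s (e 0))" "\<And>x. N (s x) x"
    by (rule least_fn1[of N, OF N1 N2]) (rule that)
  have "fn (\<lambda>e. s (e (Suc 0)))" by (intro fn_fn1[OF s(1)] fn_var)
  \<comment> \<open>\<open>s\<close> finds the next element of \<open>H\<close>. Starting from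
    \<open>s 0\<close> catches the least one, as all elements are positive.\<close>
  from prim_rec[where G = "\<lambda>_ v. s v", OF this, of "s 0"]
  obtain h where h: "h 0 = s 0" "\<And>x. h (x + 1) = s (h x)" "fn (\<lambda>e. h (e 0))" by blast
  have step: "h i < h (i + 1)" for i using s(2)[of "h i"] by (simp add: h(2) N_def)
  note inc = increasing[OF h(3) step]
  have "h i \<in> H" for i
    using s(2) h(1,2) unfolding N_def by (cases i rule: succ_cases) metis+
  moreover have "\<exists>i. y = h i" if y: "y \<in> H" for y
  proof -
    have P: "s1 (\<lambda>e. h (e 0) \<le> y)" by (intro delta_s1 rec_intros fn_fn1[OF h(3)])
    have "h 0 \<le> y" using s(2)[of 0] pos[OF y] y unfolding h(1) N_def by (meson not_less)
    moreover have "i \<le> y" if "h i \<le> y" for i using inc(1)[of i] that by simp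
    ultimately obtain i where i: "h i \<le> y" "\<And>j. h j \<le> y \<Longrightarrow> j \<le> i"
      using s1_greatest[of "\<lambda>i. h i \<le> y" 0 y, OF P] by blast
    have "\<not> h (i + 1) \<le> y" using i(2)[of "i + 1"] less_Suc[of i i] by (metis not_less order_refl)
    moreover have "h i < y \<Longrightarrow> h (i + 1) \<le> y"
      using s(2)[of "h i"] y unfolding h(2) N_def by (meson not_less)
    ultimately show ?thesis using i(1) by (metis order_le_less)
  qed
  ultimately show thesis using that[OF h(3) step] by blast
qed

lemma adjacent_sum_exists:
  assumes h: "fn (\<lambda>e. h (e 0))" "\<And>i. h i < h (i + 1)" "\<And>y. y \<in> H \<longleftrightarrow> (\<exists>i. y = h i)"
  obtains \<tau> where "fn (\<lambda>e. \<tau> (e 0))" "\<tau> 0 = 0" "\<And>l. \<tau> (l + 1) = \<tau> l + h (i + l)"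
    "\<And>m. adjacent_sum H (\<tau> (m + 1))"
proof -
  have "fn (\<lambda>e. e (Suc 0) + h (i + e 0))" by (intro rec_intros fn_fn1[OF h(1)])
  from prim_rec[where G = "\<lambda>l v. v + h (i + l)", OF this, of 0]
  obtain \<tau> where \<tau>: "\<tau> 0 = 0" "\<And>l. \<tau> (l + 1) = \<tau> l + h (i + l)" "fn (\<lambda>e. \<tau> (e 0))" by blast
  have "sum_in (graph h) i n (\<tau> n)" for n
    unfolding sum_in_def
    by (intro bexI[of _ "graph \<tau>"] graph_in_S \<tau>(3)) (simp add: is_fun_graph \<tau>)
  moreover have "enumerates_set (graph h) H"
    unfolding enumerates_set_def using increasing(2)[OF h(1,2)] h(3) by (simp add: is_fun_graph) blast
  ultimately have "adjacent_sum H (\<tau> (m + 1))" for m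
    unfolding adjacent_sum_def using graph_in_S[OF h(1)] by blast
  then show thesis using that \<tau> by blast
qed

end

lemma less_two: "d < 2 \<longleftrightarrow> d = 0 \<or> d = (1::'a)"
  using less_succ[of d 1] less_succ[of d 0] by (simp add: one_add_one)

lemma AHT_polarized:
  assumes aht: "\<And>C. C \<in> S \<Longrightarrow> is_fun_set C \<Longrightarrow> (\<And>x y. pr x y \<in> C \<Longrightarrow> y < 2) \<Longrightarrow>
    \<exists>H\<in>S. apart_set H \<and> (\<forall>x. \<exists>y>x. y \<in> H) \<and> (\<forall>x. x \<in> H \<longrightarrow> 0 < x) \<and>
      (\<exists>d<2. \<forall>s. adjacent_sum H s \<longrightarrow> pr s d \<in> C)"
  shows polarized
  unfolding polarized_def
proof (intro allI impI)
  fix R assume R: "delta (\<lambda>e. R (e 0) (e (Suc 0)))"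
  have "fn (\<lambda>e. 2 * e (Suc 0))" by (intro rec_intros)
  from prim_rec[where G = "\<lambda>_ v. 2 * v", OF this, of 1]
  obtain pw where pw: "pw 0 = 1" "\<And>x. pw (x + 1) = 2 * pw x" "fn (\<lambda>e. pw (e 0))" by blast
  let ?lam = "lam pw" and ?mu = "mu pw"
  \<comment> \<open>The bounds hold for every \<open>a\<close> and \<open>b\<close> in question and
    keep the color computable. Where none exist, as at \<open>n = 0\<close>, the default is
    \<open>0\<close>.\<close>
  define color where "color n = (if \<exists>a\<le>n. \<exists>b\<le>n. ?lam n a \<and> ?mu n b \<and> R a b then 1 else (0::'a))" for n
  have "fn (\<lambda>e. color (e 0))"
    unfolding color_def
    by (intro rec_intros delta_lam[OF pw] delta_mu[OF pw] delta_fn2[OF R])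
  then have "graph color \<in> S" by (rule graph_in_S)
  moreover have "y < 2" if "pr x y \<in> graph color" for x y
    using that less_two by (simp add: color_def)
  ultimately obtain H d where H: "H \<in> S" "apart_set H" "\<And>x. \<exists>y>x. y \<in> H" "\<And>x. x \<in> H \<Longrightarrow> 0 < x"
    and d: "\<And>s. adjacent_sum H s \<Longrightarrow> d = color s"
    using aht[of "graph color"] is_fun_graph mem_graph by metis
  obtain h where h: "fn (\<lambda>e. h (e 0))" "\<And>i. h i < h (i + 1)" "\<And>y. y \<in> H \<longleftrightarrow> (\<exists>i. y = h i)"
    by (rule enumeration_exists[OF pw H(1,3,4)]) (assumption | rule that)+
  have lam_mu: "\<exists>a. ?lam (h i) a" "\<exists>b. ?mu (h i) b" for i
  proof -
    \<comment> \<open>Apartness speaks of pairs only, so the expansion of \<open>h i\<close> is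
      taken from the pair with \<open>h (i + 1)\<close>.\<close>
    have "h i \<in> H" "h (i + 1) \<in> H" "h i < h (i + 1)" using h by blast+
    then obtain T q where "T \<in> S" "expansion T q (h i)" using H(2) unfolding apart_set_def by blast
    then show "\<exists>a. ?lam (h i) a" "\<exists>b. ?mu (h i) b" using expansion_lam_mu(3,4)[OF pw] by blast+
  qed
  have lam1: "delta (\<lambda>e. ?lam (h (e (Suc 0))) (e 0))" "delta (\<lambda>e. ?mu (h (e (Suc 0))) (e 0))"
    by (intro delta_lam[OF pw] delta_mu[OF pw] fn_fn1[OF h(1)] fn_var)+
  obtain L where L: "fn (\<lambda>e. L (e 0))" "\<And>i. ?lam (h i) (L i)"
    by (rule least_fn1[of "\<lambda>v i. ?lam (h i) v", OF lam1(1) lam_mu(1)]) (rule that)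
  obtain M where M: "fn (\<lambda>e. M (e 0))" "\<And>i. ?mu (h i) (M i)"
    by (rule least_fn1[of "\<lambda>v i. ?mu (h i) v", OF lam1(2) lam_mu(2)]) (rule that)
  have LM: "L i \<le> M i" for i using lam_le_mu[OF pw L(2) M(2)] .
  have gap: "M i < L (i + 1)" for i
  proof -
    have "h i \<in> H" "h (i + 1) \<in> H" "h i < h (i + 1)" using h by blast+
    then obtain a b T q T' q' where "T \<in> S" "expansion T q (h i)" "pr q a \<in> T"
      "T' \<in> S" "expansion T' q' (h (i + 1))" "pr 0 b \<in> T'" "a < b"
      using H(2) unfolding apart_set_def by metis
    then have "?mu (h i) a" "?lam (h (i + 1)) b" using expansion_lam_mu(1,2)[OF pw] by blast+
    then have "a = M i" "b = L (i + 1)" using lam_unique[OF pw] mu_unique[OF pw] L(2) M(2) by blast+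
    with \<open>a < b\<close> show ?thesis by simp
  qed
  have color: "d = 1 \<longleftrightarrow> R (L i) (M j)" if ij: "i < j" for i j
  proof -
    \<comment> \<open>The sum from \<open>h i\<close> to \<open>h j\<close> has \<open>m + 1\<close>
      terms; its lowest block is \<open>h i\<close> and its highest is \<open>h j\<close>, so its
      color tells whether \<open>R (L i) (M j)\<close> holds.\<close>
    obtain m where m: "j = i + m" using le_ex ij order_less_imp_le by blast
    obtain \<tau> where \<tau>: "fn (\<lambda>e. \<tau> (e 0))" "\<tau> 0 = 0" "\<And>l. \<tau> (l + 1) = \<tau> l + h (i + l)"
      "\<And>m. adjacent_sum H (\<tau> (m + 1))"
      by (rule adjacent_sum_exists[OF pw h]) (assumption | rule that)+
    have fM: "fn (\<lambda>e. M (i + e 0))" by (intro fn_fn1[OF M(1)] rec_intros)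
    have gap': "M (i + l) < L (i + (l + 1))" for l using gap[of "i + l"] by (simp add: add.assoc)
    have s: "?lam (\<tau> (m + 1)) (L (i + 0))" "?mu (\<tau> (m + 1)) (M (i + m))"
      by (rule sum_blocks[OF pw \<tau>(1) fM \<tau>(2,3) L(2) M(2) gap'])+
    have "d = color (\<tau> (m + 1))" using d \<tau>(4) by blast
    moreover have "(\<exists>a\<le>\<tau> (m + 1). \<exists>b\<le>\<tau> (m + 1). ?lam (\<tau> (m + 1)) a \<and> ?mu (\<tau> (m + 1)) b \<and> R a b) \<longleftrightarrow>
        R (L i) (M j)"
      using s lam_bounds(2)[OF pw s(1)] mu_bound[OF pw s(2)] lam_unique[OF pw s(1)] mu_unique[OF pw s(2)] m
      by (metis add_0r)
    ultimately show ?thesis by (simp add: color_def)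
  qed
  show "\<exists>L M. fn (\<lambda>e. L (e 0)) \<and> fn (\<lambda>e. M (e 0)) \<and> (\<forall>i. L i \<le> M i \<and> M i < L (i + 1)) \<and>
      ((\<forall>i j. i < j \<longrightarrow> R (L i) (M j)) \<or> (\<forall>i j. i < j \<longrightarrow> \<not> R (L i) (M j)))"
    by (rule exI[of _ L], rule exI[of _ M], cases "d = 1") (use L(1) M(1) LM gap color in auto)
qed

lemma AHT_implies_SRT2:
  assumes "eval S \<rho> \<sigma> e E (AHT 2)"
  shows "eval S \<rho> \<sigma> e E (SRT2 2)"
  unfolding eval_SRT2
proof (intro ballI impI, elim conjE)
  fix F assume F: "F \<in> S" "\<forall>z. z \<in> F \<longrightarrow> (\<exists>x y. x < y \<and> (\<exists>i<2. z = pr (pr x y) i))"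
    "\<forall>x y. x < y \<longrightarrow> (\<exists>i. pr (pr x y) i \<in> F)"
    "\<forall>x y i. pr (pr x y) i \<in> F \<longrightarrow> (\<forall>j. pr (pr x y) j \<in> F \<longrightarrow> i = j)"
    and stable: "\<forall>x. \<exists>d<2. \<exists>t>x. \<forall>s. \<not> t < s \<and> t \<noteq> s \<or> pr (pr x s) d \<in> F"
  have polarized
    using assms unfolding eval_AHT by (intro AHT_polarized) blast
  define R where "R x y \<longleftrightarrow> pr (pr x y) 1 \<in> F" for x y
  have delta_R: "delta (\<lambda>e. R (e 0) (e (Suc 0)))"
    unfolding R_def by (intro delta_mem F(1) fn_pr rec_intros)
  have "\<exists>t. (\<forall>s\<ge>t. R x s) \<or> (\<forall>s\<ge>t. \<not> R x s)" for x
  proof -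
    obtain d t where dt: "d < 2" "\<And>s. t \<le> s \<Longrightarrow> pr (pr x s) d \<in> F"
      using stable by (metis order_le_less)
    have "d = 0 \<or> d = 1" using dt(1) less_two by blast
    then show ?thesis using dt(2) F(4) unfolding R_def by (metis zero_neq_one)
  qed
  from stable_homogeneous[OF \<open>polarized\<close> delta_R this]
  obtain J where J: "J \<in> S" "\<And>x. \<exists>y\<in>J. x < y"
    "(\<forall>x\<in>J. \<forall>y\<in>J. x < y \<longrightarrow> R x y) \<or> (\<forall>x\<in>J. \<forall>y\<in>J. x < y \<longrightarrow> \<not> R x y)" by blast
  have not_R: "pr (pr x y) 0 \<in> F" if xy: "x < y" "\<not> R x y" for x y
  proof -
    obtain i where i: "pr (pr x y) i \<in> F" using F(3) xy(1) by blast
    then obtain x' y' i' where "i' < 2" "pr (pr x y) i = pr (pr x' y') i'" using F(2) by blast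
    then have "i = 0 \<or> i = 1" using less_two by simp
    then show ?thesis using i xy(2) unfolding R_def by blast
  qed
  have "\<exists>d<2. \<forall>x. x \<in> J \<longrightarrow> (\<forall>y. y \<in> J \<longrightarrow> x < y \<longrightarrow> pr (pr x y) d \<in> F)"
    using J(3)
  proof
    assume "\<forall>x\<in>J. \<forall>y\<in>J. x < y \<longrightarrow> R x y"
    then show ?thesis using less_two[of 1] unfolding R_def by blast
  next
    assume "\<forall>x\<in>J. \<forall>y\<in>J. x < y \<longrightarrow> \<not> R x y"
    then show ?thesis using less_two[of 0] not_R by blast
  qed
  then show "\<exists>J\<in>S. \<exists>d<2. (\<forall>x. \<exists>y>x. y \<in> J) \<and>
      (\<forall>x. x \<in> J \<longrightarrow> (\<forall>y. y \<in> J \<longrightarrow> x < y \<longrightarrow> pr (pr x y) d \<in> F))"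
    using J(1,2) by blast
qed

end

theorem mainTheorem4: "RCA0 \<^bold>\<turnstile> (AHT 2 \<^bold>\<longrightarrow> SRT2 2)"
proof (rule ccontr)
  assume no: "\<not> RCA0 \<^bold>\<turnstile> (AHT 2 \<^bold>\<longrightarrow> SRT2 2)"
  then interpret henkin_rca0 RCA0 "\<^bold>\<not> target" name_of by (rule henkin_model_counter)
  interpret arith: rca0_arith Sets ..
  have "(\<^bold>\<not> target) \<in> H" by (rule p0_in_H)
  moreover have "free_vars (\<^bold>\<not> target) = {}" "free_svars (\<^bold>\<not> target) = {}"
    unfolding AHT_def SRT2_def is_fun_into_def is_fun_def val_def pair_tm_def is_infinite_def
      is_apart_def is_mu_def is_lambda_def is_binary_expansion_def is_pow2_def is_sum_def in_AS_def
      enumerates_def is_pair_coloring_def is_stable_def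
    by (auto simp: eval_nat_numeral)
  ultimately have "ev undefined undefined (\<^bold>\<not> target)" using truth by blast
  then show False using arith.AHT_implies_SRT2 by simp
qed

end
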